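(* Let $K\ge3$ and consider the $K$-receiver DM BC with message index set $\mathsf{E}=\{\overline{\{K\}},\overline{\{K-1\}}\}$, $S_p=[1:K-2]$. Suppose the channel belongs to one of the classes (A) $Y_j$ is more capable than $Y_{K-1}$ for all $j\in S_p$, and $Y_{K-1}$ is more capable than $Y_K$; (B) $Y_i$ is less noisy than $Y_K$ for all $i\in S_p\cup\{K-1\}$. Then the capacity region is the set of rate pairs $(R_{\overline{K}},R_{\overline{K-1}})$ such that for some pmf $p(u,x)$ (with $U$ finite and $U\to X\to(Y_1,\dots,Y_K)$ a Markov chain) $R_{\overline{K-1}}\le I(U;Y_K)$, $R_{\overline{K-1}}+R_{\overline{K}}\le I(X;Y_j|U)+I(U;Y_K)$ for all $j\in S_p\cup\{K-1\}$, $R_{\overline{K-1}}+R_{\overline{K}}\le I(X;Y_{K-1})$.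
   Context: DM BC with finite alphabets and transition pmf $W(y_1,\dots,y_K|x)$ used memorylessly without feedback; message $M_S$ required by all receivers in $S$; achievability and capacity region in the usual sense (error probability: some receiver mis-decodes a required message). $M_{\overline{K}}$ is the message required by receivers $1,\dots,K-1$ and $M_{\overline{K-1}}$ the message required by receivers in $[1:K]\setminus\{K-1\}$. Receiver $Y_s$ is less noisy than $Y_c$ if $I(U;Y_s)\ge I(U;Y_c)$ for all $p(u,x)$ with $U\to X\to(Y_s,Y_c)$. Receiver $Y_s$ is more capable than $Y_c$ if $I(X;Y_s)\ge I(X;Y_c)$ for all $p(x)$. *)

theory Defs
  imports "HOL-Probability.Probability"
begin

text \<open>A K-receiver DM BC: input alphabet 'x (finite type), output alphabet 'y (finite type,
  common to all receivers). W x is the joint pmf of the output tuple (Y_1,...,Y_K), represented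
  as a list of length K; receiver j (1 \<le> j \<le> K) sees component j-1.\<close>

definition mi :: "('a \<times> 'b) pmf \<Rightarrow> real" where
  "mi P = (\<Sum>t\<in>set_pmf P. pmf P t *
      log 2 (pmf P t / (pmf (map_pmf fst P) (fst t) * pmf (map_pmf snd P) (snd t))))"

definition cmi :: "('c \<times> 'a \<times> 'b) pmf \<Rightarrow> real" where
  "cmi P = (\<Sum>t\<in>set_pmf P. pmf P t *
      log 2 (pmf P t * pmf (map_pmf fst P) (fst t) /
        (pmf (map_pmf (\<lambda>(c,a,b). (c,a)) P) (fst t, fst (snd t)) *
         pmf (map_pmf (\<lambda>(c,a,b). (c,b)) P) (fst t, snd (snd t)))))"

text \<open>Joint pmf of (U,X,(Y_1..Y_K)) for p(u,x); Markov chain U -> X -> Y by construction.\<close>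
definition bc_joint :: "('x \<Rightarrow> 'y list pmf) \<Rightarrow> ('u \<times> 'x) pmf \<Rightarrow> ('u \<times> 'x \<times> 'y list) pmf" where
  "bc_joint W p = p \<bind> (\<lambda>(u,x). map_pmf (\<lambda>ys. (u,x,ys)) (W x))"

definition I_UY :: "('x \<Rightarrow> 'y list pmf) \<Rightarrow> ('u \<times> 'x) pmf \<Rightarrow> nat \<Rightarrow> real" where
  "I_UY W p j = mi (map_pmf (\<lambda>(u,x,ys). (u, ys ! (j - 1))) (bc_joint W p))"

definition I_XY_given_U :: "('x \<Rightarrow> 'y list pmf) \<Rightarrow> ('u \<times> 'x) pmf \<Rightarrow> nat \<Rightarrow> real" where
  "I_XY_given_U W p j = cmi (map_pmf (\<lambda>(u,x,ys). (u, x, ys ! (j - 1))) (bc_joint W p))"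

definition I_XY :: "('x \<Rightarrow> 'y list pmf) \<Rightarrow> 'x pmf \<Rightarrow> nat \<Rightarrow> real" where
  "I_XY W px j = mi (px \<bind> (\<lambda>x. map_pmf (\<lambda>ys. (x, ys ! (j - 1))) (W x)))"

definition less_noisy :: "('x \<Rightarrow> 'y list pmf) \<Rightarrow> nat \<Rightarrow> nat \<Rightarrow> bool" where
  "less_noisy W s c \<longleftrightarrow>
     (\<forall>p :: (nat \<times> 'x) pmf. finite (set_pmf p) \<longrightarrow> I_UY W p c \<le> I_UY W p s)"

definition more_capable :: "('x \<Rightarrow> 'y list pmf) \<Rightarrow> nat \<Rightarrow> nat \<Rightarrow> bool" where
  "more_capable W s c \<longleftrightarrow> (\<forall>px :: 'x pmf. I_XY W px c \<le> I_XY W px s)"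

fun channel_out :: "('x \<Rightarrow> 'y list pmf) \<Rightarrow> 'x list \<Rightarrow> 'y list list pmf" where
  "channel_out W [] = return_pmf []"
| "channel_out W (x # xs) = W x \<bind> (\<lambda>y. channel_out W xs \<bind> (\<lambda>ys. return_pmf (y # ys)))"

definition recv :: "nat \<Rightarrow> 'y list list \<Rightarrow> 'y list" where
  "recv j ys = map (\<lambda>y. y ! (j - 1)) ys"

definition msg_size :: "nat \<Rightarrow> real \<Rightarrow> nat" where
  "msg_size n R = nat \<lceil>2 powr (real n * R)\<rceil>"

text \<open>Average error probability of a code for message set E = {M_{K-bar}, M_{(K-1)-bar}}:
  M1 = M_{K-bar} is required by receivers 1..K-1, M2 = M_{(K-1)-bar} by receivers
  [1:K] minus K-1. Each decoder g j outputs a pair of message estimates; only the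
  components of required messages are checked. Messages are uniform on {0..<N1} x {0..<N2}.\<close>
definition avg_err :: "('x \<Rightarrow> 'y list pmf) \<Rightarrow> nat \<Rightarrow> nat \<Rightarrow> nat \<Rightarrow>
     (nat \<Rightarrow> nat \<Rightarrow> 'x list) \<Rightarrow> (nat \<Rightarrow> 'y list \<Rightarrow> nat \<times> nat) \<Rightarrow> real" where
  "avg_err W K N1 N2 f g =
     (\<Sum>m1<N1. \<Sum>m2<N2. measure_pmf.prob (channel_out W (f m1 m2))
        {ys. \<exists>j\<in>{1..K}.
              (j \<noteq> K \<and> fst (g j (recv j ys)) \<noteq> m1) \<or>
              (j \<noteq> K - 1 \<and> snd (g j (recv j ys)) \<noteq> m2)}) / (real N1 * real N2)"

definition achievable :: "('x \<Rightarrow> 'y list pmf) \<Rightarrow> nat \<Rightarrow> real \<times> real \<Rightarrow> bool" where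
  "achievable W K R \<longleftrightarrow> fst R \<ge> 0 \<and> snd R \<ge> 0 \<and>
     (\<forall>\<epsilon>>0. \<exists>N. \<forall>n\<ge>N. \<exists>f g.
        (\<forall>m1<msg_size n (fst R). \<forall>m2<msg_size n (snd R). length (f m1 m2) = n) \<and>
        avg_err W K (msg_size n (fst R)) (msg_size n (snd R)) f g \<le> \<epsilon>)"

definition capacity_region :: "('x \<Rightarrow> 'y list pmf) \<Rightarrow> nat \<Rightarrow> (real \<times> real) set" where
  "capacity_region W K = closure {R. achievable W K R}"

end

theory Submission
  imports Defs "HOL-Real_Asymp.Real_Asymp"
begin

text \<open>Converse: write \<open>y = K - 1\<close> and \<open>z = K\<close>. Up to Fano terms,
  \<open>log N1 + log N2\<close> is at most \<open>I(M2; Y_z^n) + I(X^n; Y_j^n | M2)\<close>.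
  In class (A), for \<open>j = y\<close>, this equals
  \<open>I(X^n; Y_z^n) + (I(X^n; Y_y^n | M2) - I(X^n; Y_z^n | M2))\<close>, and the difference telescopes when the outputs
  of \<open>z\<close> are exchanged for those of \<open>y\<close> one time index after the other; this gives the auxiliary
  variable \<open>U_i = (M2, Y_y^{<i}, Y_z^{>i})\<close>. In class (B) the less noisy ordering lets the past of
  receiver \<open>j\<close> be replaced by that of receiver \<open>z\<close>, so that \<open>U_i = (M2, Y_z^{<i})\<close> works for all \<open>j\<close>
  at once.
  A bound on the support of \<open>U\<close> and compactness remove the vanishing slack.

  Achievability: part of the message \<open>M1\<close> is moved into the cloud centre of a superposition code, which is
  all that receiver \<open>K\<close> decodes, while the receivers \<open>1..K-1\<close> decode both messages; the conditions for
  this reduce to the stated ones because \<open>I(X;Y_j)\<close> dominates the last bound in either class.\<close>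

subsection \<open>Entropies of kernel outputs\<close>

text \<open>In class (B) it follows from the second bound at j = K-1 and I(U;Y_K) <= I(U;Y_{K-1}).
  In class (A) the order of the messages is reversed: Fano for M1 at Y_{K-1}, then for M2 at Y_K
  given M1; the exchange of outputs is run once more, conditioned on M1, where the more capable
  ordering makes it an inequality in the right direction.

  The converse works with functionals of the unnormalised vectors p(u,.). The orderings then become
  statements about nonnegative vectors: more capable is a pointwise inequality for
  \<open>out_ent\<close> minus \<open>noise_ent\<close>, less noisy is superadditivity of a
  difference of two \<open>out_ent\<close>. They apply to auxiliary variables of any type with
  finite support, although the hypotheses speak of a \<open>nat\<close>-valued U or of no U at all.

  In the coding part the number of wrong candidates is counted exactly, so that the error terms
  vanish at rate 0. This covers the boundary cases in which a mutual information is itself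
  0.\<close>

definition eta :: "real \<Rightarrow> real" where
  "eta t = - t * log 2 t"

lemma eta_0 [simp]: "eta 0 = 0" and eta_1 [simp]: "eta 1 = 0"
  by (simp_all add: eta_def)

lemma eta_mult:
  assumes "a \<ge> 0" "b \<ge> 0"
  shows "eta (a * b) = a * eta b + b * eta a"
proof (cases "a = 0 \<or> b = 0")
  case False
  then have "a > 0" "b > 0" using assms by auto
  then show ?thesis by (simp add: eta_def log_mult algebra_simps)
qed auto

definition entropy :: "'a pmf \<Rightarrow> real" where
  "entropy P = (\<Sum>v\<in>set_pmf P. eta (pmf P v))"

lemma entropy_superset:
  assumes "finite A" "set_pmf P \<subseteq> A"
  shows "entropy P = (\<Sum>v\<in>A. eta (pmf P v))"
  unfolding entropy_def
  by (rule sum.mono_neutral_left) (use assms in \<open>auto simp: set_pmf_iff\<close>)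

lemma entropy_map_inj:
  assumes "inj_on f (set_pmf P)"
  shows "entropy (map_pmf f P) = entropy P"
  using assms by (simp add: entropy_def sum.reindex pmf_map_inj)

lemma entropy_return [simp]: "entropy (return_pmf x) = 0"
  by (simp add: entropy_def)

lemma pmf_bind_finite:
  assumes "finite A" "set_pmf p \<subseteq> A"
  shows "pmf (bind_pmf p f) y = (\<Sum>x\<in>A. pmf p x * pmf (f x) y)"
  unfolding pmf_bind
  by (subst integral_measure_pmf_real[where A = A]) (use assms in \<open>auto simp: mult.commute\<close>)

lemma pmf_map_finite:
  assumes "finite A" "set_pmf p \<subseteq> A"
  shows "pmf (map_pmf f p) y = (\<Sum>x\<in>{x\<in>A. f x = y}. pmf p x)"
proof -
  have "pmf (map_pmf f p) y = (\<Sum>x\<in>A. pmf p x * indicator {y} (f x))"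
    unfolding map_pmf_def by (subst pmf_bind_finite[OF assms]) simp
  also have "\<dots> = (\<Sum>x\<in>A. if f x = y then pmf p x else 0)"
    by (intro sum.cong) (auto simp: indicator_def)
  finally show ?thesis using assms(1) by (simp add: sum.inter_filter)
qed

text \<open>Grouping the sum by the value of \<open>f\<close> makes the logarithm constant on each
  group. This turns \<open>mi\<close> and \<open>cmi\<close> into signed sums of entropies.\<close>

lemma sum_log_map:
  assumes "finite (set_pmf P)"
  shows "(\<Sum>t\<in>set_pmf P. pmf P t * log 2 (pmf (map_pmf f P) (f t))) = - entropy (map_pmf f P)"
proof -
  have "(\<Sum>t\<in>set_pmf P. pmf P t * log 2 (pmf (map_pmf f P) (f t))) =
     (\<Sum>v\<in>f ` set_pmf P. \<Sum>t\<in>{t\<in>set_pmf P. f t = v}. pmf P t * log 2 (pmf (map_pmf f P) (f t)))"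
    using assms by (rule sum.image_gen)
  also have "\<dots> = (\<Sum>v\<in>f ` set_pmf P. pmf (map_pmf f P) v * log 2 (pmf (map_pmf f P) v))"
  proof (rule sum.cong[OF refl])
    fix v
    show "(\<Sum>t\<in>{t\<in>set_pmf P. f t = v}. pmf P t * log 2 (pmf (map_pmf f P) (f t))) =
        pmf (map_pmf f P) v * log 2 (pmf (map_pmf f P) v)"
      by (subst (2) pmf_map_finite[OF assms order_refl]) (simp add: sum_distrib_right)
  qed
  finally show ?thesis by (simp add: entropy_def eta_def sum_negf)
qed

lemma pmf_map_pos: "t \<in> set_pmf P \<Longrightarrow> pmf (map_pmf f P) (f t) > 0"
  by (simp add: pmf_positive_iff)

lemma mi_entropy:
  assumes "finite (set_pmf P)"
  shows "mi P = entropy (map_pmf fst P) + entropy (map_pmf snd P) - entropy P"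
proof -
  have "mi P = (\<Sum>t\<in>set_pmf P. pmf P t * log 2 (pmf (map_pmf (\<lambda>t. t) P) t)
      - pmf P t * log 2 (pmf (map_pmf fst P) (fst t)) - pmf P t * log 2 (pmf (map_pmf snd P) (snd t)))"
    unfolding mi_def
  proof (rule sum.cong[OF refl])
    fix t assume t: "t \<in> set_pmf P"
    show "pmf P t * log 2 (pmf P t / (pmf (map_pmf fst P) (fst t) * pmf (map_pmf snd P) (snd t))) =
      pmf P t * log 2 (pmf (map_pmf (\<lambda>t. t) P) t)
      - pmf P t * log 2 (pmf (map_pmf fst P) (fst t)) - pmf P t * log 2 (pmf (map_pmf snd P) (snd t))"
      using pmf_positive[OF t] pmf_map_pos[OF t, of fst] pmf_map_pos[OF t, of snd]
      by (simp add: log_divide log_mult algebra_simps)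
  qed
  also have "\<dots> = entropy (map_pmf fst P) + entropy (map_pmf snd P) - entropy P"
    unfolding sum_subtractf sum_log_map[OF assms] by simp
  finally show ?thesis .
qed

lemma cmi_entropy:
  assumes "finite (set_pmf P)"
  shows "cmi P = entropy (map_pmf (\<lambda>(c,a,b). (c,a)) P) + entropy (map_pmf (\<lambda>(c,a,b). (c,b)) P)
    - entropy P - entropy (map_pmf fst P)"
proof -
  let ?ca = "\<lambda>(c,a,b). (c,a)" and ?cb = "\<lambda>(c,a,b). (c,b)"
  have "cmi P = (\<Sum>t\<in>set_pmf P. pmf P t * log 2 (pmf (map_pmf (\<lambda>t. t) P) t)
      + pmf P t * log 2 (pmf (map_pmf fst P) (fst t))
      - pmf P t * log 2 (pmf (map_pmf ?ca P) (?ca t)) - pmf P t * log 2 (pmf (map_pmf ?cb P) (?cb t)))"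
    unfolding cmi_def
  proof (rule sum.cong[OF refl])
    fix t assume t: "t \<in> set_pmf P"
    have e: "(fst t, fst (snd t)) = ?ca t" "(fst t, snd (snd t)) = ?cb t"
      by (auto simp: case_prod_beta)
    show "pmf P t * log 2 (pmf P t * pmf (map_pmf fst P) (fst t) /
        (pmf (map_pmf ?ca P) (fst t, fst (snd t)) * pmf (map_pmf ?cb P) (fst t, snd (snd t)))) =
      pmf P t * log 2 (pmf (map_pmf (\<lambda>t. t) P) t)
      + pmf P t * log 2 (pmf (map_pmf fst P) (fst t))
      - pmf P t * log 2 (pmf (map_pmf ?ca P) (?ca t)) - pmf P t * log 2 (pmf (map_pmf ?cb P) (?cb t))"
      unfolding e
      using pmf_positive[OF t] pmf_map_pos[OF t, of fst] pmf_map_pos[OF t, of ?ca] pmf_map_pos[OF t, of ?cb]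
      by (simp add: log_divide log_mult algebra_simps del: split_paired_All)
  qed
  also have "\<dots> = entropy (map_pmf ?ca P) + entropy (map_pmf ?cb P) - entropy P - entropy (map_pmf fst P)"
    unfolding sum_subtractf sum.distrib sum_log_map[OF assms] by simp
  finally show ?thesis .
qed

text \<open>\<open>out_ent k a\<close> is the entropy of the output of the kernel \<open>k\<close> conditioned on its input law, where the
  input law is an unnormalised vector \<open>a\<close>: homogeneity makes \<open>H(Y|U)\<close> a plain sum over \<open>u\<close> of
  \<open>out_ent\<close> at the vectors \<open>p(u,\<cdot>)\<close>.\<close>

definition out_ent :: "('x::finite \<Rightarrow> 'y::finite pmf) \<Rightarrow> ('x \<Rightarrow> real) \<Rightarrow> real" where
  "out_ent k a = (\<Sum>y\<in>UNIV. eta (\<Sum>x\<in>UNIV. a x * pmf (k x) y)) - eta (\<Sum>x\<in>UNIV. a x)"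

text \<open>H(Y|X) for the input vector \<open>a\<close>. In contrast to \<open>out_ent\<close> it
  is linear in \<open>a\<close>, hence exactly additive over values of U and over time
  indices.\<close>

definition noise_ent :: "('x::finite \<Rightarrow> 'y::finite pmf) \<Rightarrow> ('x \<Rightarrow> real) \<Rightarrow> real" where
  "noise_ent k a = (\<Sum>x\<in>UNIV. a x * (\<Sum>y\<in>UNIV. eta (pmf (k x) y)))"

definition cond_ent :: "('x::finite \<Rightarrow> 'y::finite pmf) \<Rightarrow> ('u \<times> 'x) pmf \<Rightarrow> real" where
  "cond_ent k p = (\<Sum>u\<in>fst ` set_pmf p. out_ent k (\<lambda>x. pmf p (u, x)))"

definition out_kernel :: "('x \<Rightarrow> 'y list pmf) \<Rightarrow> nat \<Rightarrow> 'x \<Rightarrow> 'y pmf" where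
  "out_kernel W j x = map_pmf (\<lambda>ys. ys ! (j - 1)) (W x)"

lemma out_ent_0 [simp]: "out_ent k (\<lambda>x. 0) = 0"
  by (simp add: out_ent_def)

lemma cond_ent_superset:
  assumes "finite A" "fst ` set_pmf p \<subseteq> A"
  shows "cond_ent k p = (\<Sum>u\<in>A. out_ent k (\<lambda>x. pmf p (u, x)))"
  unfolding cond_ent_def
proof (rule sum.mono_neutral_left)
  show "\<forall>u\<in>A - fst ` set_pmf p. out_ent k (\<lambda>x. pmf p (u, x)) = 0"
  proof
    fix u assume "u \<in> A - fst ` set_pmf p"
    then have "(\<lambda>x. pmf p (u, x)) = (\<lambda>x. 0)"
      by (force simp: set_pmf_iff)
    then show "out_ent k (\<lambda>x. pmf p (u, x)) = 0" by simp
  qed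
qed (use assms in auto)

lemma subset_times_UNIV: "set_pmf p \<subseteq> fst ` set_pmf p \<times> UNIV"
  by force

lemma pmf_map_fst:
  fixes p :: "('u \<times> 'x::finite) pmf"
  assumes "finite (set_pmf p)"
  shows "pmf (map_pmf fst p) u = (\<Sum>x\<in>UNIV. pmf p (u, x))"
proof -
  let ?A = "insert u (fst ` set_pmf p)"
  have "pmf (map_pmf fst p) u = (\<Sum>z\<in>{z\<in>?A \<times> UNIV. fst z = u}. pmf p z)"
    using assms subset_times_UNIV[of p] by (intro pmf_map_finite) auto
  also have "{z\<in>?A \<times> (UNIV :: 'x set). fst z = u} = Pair u ` UNIV" by auto
  finally show ?thesis by (simp add: sum.reindex inj_on_def)
qed

lemma pmf_map_snd:
  fixes p :: "('u \<times> 'x::finite) pmf"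
  assumes "finite A" "fst ` set_pmf p \<subseteq> A"
  shows "pmf (map_pmf snd p) x = (\<Sum>u\<in>A. pmf p (u, x))"
proof -
  have "pmf (map_pmf snd p) x = (\<Sum>z\<in>{z\<in>A \<times> UNIV. snd z = x}. pmf p z)"
    using assms subset_times_UNIV[of p] by (intro pmf_map_finite) auto
  also have "{z\<in>A \<times> (UNIV :: 'x set). snd z = x} = (\<lambda>u. (u, x)) ` A" by auto
  finally show ?thesis by (simp add: sum.reindex inj_on_def)
qed

definition uy_pmf :: "('x \<Rightarrow> 'y pmf) \<Rightarrow> ('u \<times> 'x) pmf \<Rightarrow> ('u \<times> 'y) pmf" where
  "uy_pmf k p = p \<bind> (\<lambda>(u,x). map_pmf (\<lambda>y. (u,y)) (k x))"

lemma pmf_map_Pair: "pmf (map_pmf (Pair u) q) (v, y) = (if u = v then pmf q y else 0)"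
proof (cases "u = v")
  case True
  then show ?thesis by (simp add: pmf_map_inj' inj_on_def)
next
  case False
  then show ?thesis by (auto intro!: pmf_map_outside)
qed

lemma pmf_uy:
  fixes p :: "('u \<times> 'x::finite) pmf"
  assumes "finite (set_pmf p)"
  shows "pmf (uy_pmf k p) (u, y) = (\<Sum>x\<in>UNIV. pmf p (u, x) * pmf (k x) y)"
proof -
  let ?A = "insert u (fst ` set_pmf p)"
  have "pmf (uy_pmf k p) (u, y) =
      (\<Sum>z\<in>?A \<times> UNIV. pmf p z * pmf ((\<lambda>(u,x). map_pmf (\<lambda>y. (u,y)) (k x)) z) (u, y))"
    unfolding uy_pmf_def using assms subset_times_UNIV[of p] by (intro pmf_bind_finite) auto
  also have "\<dots> = (\<Sum>v\<in>?A. \<Sum>x\<in>UNIV. if v = u then pmf p (v, x) * pmf (k x) y else 0)"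
    by (simp only: sum.cartesian_product) (intro sum.cong, auto simp: pmf_map_Pair)
  also have "\<dots> = (\<Sum>v\<in>?A. if v = u then \<Sum>x\<in>UNIV. pmf p (v, x) * pmf (k x) y else 0)"
    by (intro sum.cong) auto
  finally show ?thesis using assms by (simp add: sum.delta)
qed

lemma finite_uy:
  fixes k :: "'x::finite \<Rightarrow> 'y::finite pmf"
  assumes "finite (set_pmf p)"
  shows "finite (set_pmf (uy_pmf k p))"
  unfolding uy_pmf_def using assms by auto

lemma map_fst_uy: "map_pmf fst (uy_pmf k p) = map_pmf fst p"
  unfolding uy_pmf_def
  by (simp add: map_bind_pmf case_prod_unfold map_pmf_comp) (simp add: map_pmf_def)

lemma entropy_uy:
  fixes k :: "'x::finite \<Rightarrow> 'y::finite pmf"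
  assumes fin: "finite (set_pmf p)"
  shows "entropy (uy_pmf k p) - entropy (map_pmf fst p) = cond_ent k p"
proof -
  let ?A = "fst ` set_pmf p"
  have sub: "set_pmf (uy_pmf k p) \<subseteq> ?A \<times> UNIV"
    unfolding uy_pmf_def by force
  have "entropy (uy_pmf k p) = (\<Sum>u\<in>?A. \<Sum>y\<in>UNIV. eta (\<Sum>x\<in>UNIV. pmf p (u, x) * pmf (k x) y))"
    using fin sub
    by (subst entropy_superset[where A = "?A \<times> UNIV"])
       (auto simp: sum.cartesian_product pmf_uy[OF fin] intro!: sum.cong)
  moreover have "entropy (map_pmf fst p) = (\<Sum>u\<in>?A. eta (\<Sum>x\<in>UNIV. pmf p (u, x)))"
    by (simp add: entropy_def pmf_map_fst[OF fin])
  ultimately show ?thesis by (simp add: cond_ent_def out_ent_def sum_subtractf)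
qed

lemma map_snd_uy: "map_pmf snd (uy_pmf k p) = map_pmf snd p \<bind> k"
  unfolding uy_pmf_def
  by (simp add: map_bind_pmf case_prod_unfold map_pmf_comp bind_map_pmf)

lemma sum_pmf_UNIV [simp]: "(\<Sum>x\<in>UNIV. pmf (q :: 'x::finite pmf) x) = 1"
  by (rule sum_pmf_eq_1) auto

lemma entropy_out:
  fixes k :: "'x::finite \<Rightarrow> 'y::finite pmf"
  shows "entropy (q \<bind> k) = out_ent k (pmf q)"
  by (subst entropy_superset[where A = UNIV]) (auto simp: out_ent_def pmf_bind_finite[where A = UNIV])

lemma mi_uy:
  fixes k :: "'x::finite \<Rightarrow> 'y::finite pmf"
  assumes fin: "finite (set_pmf p)"
  shows "mi (uy_pmf k p) = out_ent k (pmf (map_pmf snd p)) - cond_ent k p"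
  using entropy_uy[OF fin, of k]
  by (simp add: mi_entropy[OF finite_uy[OF fin]] map_fst_uy map_snd_uy entropy_out)

text \<open>When U determines X, each vector p(u,.) has a single nonzero entry, so H(Y|U) = H(Y|X).
  With U = X, or with the pair (U,X) as auxiliary, the quantities conditioned on X become instances
  of \<open>cond_ent\<close>.\<close>

lemma cond_ent_dirac:
  fixes k :: "'x::finite \<Rightarrow> 'y::finite pmf"
  assumes fin: "finite (set_pmf p)" and g: "\<And>z. z \<in> set_pmf p \<Longrightarrow> snd z = g (fst z)"
  shows "cond_ent k p = noise_ent k (pmf (map_pmf snd p))"
proof -
  let ?A = "fst ` set_pmf p"
  have *: "out_ent k (\<lambda>x. pmf p (u, x)) = (\<Sum>x\<in>UNIV. pmf p (u, x) * (\<Sum>y\<in>UNIV. eta (pmf (k x) y)))"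
    if u: "u \<in> ?A" for u
  proof -
    have z: "pmf p (u, x) = 0" if "x \<noteq> g u" for x
      using g[of "(u, x)"] that by (auto simp: set_pmf_iff)
    have s: "(\<Sum>x\<in>UNIV. pmf p (u, x) * h x) = pmf p (u, g u) * h (g u)" for h :: "'x \<Rightarrow> real"
      by (subst sum.mono_neutral_right[where S = "{g u}"]) (auto simp: z)
    show ?thesis
      using s[of "\<lambda>x. 1"] sum_pmf_UNIV[of "k (g u)"]
      by (simp add: out_ent_def s eta_mult sum.distrib sum_distrib_left[symmetric] sum_distrib_right[symmetric])
  qed
  have "cond_ent k p = (\<Sum>u\<in>?A. \<Sum>x\<in>UNIV. pmf p (u, x) * (\<Sum>y\<in>UNIV. eta (pmf (k x) y)))"
    unfolding cond_ent_def by (intro sum.cong) (auto simp: *)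
  also have "\<dots> = noise_ent k (pmf (map_pmf snd p))"
    unfolding noise_ent_def
    by (subst sum.swap, intro sum.cong refl, subst pmf_map_snd[where A = ?A])
       (use fin in \<open>auto simp: sum_distrib_right\<close>)
  finally show ?thesis .
qed

lemma I_UY_eq_mi: "I_UY W p j = mi (uy_pmf (out_kernel W j) p)"
  unfolding I_UY_def bc_joint_def uy_pmf_def out_kernel_def
  by (simp add: map_bind_pmf case_prod_unfold map_pmf_comp)

lemma I_UY_eq:
  fixes W :: "'x::finite \<Rightarrow> 'y::finite list pmf"
  assumes "finite (set_pmf p)"
  shows "I_UY W p j = out_ent (out_kernel W j) (pmf (map_pmf snd p)) - cond_ent (out_kernel W j) p"
  using assms by (simp add: I_UY_eq_mi mi_uy)

lemma I_XY_eq: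
  fixes W :: "'x::finite \<Rightarrow> 'y::finite list pmf"
  shows "I_XY W q j = out_ent (out_kernel W j) (pmf q) - noise_ent (out_kernel W j) (pmf q)"
proof -
  let ?p = "map_pmf (\<lambda>x. (x, x)) q"
  have "I_XY W q j = mi (uy_pmf (out_kernel W j) ?p)"
    unfolding I_XY_def uy_pmf_def out_kernel_def by (simp add: map_pmf_comp bind_map_pmf)
  also have "\<dots> = out_ent (out_kernel W j) (pmf q) - noise_ent (out_kernel W j) (pmf q)"
    by (subst mi_uy, simp, subst cond_ent_dirac[where g = id]) (auto simp: map_pmf_comp)
  finally show ?thesis .
qed

lemma I_XY_given_U_eq:
  fixes W :: "'x::finite \<Rightarrow> 'y::finite list pmf"
  assumes fin: "finite (set_pmf p)"
  shows "I_XY_given_U W p j = cond_ent (out_kernel W j) p - noise_ent (out_kernel W j) (pmf (map_pmf snd p))"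
proof -
  let ?k = "out_kernel W j"
  let ?J = "p \<bind> (\<lambda>(u,x). map_pmf (\<lambda>y. (u,x,y)) (?k x))"
  \<comment> \<open>The pair (U,X) takes the role of the auxiliary, which makes H(Y|U,X) a
    \<open>cond_ent\<close> as well.\<close>
  let ?q = "map_pmf (\<lambda>(u,x). ((u,x),x)) p"
  have J: "map_pmf (\<lambda>(u, x, ys). (u, x, ys ! (j - 1))) (bc_joint W p) = ?J"
    unfolding bc_joint_def out_kernel_def by (simp add: map_bind_pmf case_prod_unfold map_pmf_comp)
  have finJ: "finite (set_pmf ?J)" using fin by auto
  have 1: "map_pmf (\<lambda>(c,a,b). (c,a)) ?J = p" "map_pmf fst ?J = map_pmf fst p"
    by (simp_all add: map_bind_pmf case_prod_unfold map_pmf_comp bind_return_pmf')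
      (simp add: map_pmf_def)
  have 2: "map_pmf (\<lambda>(c,a,b). (c,b)) ?J = uy_pmf ?k p"
    by (simp add: map_bind_pmf case_prod_unfold map_pmf_comp uy_pmf_def)
  have "uy_pmf ?k ?q = map_pmf (\<lambda>(u,x,y). ((u,x),y)) ?J"
    by (simp add: map_bind_pmf case_prod_unfold map_pmf_comp uy_pmf_def bind_map_pmf)
  moreover have "entropy (map_pmf (\<lambda>(u,x,y). ((u,x),y)) ?J) = entropy ?J"
    by (rule entropy_map_inj) (auto simp: inj_on_def)
  ultimately have "entropy (uy_pmf ?k ?q) = entropy ?J" by simp
  moreover have "entropy (map_pmf fst ?q) = entropy p"
    by (simp add: map_pmf_comp case_prod_beta)
  moreover have "cond_ent ?k ?q = noise_ent ?k (pmf (map_pmf snd p))"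
    by (subst cond_ent_dirac[where g = snd]) (use fin in \<open>auto simp: map_pmf_comp case_prod_beta\<close>)
  ultimately have 3: "entropy ?J - entropy p = noise_ent ?k (pmf (map_pmf snd p))"
    using entropy_uy[of ?q ?k] fin by simp
  show ?thesis
    unfolding I_XY_given_U_def J cmi_entropy[OF finJ] 1 2
    using 3 entropy_uy[OF fin, of ?k] by simp
qed

section \<open>Superadditivity of entropy and the channel orderings\<close>

lemma log_sum_ineq:
  fixes s t s' t' :: real
  assumes "0 \<le> s" "s \<le> t" "0 \<le> s'" "s' \<le> t'"
  shows "(eta s + s * log 2 t) + (eta s' + s' * log 2 t') \<le> eta (s + s') + (s + s') * log 2 (t + t')"
proof (cases "s + s' = 0")
  case True
  then have "s = 0" "s' = 0" using assms by auto
  then show ?thesis by simp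
next
  case False
  define S T where "S = s + s'" and "T = t + t'"
  have pos: "S > 0" "T > 0" using False assms by (auto simp: S_def T_def)
  \<comment> \<open>The tangent bound ln v <= v - 1 at v = (q S) / (r T). The linear remainders for
    (s,t) and (s',t') add up to T S / T - S = 0. The case r = 0 is split off because the ratio is
    then undefined.\<close>
  have key: "eta r + r * log 2 q \<le> r * log 2 (T / S) + (q * S / T - r) / ln 2"
    if "0 \<le> r" "r \<le> q" for r q :: real
  proof (cases "r = 0")
    case True
    then show ?thesis using pos that by simp
  next
    case False
    then have r: "r > 0" "q > 0" using that by auto
    have "ln ((q * S) / (r * T)) \<le> (q * S) / (r * T) - 1"
      using r pos by (intro ln_le_minus_one) auto
    then have "r * ln ((q * S) / (r * T)) \<le> q * S / T - r"
      using r pos by (simp add: field_simps)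
    then have "r * ln ((q * S) / (r * T)) / ln 2 \<le> (q * S / T - r) / ln 2"
      by (simp add: divide_right_mono)
    moreover have "ln ((q * S) / (r * T)) = ln q + ln S - ln r - ln T"
      using r pos by (simp add: ln_mult ln_div)
    moreover have "eta r + r * log 2 q - r * log 2 (T / S) = r * (ln q + ln S - ln r - ln T) / ln 2"
      using r pos by (simp add: eta_def log_def ln_div diff_divide_distrib add_divide_distrib algebra_simps)
    ultimately show ?thesis by simp
  qed
  have "(eta s + s * log 2 t) + (eta s' + s' * log 2 t') \<le>
      S * log 2 (T / S) + (T * S / T - S) / ln 2"
    using key[of s t] key[of s' t'] assms
    by (simp add: S_def T_def algebra_simps add_divide_distrib diff_divide_distrib)
  also have "\<dots> = S * log 2 (T / S)" using pos by simp
  also have "\<dots> = eta S + S * log 2 T" using pos by (simp add: eta_def log_divide algebra_simps)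
  finally show ?thesis by (simp add: S_def T_def)
qed

lemma sum_out:
  fixes k :: "'x::finite \<Rightarrow> 'y::finite pmf"
  shows "(\<Sum>y\<in>UNIV. \<Sum>x\<in>UNIV. a x * pmf (k x) y) = (\<Sum>x\<in>UNIV. a x)"
  by (subst sum.swap) (simp add: sum_distrib_left[symmetric])

lemma out_ent_alt:
  fixes k :: "'x::finite \<Rightarrow> 'y::finite pmf"
  shows "out_ent k a = (\<Sum>y\<in>UNIV. eta (\<Sum>x\<in>UNIV. a x * pmf (k x) y) +
     (\<Sum>x\<in>UNIV. a x * pmf (k x) y) * log 2 (\<Sum>x\<in>UNIV. a x))"
  by (simp add: out_ent_def sum.distrib sum_distrib_right[symmetric] sum_out) (simp add: eta_def)

text \<open>For positively homogeneous functionals this is concavity without normalisation. Jensen's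
  inequality and "conditioning reduces entropy" become finite sums in which no probability of a
  value of U is divided by.\<close>

definition superadditive :: "(('x \<Rightarrow> real) \<Rightarrow> real) \<Rightarrow> bool" where
  "superadditive D \<longleftrightarrow> D (\<lambda>x. 0) = 0 \<and>
     (\<forall>a b. (\<forall>x. 0 \<le> a x) \<longrightarrow> (\<forall>x. 0 \<le> b x) \<longrightarrow> D a + D b \<le> D (\<lambda>x. a x + b x))"

lemma superadditive_out_ent:
  fixes k :: "'x::finite \<Rightarrow> 'y::finite pmf"
  shows "superadditive (out_ent k)"
  unfolding superadditive_def
proof (intro conjI allI impI)
  fix a b :: "'x \<Rightarrow> real"
  assume a: "\<forall>x. 0 \<le> a x" and b: "\<forall>x. 0 \<le> b x"
  have le: "(\<Sum>x\<in>UNIV. c x * pmf (k x) y) \<le> (\<Sum>x\<in>UNIV. c x)" if "\<forall>x. 0 \<le> c x" for c y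
    using that by (intro sum_mono) (simp add: mult_left_le pmf_le_1)
  define A B where "A y = (\<Sum>x\<in>UNIV. a x * pmf (k x) y)" and "B y = (\<Sum>x\<in>UNIV. b x * pmf (k x) y)" for y
  define At Bt where "At = (\<Sum>x\<in>UNIV. a x)" and "Bt = (\<Sum>x\<in>UNIV. b x)"
  have "out_ent k a + out_ent k b = (\<Sum>y\<in>UNIV. (eta (A y) + A y * log 2 At) + (eta (B y) + B y * log 2 Bt))"
    by (simp only: out_ent_alt A_def B_def At_def Bt_def sum.distrib)
  also have "\<dots> \<le> (\<Sum>y\<in>UNIV. eta (A y + B y) + (A y + B y) * log 2 (At + Bt))"
    using a b unfolding A_def B_def At_def Bt_def
    by (intro sum_mono log_sum_ineq le sum_nonneg) auto
  also have "\<dots> = out_ent k (\<lambda>x. a x + b x)"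
  proof -
    have "A y + B y = (\<Sum>x\<in>UNIV. (a x + b x) * pmf (k x) y)" for y
      by (simp add: A_def B_def sum.distrib distrib_right)
    moreover have "At + Bt = (\<Sum>x\<in>UNIV. a x + b x)"
      by (simp add: At_def Bt_def sum.distrib)
    ultimately show ?thesis by (simp only: out_ent_alt)
  qed
  finally show "out_ent k a + out_ent k b \<le> out_ent k (\<lambda>x. a x + b x)" .
qed simp

lemma superadditive_sum:
  assumes D: "superadditive D" and "finite T" and "\<And>t x. t \<in> T \<Longrightarrow> 0 \<le> a t x"
  shows "(\<Sum>t\<in>T. D (a t)) \<le> D (\<lambda>x. \<Sum>t\<in>T. a t x)"
  using assms(2,3)
proof (induction T rule: finite_induct)
  case empty
  then show ?case using D by (simp add: superadditive_def)
next
  case (insert t T)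
  have "D (a t) + D (\<lambda>x. \<Sum>t\<in>T. a t x) \<le> D (\<lambda>x. a t x + (\<Sum>t\<in>T. a t x))"
    using D[unfolded superadditive_def, THEN conjunct2, rule_format, of "a t" "\<lambda>x. \<Sum>t\<in>T. a t x"] insert.prems
    by (auto intro!: sum_nonneg)
  moreover have "(\<Sum>t\<in>T. D (a t)) \<le> D (\<lambda>x. \<Sum>t\<in>T. a t x)"
    using insert by auto
  ultimately show ?case using insert.hyps by simp
qed

lemma pmf_map_apfst:
  fixes p :: "('u \<times> 'x::finite) pmf"
  assumes "finite (set_pmf p)"
  shows "pmf (map_pmf (\<lambda>(u,x). (g u, x)) p) (v, x) = (\<Sum>u\<in>{u\<in>fst ` set_pmf p. g u = v}. pmf p (u, x))"
proof -
  let ?A = "fst ` set_pmf p"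
  have "pmf (map_pmf (\<lambda>(u,x). (g u, x)) p) (v, x) =
     (\<Sum>z\<in>{z\<in>?A \<times> UNIV. (\<lambda>(u,x). (g u, x)) z = (v, x)}. pmf p z)"
    using assms subset_times_UNIV[of p] by (intro pmf_map_finite) auto
  also have "{z\<in>?A \<times> UNIV. (\<lambda>(u,x). (g u, x)) z = (v, x)} = (\<lambda>u. (u, x)) ` {u\<in>?A. g u = v}"
    by auto
  finally show ?thesis by (simp add: sum.reindex inj_on_def)
qed

text \<open>Merging the values of U that share an image under \<open>g\<close> adds their vectors,
  and superadditivity applies on each fibre. For \<open>out_ent k\<close> this is H(Y|U) <=
  H(Y|g(U)); for a difference of two \<open>out_ent\<close> it is the conditional form of the less
  noisy comparison.\<close>

lemma superadditive_coarsen: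
  fixes p :: "('u \<times> 'x::finite) pmf"
  assumes D: "superadditive D" and fin: "finite (set_pmf p)"
  shows "(\<Sum>u\<in>fst ` set_pmf p. D (\<lambda>x. pmf p (u, x))) \<le>
     (\<Sum>v\<in>g ` fst ` set_pmf p. D (\<lambda>x. pmf (map_pmf (\<lambda>(u,x). (g u, x)) p) (v, x)))"
proof -
  let ?A = "fst ` set_pmf p"
  have "(\<Sum>u\<in>?A. D (\<lambda>x. pmf p (u, x))) = (\<Sum>v\<in>g ` ?A. \<Sum>u\<in>{u\<in>?A. g u = v}. D (\<lambda>x. pmf p (u, x)))"
    using fin by (intro sum.image_gen) auto
  also have "\<dots> \<le> (\<Sum>v\<in>g ` ?A. D (\<lambda>x. \<Sum>u\<in>{u\<in>?A. g u = v}. pmf p (u, x)))"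
    using fin by (intro sum_mono superadditive_sum[OF D]) auto
  finally show ?thesis by (simp add: pmf_map_apfst[OF fin])
qed

lemma cond_ent_coarsen:
  fixes k :: "'x::finite \<Rightarrow> 'y::finite pmf"
  assumes "finite (set_pmf p)"
  shows "cond_ent k p \<le> cond_ent k (map_pmf (\<lambda>(u,x). (g u, x)) p)"
  using superadditive_coarsen[OF superadditive_out_ent assms, of k g] by (simp add: cond_ent_def image_image case_prod_unfold)

lemma cond_ent_const:
  fixes k :: "'x::finite \<Rightarrow> 'y::finite pmf"
  shows "cond_ent k (map_pmf (Pair u) q) = out_ent k (pmf q)"
  by (subst cond_ent_superset[where A = "{u}"]) (auto simp: pmf_map_Pair)

lemma cond_ent_le_out_ent:
  fixes k :: "'x::finite \<Rightarrow> 'y::finite pmf"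
  assumes "finite (set_pmf p)"
  shows "cond_ent k p \<le> out_ent k (pmf (map_pmf snd p))"
proof -
  have "map_pmf (\<lambda>(u,x). ((), x)) p = map_pmf (Pair ()) (map_pmf snd p)"
    by (simp add: map_pmf_comp case_prod_unfold)
  then show ?thesis
    using cond_ent_coarsen[OF assms, of k "\<lambda>_. ()"] by (simp add: cond_ent_const)
qed

lemma cond_ent_relabel:
  fixes k :: "'x::finite \<Rightarrow> 'y::finite pmf"
  assumes fin: "finite (set_pmf p)" and inj: "inj_on g (fst ` set_pmf p)"
  shows "cond_ent k (map_pmf (\<lambda>(u,x). (g u, x)) p) = cond_ent k p"
proof -
  have "(\<Sum>u'\<in>{u'\<in>fst ` set_pmf p. g u' = g u}. pmf p (u', x)) = pmf p (u, x)"
    if "u \<in> fst ` set_pmf p" for u x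
  proof -
    have "{u'\<in>fst ` set_pmf p. g u' = g u} = {u}"
      using inj that by (auto simp: inj_on_def)
    then show ?thesis by simp
  qed
  moreover have "fst ` set_pmf (map_pmf (\<lambda>(u,x). (g u, x)) p) = g ` fst ` set_pmf p"
    by (auto simp: image_iff) force+
  ultimately show ?thesis
    unfolding cond_ent_def by (simp add: sum.reindex[OF inj] pmf_map_apfst[OF fin])
qed

lemma noise_ent_le_cond_ent:
  fixes k :: "'x::finite \<Rightarrow> 'y::finite pmf"
  assumes fin: "finite (set_pmf p)"
  shows "noise_ent k (pmf (map_pmf snd p)) \<le> cond_ent k p"
proof -
  let ?q = "map_pmf (\<lambda>(u,x). ((u,x),x)) p"
  have "noise_ent k (pmf (map_pmf snd p)) = cond_ent k ?q"
    by (subst cond_ent_dirac[where g = snd]) (use fin in \<open>auto simp: map_pmf_comp case_prod_unfold\<close>)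
  also have "\<dots> \<le> cond_ent k (map_pmf (\<lambda>(u,x). (fst u, x)) ?q)"
    using fin by (intro cond_ent_coarsen) auto
  also have "map_pmf (\<lambda>(u,x). (fst u, x)) ?q = p"
    by (simp add: map_pmf_comp case_prod_unfold)
  finally show ?thesis .
qed

lemma out_ent_scale:
  fixes k :: "'x::finite \<Rightarrow> 'y::finite pmf"
  assumes "c \<ge> 0" "\<And>x. 0 \<le> a x"
  shows "out_ent k (\<lambda>x. c * a x) = c * out_ent k a"
proof -
  have e: "(\<Sum>x\<in>UNIV. c * a x * pmf (k x) y) = c * (\<Sum>x\<in>UNIV. a x * pmf (k x) y)" for y
    by (simp add: sum_distrib_left mult.assoc)
  have n: "0 \<le> (\<Sum>x\<in>UNIV. a x * pmf (k x) y)" for y using assms by (auto intro!: sum_nonneg)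
  have n': "0 \<le> (\<Sum>x\<in>UNIV. a x)" using assms by (auto intro!: sum_nonneg)
  show ?thesis
    unfolding out_ent_def e sum_distrib_left[symmetric]
    by (simp add: eta_mult[OF assms(1) n] eta_mult[OF assms(1) n'] sum.distrib
        sum_distrib_left[symmetric] sum_distrib_right[symmetric] sum_out algebra_simps)
qed

lemma noise_ent_scale: "noise_ent k (\<lambda>x. c * a x) = c * noise_ent k a"
  by (simp add: noise_ent_def sum_distrib_left mult.assoc)

lemma noise_ent_sum: "noise_ent k (\<lambda>x. \<Sum>t\<in>T. a t x) = (\<Sum>t\<in>T. noise_ent k (a t))"
  unfolding noise_ent_def sum_distrib_right by (rule sum.swap)

lemma ex_finite_pmf:
  assumes fin: "finite A" and nn: "\<And>z. 0 \<le> f z" and out: "\<And>z. z \<notin> A \<Longrightarrow> f z = 0"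
    and one: "(\<Sum>z\<in>A. f z) = (1::real)"
  obtains p where "\<And>z. pmf p z = f z" "set_pmf p \<subseteq> A"
proof -
  have "(\<integral>\<^sup>+z. ennreal (f z) \<partial>count_space UNIV) = (\<Sum>z\<in>A. ennreal (f z))"
    using fin out by (intro nn_integral_count_space'[where A = A]) auto
  also have "\<dots> = 1" using nn one by (simp add: sum_ennreal)
  finally have e: "pmf (embed_pmf f) z = f z" for z
    using nn by (intro pmf_embed_pmf) auto
  moreover have "set_pmf (embed_pmf f) \<subseteq> A"
    using out unfolding subset_iff set_pmf_iff e by blast
  ultimately show ?thesis by (rule that)
qed

text \<open>Less noisy is known to be concavity of I(X;Y_s) - I(X;Y_c) in p(x), and the parts H(Y|X)
  are linear and drop out. Concretely, a two-valued U with joint vectors a/m and b/m turns I(U;Y_c)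
  <= I(U;Y_s) into the inequality for \<open>a\<close> and \<open>b\<close>, up to the factor
  1/m.\<close>

lemma less_noisy_superadditive:
  fixes W :: "'x::finite \<Rightarrow> 'y::finite list pmf"
  assumes ln: "less_noisy W s c"
  shows "superadditive (\<lambda>a. out_ent (out_kernel W s) a - out_ent (out_kernel W c) a)"
  unfolding superadditive_def
proof (intro conjI allI impI)
  fix a b :: "'x \<Rightarrow> real"
  assume a: "\<forall>x. 0 \<le> a x" and b: "\<forall>x. 0 \<le> b x"
  define m where "m = (\<Sum>x\<in>UNIV. a x) + (\<Sum>x\<in>UNIV. b x)"
  have sn: "0 \<le> (\<Sum>x\<in>UNIV. a x)" "0 \<le> (\<Sum>x\<in>UNIV. b x)" using a b by (auto intro!: sum_nonneg)
  let ?D = "\<lambda>a. out_ent (out_kernel W s) a - out_ent (out_kernel W c) a"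
  show "?D a + ?D b \<le> ?D (\<lambda>x. a x + b x)"
  proof (cases "m = 0")
    case True
    then have "(\<Sum>x\<in>UNIV. a x) = 0" "(\<Sum>x\<in>UNIV. b x) = 0" using sn by (auto simp: m_def)
    then have "a = (\<lambda>x. 0)" "b = (\<lambda>x. 0)"
      using a b by (auto simp: sum_nonneg_eq_0_iff)
    then show ?thesis by simp
  next
    case False
    then have m: "m > 0" using sn by (simp add: m_def)
    let ?f = "\<lambda>(u::nat, x). if u = 0 then 1 / m * a x else if u = 1 then 1 / m * b x else 0"
    obtain p where p: "\<And>z. pmf p z = ?f z" "set_pmf p \<subseteq> {0,1} \<times> UNIV"
    proof (rule ex_finite_pmf[of "{0,1} \<times> UNIV" ?f])
      show "(\<Sum>z\<in>{0, 1} \<times> UNIV. ?f z) = 1"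
        using m by (simp add: sum.cartesian_product[symmetric] sum_distrib_left[symmetric]
            distrib_left[symmetric] m_def[symmetric] sum_divide_distrib[symmetric] add_divide_distrib[symmetric])
    qed (use a b m in \<open>auto simp: case_prod_unfold\<close>)
    have fin: "finite (set_pmf p)" using p(2) by (rule finite_subset) auto
    have sub: "fst ` set_pmf p \<subseteq> {0,1}" using p(2) by force
    have H: "cond_ent k p = 1 / m * (out_ent k a + out_ent k b)" for k :: "'x \<Rightarrow> 'y pmf"
      using m a b
      by (subst cond_ent_superset[OF _ sub]) (simp_all add: p(1) out_ent_scale[where c = "1/m", simplified] algebra_simps add_divide_distrib)
    have "pmf (map_pmf snd p) = (\<lambda>x. 1 / m * (a x + b x))"
      by (rule ext, subst pmf_map_snd[OF _ sub]) (simp_all add: p(1) algebra_simps add_divide_distrib)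
    then have M: "out_ent k (pmf (map_pmf snd p)) = 1 / m * out_ent k (\<lambda>x. a x + b x)" for k :: "'x \<Rightarrow> 'y pmf"
      using m a b by (simp only: out_ent_scale) (auto simp: out_ent_scale[where c = "1/m", simplified])
    have "I_UY W p c \<le> I_UY W p s" using ln fin by (auto simp: less_noisy_def)
    then have "1 / m * (out_ent (out_kernel W c) (\<lambda>x. a x + b x) - (out_ent (out_kernel W c) a + out_ent (out_kernel W c) b))
      \<le> 1 / m * (out_ent (out_kernel W s) (\<lambda>x. a x + b x) - (out_ent (out_kernel W s) a + out_ent (out_kernel W s) b))"
      unfolding I_UY_eq[OF fin] H M right_diff_distrib by simp
    then show ?thesis using m by (simp add: divide_le_cancel)
  qed
qed simp

text \<open>Normalising \<open>a\<close> to an input law scales both sides by the total mass. The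
  unnormalised form can be summed over the vectors p(u,.), which yields I(X;Y_c|U) <=
  I(X;Y_s|U).\<close>

lemma more_capable_vec:
  fixes W :: "'x::finite \<Rightarrow> 'y::finite list pmf"
  assumes mc: "more_capable W s c" and a: "\<And>x. 0 \<le> a x"
  shows "out_ent (out_kernel W c) a - noise_ent (out_kernel W c) a \<le> out_ent (out_kernel W s) a - noise_ent (out_kernel W s) a"
proof (cases "(\<Sum>x\<in>UNIV. a x) = 0")
  case True
  then have "a = (\<lambda>x. 0)" using a by (auto simp: sum_nonneg_eq_0_iff)
  then show ?thesis by (simp add: noise_ent_def)
next
  case False
  define m where "m = (\<Sum>x\<in>UNIV. a x)"
  have m: "m > 0" using a False by (auto simp: m_def less_le intro!: sum_nonneg)
  obtain q where q: "\<And>x. pmf q x = 1 / m * a x"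
  proof (rule ex_finite_pmf[of UNIV "\<lambda>x. 1 / m * a x"])
    show "(\<Sum>x\<in>UNIV. 1 / m * a x) = 1"
      using m by (simp add: sum_divide_distrib[symmetric] m_def)
  qed (use a m in auto)
  have "pmf q = (\<lambda>x. 1 / m * a x)" using q by auto
  then have GC: "out_ent k (pmf q) - noise_ent k (pmf q) = 1 / m * (out_ent k a - noise_ent k a)" for k :: "'x \<Rightarrow> 'y pmf"
    using m a by (simp only: noise_ent_scale) (subst out_ent_scale, auto simp: algebra_simps diff_divide_distrib)
  have "I_XY W q c \<le> I_XY W q s" using mc by (simp add: more_capable_def)
  then show ?thesis unfolding I_XY_eq GC using m by (simp add: divide_le_cancel)
qed

subsection \<open>Compactness of the rate region\<close>

text \<open>Gaussian elimination on a homogeneous system with more unknowns than equations: a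
  nonzero \<open>A i w\<close> is the pivot, equation \<open>i\<close> eliminates the unknown
  \<open>w\<close>, and the induction hypothesis solves what remains.\<close>

lemma ex_kernel_vector:
  fixes A :: "'i \<Rightarrow> 'u \<Rightarrow> real"
  assumes "finite I" "finite U" "card I < card U"
  shows "\<exists>v. (\<exists>u\<in>U. v u \<noteq> 0) \<and> (\<forall>i\<in>I. (\<Sum>u\<in>U. v u * A i u) = 0)"
  using assms
proof (induction I arbitrary: U A rule: finite_induct)
  case empty
  then obtain u where "u \<in> U" by (metis card_0_eq ex_in_conv less_not_refl card.empty)
  then show ?case by (intro exI[of _ "\<lambda>_. 1"]) auto
next
  case (insert i I)
  show ?case
  proof (cases "\<forall>u\<in>U. A i u = 0")
    case True
    then have "(\<Sum>u\<in>U. v u * A i u) = 0" for v by (intro sum.neutral) auto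
    then show ?thesis using insert.IH[of U A] insert.prems insert.hyps by auto
  next
    case False
    then obtain w where w: "w \<in> U" "A i w \<noteq> 0" by auto
    define B where "B j u = A j u - A i u * A j w / A i w" for j u
    have "card I < card (U - {w})" using insert.prems insert.hyps w by auto
    then obtain v where v: "\<exists>u\<in>U - {w}. v u \<noteq> 0" "\<forall>j\<in>I. (\<Sum>u\<in>U - {w}. v u * B j u) = 0"
      using insert.IH[of "U - {w}" B] insert.prems by auto
    define c where "c = - (\<Sum>u\<in>U - {w}. v u * A i u) / A i w"
    define v' where "v' = v(w := c)"
    have s: "(\<Sum>u\<in>U. v' u * A j u) = c * A j w + (\<Sum>u\<in>U - {w}. v u * A j u)" for j
      using insert.prems w by (simp add: v'_def sum.remove[of U w])
    have "(\<Sum>u\<in>U. v' u * A j u) = 0" if "j \<in> I" for j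
    proof -
      have "(\<Sum>u\<in>U - {w}. v u * A j u) - (\<Sum>u\<in>U - {w}. v u * A i u) * A j w / A i w = 0"
        using v(2) that unfolding B_def
        by (simp add: right_diff_distrib sum_subtractf sum_distrib_right sum_divide_distrib mult.assoc)
      then show ?thesis unfolding s c_def by simp
    qed
    moreover have "(\<Sum>u\<in>U. v' u * A i u) = 0" unfolding s c_def using w by simp
    moreover have "\<exists>u\<in>U. v' u \<noteq> 0" using v(1) by (auto simp: v'_def)
    ultimately show ?thesis by (intro exI[of _ v']) auto
  qed
qed

text \<open>A kernel vector \<open>v\<close> of the constraints lets the weights be tilted by \<open>1 + t v u\<close> until one of
  them vanishes; by homogeneity of \<open>out_ent\<close> nothing else changes.\<close>

lemma reduce_support:
  fixes p :: "('u \<times> 'x::finite) pmf" and k :: "nat \<Rightarrow> 'x \<Rightarrow> 'y::finite pmf"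
  assumes fin: "finite (set_pmf p)" and big: "CARD('x) + K < card (fst ` set_pmf p)"
  obtains p' :: "('u \<times> 'x) pmf" where "finite (set_pmf p')" "map_pmf snd p' = map_pmf snd p"
    "\<forall>j<K. cond_ent (k j) p' = cond_ent (k j) p" "card (fst ` set_pmf p') < card (fst ` set_pmf p)"
proof -
  define U where "U = fst ` set_pmf p"
  have finU: "finite U" using fin by (simp add: U_def)
  \<comment> \<open>One constraint per input letter keeps p(x), hence also the total mass; one per
    kernel keeps H(Y_j|U).\<close>
  define I where "I = Inl ` (UNIV :: 'x set) \<union> Inr ` {..<K}"
  have "card I = CARD('x) + K"
    unfolding I_def by (subst card_Un_disjoint) (auto simp: card_image)
  define A where "A i u = (case i of Inl x \<Rightarrow> pmf p (u, x) | Inr j \<Rightarrow> out_ent (k j) (\<lambda>x. pmf p (u, x)))" for i u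
  obtain v where v: "\<exists>u\<in>U. v u \<noteq> 0" "\<forall>i\<in>I. (\<Sum>u\<in>U. v u * A i u) = 0"
    using ex_kernel_vector[of I U A] big finU \<open>card I = _\<close> by (auto simp: U_def[symmetric] I_def)
  have vx: "(\<Sum>u\<in>U. v u * pmf p (u, x)) = 0" for x
    using v(2)[rule_format, of "Inl x"] by (simp add: I_def A_def)
  have vG: "(\<Sum>u\<in>U. v u * out_ent (k j) (\<lambda>x. pmf p (u, x))) = 0" if "j < K" for j
    using v(2)[rule_format, of "Inr j"] that by (simp add: I_def A_def)
  define w where "w u = (\<Sum>x\<in>UNIV. pmf p (u, x))" for u
  have wpos: "w u > 0" if "u \<in> U" for u
  proof -
    obtain z where z: "z \<in> set_pmf p" "u = fst z" using \<open>u \<in> U\<close> unfolding U_def by (rule imageE)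
    obtain x where "z = (fst z, x)" by (cases z) auto
    with z have "(u, x) \<in> set_pmf p" by simp
    then have "0 < pmf p (u, x)" by (simp add: pmf_positive)
    also have "\<dots> \<le> w u" unfolding w_def by (rule member_le_sum) auto
    finally show ?thesis .
  qed
  have vw: "(\<Sum>u\<in>U. v u * w u) = 0"
    unfolding w_def sum_distrib_left by (subst sum.swap) (simp add: vx)
  \<comment> \<open>\<open>v\<close> is nonzero and sums to 0 against the positive weights
    \<open>w\<close>, so it takes negative values. This makes the divisor \<open>t\<close> below
    positive.\<close>
  have "\<exists>u\<in>U. v u < 0"
  proof (rule ccontr)
    assume "\<not> ?thesis"
    then have nn: "\<forall>u\<in>U. 0 \<le> v u * w u" using wpos by (force intro: mult_nonneg_nonneg)
    have "\<forall>u\<in>U. v u * w u = 0"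
      using sum_nonneg_eq_0_iff[OF finU, of "\<lambda>u. v u * w u"] nn vw by simp
    then show False using v(1) wpos by force
  qed
  then have ne: "U \<noteq> {}" by auto
  define t where "t = Max ((\<lambda>u. - v u) ` U)"
  have tmax: "- v u \<le> t" if "u \<in> U" for u using that finU by (simp add: t_def)
  have tpos: "t > 0" using \<open>\<exists>u\<in>U. v u < 0\<close> tmax by force
  have "t \<in> (\<lambda>u. - v u) ` U" unfolding t_def using finU ne by (intro Max_in) auto
  then obtain u0 where u0: "u0 \<in> U" "- v u0 = t" by auto
  define c where "c u = (if u \<in> U then 1 + v u / t else 0)" for u
  have c0: "c u \<ge> 0" for u using tmax[of u] tpos by (auto simp: c_def field_simps)
  have cu0: "c u0 = 0" using u0 tpos by (simp add: c_def field_simps)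
  have sumc: "(\<Sum>u\<in>U. c u * h u) = (\<Sum>u\<in>U. h u)" if "(\<Sum>u\<in>U. v u * h u) = 0" for h
  proof -
    have "(\<Sum>u\<in>U. c u * h u) = (\<Sum>u\<in>U. h u + v u * h u / t)"
      by (intro sum.cong) (auto simp: c_def algebra_simps)
    also have "\<dots> = (\<Sum>u\<in>U. h u) + (\<Sum>u\<in>U. v u * h u) / t"
      by (simp add: sum.distrib sum_divide_distrib)
    finally show ?thesis using that by simp
  qed
  let ?f = "\<lambda>(u, x). c u * pmf p (u, x)"
  have mass: "(\<Sum>u\<in>U. w u) = 1"
  proof -
    have "(\<Sum>u\<in>U. w u) = (\<Sum>u\<in>U. pmf (map_pmf fst p) u)"
      by (simp add: w_def pmf_map_fst[OF fin])
    also have "\<dots> = 1" by (rule sum_pmf_eq_1) (use finU in \<open>auto simp: U_def\<close>)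
    finally show ?thesis .
  qed
  obtain p' where p': "\<And>z. pmf p' z = ?f z" "set_pmf p' \<subseteq> U \<times> UNIV"
  proof (rule ex_finite_pmf[of "U \<times> UNIV" ?f])
    have "(\<Sum>z\<in>U \<times> UNIV. ?f z) = (\<Sum>u\<in>U. c u * w u)"
      by (simp add: sum.cartesian_product[symmetric] w_def sum_distrib_left)
    then show "(\<Sum>z\<in>U \<times> UNIV. ?f z) = 1" using sumc[OF vw] mass by simp
    show "0 \<le> ?f z" for z using c0 by (auto split: prod.splits)
    show "?f z = 0" if "z \<notin> U \<times> UNIV" for z using that by (auto simp: c_def split: prod.splits)
  qed (use finU in auto)
  have "finite (set_pmf p')" using p'(2) finU by (meson finite_SigmaI finite finite_subset)
  moreover have sub: "fst ` set_pmf p' \<subseteq> U" using p'(2) by auto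
  have "map_pmf snd p' = map_pmf snd p"
  proof (rule pmf_eqI)
    fix x
    have "pmf (map_pmf snd p') x = (\<Sum>u\<in>U. c u * pmf p (u, x))"
      by (simp add: pmf_map_snd[OF finU sub] p'(1))
    also have "\<dots> = (\<Sum>u\<in>U. pmf p (u, x))" by (rule sumc) (rule vx)
    also have "\<dots> = pmf (map_pmf snd p) x"
      by (subst pmf_map_snd[where A = U]) (use finU in \<open>auto simp: U_def\<close>)
    finally show "pmf (map_pmf snd p') x = pmf (map_pmf snd p) x" .
  qed
  moreover have "cond_ent (k j) p' = cond_ent (k j) p" if j: "j < K" for j
  proof -
    have "cond_ent (k j) p' = (\<Sum>u\<in>U. c u * out_ent (k j) (\<lambda>x. pmf p (u, x)))"
      unfolding cond_ent_superset[OF finU sub] by (simp add: p'(1) out_ent_scale c0)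
    also have "\<dots> = (\<Sum>u\<in>U. out_ent (k j) (\<lambda>x. pmf p (u, x)))" by (rule sumc) (rule vG[OF j])
    finally show ?thesis by (simp add: cond_ent_def U_def)
  qed
  moreover have "card (fst ` set_pmf p') < card U"
  proof (rule psubset_card_mono[OF finU])
    have "u0 \<notin> fst ` set_pmf p'" using cu0 by (auto simp: set_pmf_iff p'(1))
    then show "fst ` set_pmf p' \<subset> U" using sub u0 by auto
  qed
  ultimately show ?thesis using that[of p'] by (simp add: U_def)
qed

lemma bounded_support:
  fixes p :: "('u \<times> 'x::finite) pmf" and k :: "nat \<Rightarrow> 'x \<Rightarrow> 'y::finite pmf"
  assumes "finite (set_pmf p)"
  shows "\<exists>p' :: ('u \<times> 'x) pmf. finite (set_pmf p') \<and> map_pmf snd p' = map_pmf snd p \<and>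
    (\<forall>j<K. cond_ent (k j) p' = cond_ent (k j) p) \<and> card (fst ` set_pmf p') \<le> CARD('x) + K"
  using assms
proof (induction "card (fst ` set_pmf p)" arbitrary: p rule: less_induct)
  case less
  show ?case
  proof (cases "card (fst ` set_pmf p) \<le> CARD('x) + K")
    case True
    then show ?thesis using less.prems by blast
  next
    case False
    obtain p' :: "('u \<times> 'x) pmf" where p': "finite (set_pmf p')" "map_pmf snd p' = map_pmf snd p"
      "\<forall>j<K. cond_ent (k j) p' = cond_ent (k j) p" "card (fst ` set_pmf p') < card (fst ` set_pmf p)"
      by (rule reduce_support[OF less.prems, of K k]) (use False in auto)
    then show ?thesis using less.hyps[OF p'(4,1)] by auto
  qed
qed

text \<open>Renaming the values of U places all auxiliaries in one finite set that does not depend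
  on \<open>p\<close>, so that a sequence of such laws has a convergent subsequence.\<close>

lemma bounded_nat_support:
  fixes p :: "('u \<times> 'x::finite) pmf" and k :: "nat \<Rightarrow> 'x \<Rightarrow> 'y::finite pmf"
  assumes "finite (set_pmf p)"
  obtains p' :: "(nat \<times> 'x) pmf" where "fst ` set_pmf p' \<subseteq> {..<CARD('x) + K}"
    "map_pmf snd p' = map_pmf snd p" "\<forall>j<K. cond_ent (k j) p' = cond_ent (k j) p"
proof -
  obtain q :: "('u \<times> 'x) pmf" where q: "finite (set_pmf q)" "map_pmf snd q = map_pmf snd p"
    "\<forall>j<K. cond_ent (k j) q = cond_ent (k j) p" "card (fst ` set_pmf q) \<le> CARD('x) + K"
    using bounded_support[OF assms, of K k] by blast
  obtain h where h: "bij_betw h (fst ` set_pmf q) {0..<card (fst ` set_pmf q)}"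
    using ex_bij_betw_finite_nat[of "fst ` set_pmf q"] q(1) by auto
  let ?p = "map_pmf (\<lambda>(u,x). (h u, x)) q"
  show ?thesis
  proof (rule that[of ?p])
    show "fst ` set_pmf ?p \<subseteq> {..<CARD('x) + K}"
      using bij_betwE[OF h] q(4) by force
    show "map_pmf snd ?p = map_pmf snd p"
      using q(2) by (simp add: map_pmf_comp case_prod_unfold)
    show "\<forall>j<K. cond_ent (k j) ?p = cond_ent (k j) p"
    proof (intro allI impI)
      fix j assume "j < K"
      then show "cond_ent (k j) ?p = cond_ent (k j) p"
        using q(3) h by (subst cond_ent_relabel[OF q(1)]) (auto simp: bij_betw_def)
    qed
  qed
qed

lemma tendsto_eta:
  assumes "a \<longlonglongrightarrow> l" "\<And>n. 0 \<le> a n"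
  shows "(\<lambda>n. eta (a n)) \<longlonglongrightarrow> eta l"
proof (cases "l = 0")
  case False
  then have "l > 0" using LIMSEQ_le_const[OF assms(1), of 0] assms(2) by (auto simp: less_le)
  then show ?thesis unfolding eta_def using assms(1) by (intro tendsto_intros) auto
next
  case True
  \<comment> \<open>Continuity at 0 is the limit t log t -> 0 from the right; one side is enough
    because the sequence is nonnegative.\<close>
  have "((\<lambda>t::real. - t * log 2 t) \<longlongrightarrow> 0) (at_right 0)" by real_asymp
  then have "(eta \<longlongrightarrow> eta 0) (at_right 0)" by (simp add: eta_def[abs_def])
  then have "continuous (at 0 within {0..}) eta"
    by (simp add: continuous_within at_within_Ici_at_right)
  then show ?thesis
    unfolding True
    by (rule continuous_within_tendsto_compose') (use assms True in auto)
qed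

lemma tendsto_out_ent:
  fixes k :: "'x::finite \<Rightarrow> 'y::finite pmf"
  assumes "\<And>x. (\<lambda>n. a n x) \<longlonglongrightarrow> b x" "\<And>n x. 0 \<le> a n x"
  shows "(\<lambda>n. out_ent k (a n)) \<longlonglongrightarrow> out_ent k b"
  unfolding out_ent_def
  by (intro tendsto_diff tendsto_sum tendsto_eta tendsto_mult assms tendsto_const sum_nonneg mult_nonneg_nonneg) auto

lemma ex_convergent_subseq:
  fixes f :: "nat \<Rightarrow> 'a \<Rightarrow> real"
  assumes "finite F" "\<And>n z. f n z \<in> {0..1}"
  shows "\<exists>r. strict_mono r \<and> (\<forall>z\<in>F. convergent (\<lambda>n. f (r n) z))"
  using assms(1)
proof (induction F rule: finite_induct)
  case empty
  then show ?case by (intro exI[of _ id]) (auto simp: strict_mono_def)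
next
  case (insert z F)
  then obtain r where r: "strict_mono r" "\<forall>z\<in>F. convergent (\<lambda>n. f (r n) z)" by blast
  have "seq_compact {0..1::real}" by (intro compact_imp_seq_compact) auto
  then obtain l s where s: "strict_mono s" "((\<lambda>n. f (r n) z) \<circ> s) \<longlonglongrightarrow> l"
    by (rule seq_compactE[where f = "\<lambda>n. f (r n) z"]) (use assms(2) in auto)
  have "convergent (\<lambda>n. f (r (s n)) z')" if "z' \<in> F" for z'
    using convergent_subseq_convergent[OF r(2)[rule_format, OF that] s(1)] by (simp add: o_def)
  moreover have "convergent (\<lambda>n. f (r (s n)) z)"
    using s(2) by (auto simp: convergent_def o_def)
  ultimately show ?case
    using strict_mono_o[OF r(1) s(1)] by (intro exI[of _ "r \<circ> s"]) (auto simp del: o_apply simp: o_def)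
qed

lemma pmf_seq_compact:
  fixes p :: "nat \<Rightarrow> 'a pmf"
  assumes "finite F" "\<And>n. set_pmf (p n) \<subseteq> F"
  obtains r q where "strict_mono r" "set_pmf q \<subseteq> F" "\<And>z. (\<lambda>n. pmf (p (r n)) z) \<longlonglongrightarrow> pmf q z"
proof -
  obtain r where r: "strict_mono r" "\<forall>z\<in>F. convergent (\<lambda>n. pmf (p (r n)) z)"
    using ex_convergent_subseq[OF assms(1), of "\<lambda>n. pmf (p n)"] by (auto simp: pmf_le_1)
  define f where "f z = lim (\<lambda>n. pmf (p (r n)) z)" for z
  have z0: "pmf (p n) z = 0" if "z \<notin> F" for n z using assms(2)[of n] that by (auto simp: set_pmf_iff)
  have lim: "(\<lambda>n. pmf (p (r n)) z) \<longlonglongrightarrow> f z" for z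
  proof (cases "z \<in> F")
    case True
    then show ?thesis using r(2) by (simp add: f_def convergent_LIMSEQ_iff)
  next
    case False
    then show ?thesis by (simp add: f_def z0)
  qed
  have "(\<lambda>n. \<Sum>z\<in>F. pmf (p (r n)) z) \<longlonglongrightarrow> (\<Sum>z\<in>F. f z)" by (intro tendsto_sum lim)
  moreover have "(\<Sum>z\<in>F. pmf (p (r n)) z) = 1" for n using assms by (intro sum_pmf_eq_1) auto
  ultimately have "(\<Sum>z\<in>F. f z) = 1" by (simp add: LIMSEQ_const_iff)
  moreover have "0 \<le> f z" for z using LIMSEQ_le_const[OF lim, of 0 z] by simp
  moreover have "f z = 0" if "z \<notin> F" for z by (simp add: f_def z0[OF that])
  ultimately obtain q where q: "\<And>z. pmf q z = f z" "set_pmf q \<subseteq> F"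
    using ex_finite_pmf[OF assms(1), of f] by metis
  show ?thesis using that[OF r(1) q(2)] lim by (simp add: q(1))
qed

text \<open>The three inequalities of the claimed region, with \<open>a\<close> the rate of M1 and
  \<open>b\<close> the rate of M2, loosened by \<open>d\<close>. For \<open>d = 0\<close> they are
  the region itself apart from the signs of the rates.\<close>

definition within_slack :: "('x::finite \<Rightarrow> 'y::finite list pmf) \<Rightarrow> nat \<Rightarrow> (nat \<times> 'x) pmf \<Rightarrow> real \<Rightarrow> real \<Rightarrow> real \<Rightarrow> bool" where
  "within_slack W K p d a b \<longleftrightarrow> finite (set_pmf p) \<and> b \<le> I_UY W p K + d \<and>
     (\<forall>j\<in>{1..K-1}. b + a \<le> I_XY_given_U W p j + I_UY W p K + d) \<and>
     b + a \<le> I_XY W (map_pmf snd p) (K - 1) + d"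

lemma within_slack_closed:
  fixes W :: "'x::finite \<Rightarrow> 'y::finite list pmf"
  assumes "\<And>d. d > 0 \<Longrightarrow> \<exists>p. within_slack W K p d a b"
  shows "\<exists>p. within_slack W K p 0 a b"
proof -
  define k where "k = out_kernel W"
  \<comment> \<open>\<open>Suc K\<close> because the support bound preserves \<open>cond_ent\<close>
    for indices strictly below its parameter, and receiver K has to be among them.\<close>
  define B where "B = CARD('x) + Suc K"
  have "\<exists>p. fst ` set_pmf p \<subseteq> {..<B} \<and> within_slack W K p (1 / real (Suc n)) a b" for n
  proof -
    obtain p where p: "within_slack W K p (1 / real (Suc n)) a b" using assms[of "1 / real (Suc n)"] by auto
    then have fin: "finite (set_pmf p)" by (simp add: within_slack_def)
    obtain p' :: "(nat \<times> 'x) pmf" where p': "fst ` set_pmf p' \<subseteq> {..<B}"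
      "map_pmf snd p' = map_pmf snd p" "\<forall>j<Suc K. cond_ent (k j) p' = cond_ent (k j) p"
      using bounded_nat_support[OF fin, of "Suc K" k] unfolding B_def by blast
    have fin': "finite (set_pmf p')"
      using p'(1) subset_times_UNIV[of p'] by (meson finite_SigmaI finite finite_subset finite_lessThan)
    have "within_slack W K p' (1 / real (Suc n)) a b"
      using p p' fin fin' unfolding within_slack_def
      by (auto simp: I_UY_eq I_XY_given_U_eq k_def)
    then show ?thesis using p'(1) by blast
  qed
  then obtain p where p: "\<And>n. fst ` set_pmf (p n) \<subseteq> {..<B}"
    "\<And>n. within_slack W K (p n) (1 / real (Suc n)) a b" by metis
  have fin: "finite (set_pmf (p n))" for n using p(2) by (simp add: within_slack_def)
  have "set_pmf (p n) \<subseteq> {..<B} \<times> UNIV" for n using p(1)[of n] subset_times_UNIV[of "p n"] by blast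
  then obtain r q where r: "strict_mono r" and q: "set_pmf q \<subseteq> {..<B} \<times> UNIV"
    "\<And>z. (\<lambda>n. pmf (p (r n)) z) \<longlonglongrightarrow> pmf q z"
    using pmf_seq_compact[of "{..<B} \<times> (UNIV :: 'x set)" p] by (metis finite_SigmaI finite_lessThan finite)
  have finq: "finite (set_pmf q)" using q(1) by (rule finite_subset) auto
  have fq: "fst ` set_pmf q \<subseteq> {..<B}" using q(1) by force
  have M: "(\<lambda>n. pmf (map_pmf snd (p (r n))) x) \<longlonglongrightarrow> pmf (map_pmf snd q) x" for x
    unfolding pmf_map_snd[OF finite_lessThan p(1)] pmf_map_snd[OF finite_lessThan fq]
    by (intro tendsto_sum q(2))
  have lG: "(\<lambda>n. out_ent (k j) (pmf (map_pmf snd (p (r n))))) \<longlonglongrightarrow> out_ent (k j) (pmf (map_pmf snd q))" for j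
    by (intro tendsto_out_ent M) auto
  have lC: "(\<lambda>n. noise_ent (k j) (pmf (map_pmf snd (p (r n))))) \<longlonglongrightarrow> noise_ent (k j) (pmf (map_pmf snd q))" for j
    unfolding noise_ent_def by (intro tendsto_sum tendsto_mult M tendsto_const)
  have lH: "(\<lambda>n. cond_ent (k j) (p (r n))) \<longlonglongrightarrow> cond_ent (k j) q" for j
    unfolding cond_ent_superset[OF finite_lessThan p(1)] cond_ent_superset[OF finite_lessThan fq]
    by (intro tendsto_sum tendsto_out_ent q(2)) auto
  have l1: "(\<lambda>n. I_UY W (p (r n)) j) \<longlonglongrightarrow> I_UY W q j" for j
    unfolding I_UY_eq[OF fin] I_UY_eq[OF finq] k_def[symmetric] by (intro tendsto_diff lG lH)
  have l2: "(\<lambda>n. I_XY_given_U W (p (r n)) j) \<longlonglongrightarrow> I_XY_given_U W q j" for j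
    unfolding I_XY_given_U_eq[OF fin] I_XY_given_U_eq[OF finq] k_def[symmetric] by (intro tendsto_diff lC lH)
  have l3: "(\<lambda>n. I_XY W (map_pmf snd (p (r n))) j) \<longlonglongrightarrow> I_XY W (map_pmf snd q) j" for j
    unfolding I_XY_eq k_def[symmetric] by (intro tendsto_diff lC lG)
  have l0: "(\<lambda>n. 1 / real (Suc (r n))) \<longlonglongrightarrow> 0"
    using LIMSEQ_subseq_LIMSEQ[OF LIMSEQ_Suc[OF lim_inverse_n'] r] by (simp add: o_def)
  note pr = p(2)[unfolded within_slack_def]
  have "b \<le> I_UY W q K + 0"
    using pr by (intro LIMSEQ_le_const[OF tendsto_add[OF l1 l0]]) blast
  moreover have "b + a \<le> I_XY_given_U W q j + I_UY W q K + 0" if "j \<in> {1..K-1}" for j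
    using pr that by (intro LIMSEQ_le_const[OF tendsto_add[OF tendsto_add[OF l2 l1] l0]]) blast
  moreover have "b + a \<le> I_XY W (map_pmf snd q) (K - 1) + 0"
    using pr by (intro LIMSEQ_le_const[OF tendsto_add[OF l3 l0]]) blast
  ultimately show ?thesis using finq unfolding within_slack_def by blast
qed

section \<open>Fano's inequality and time sharing\<close>

lemma measure_bind_pmf_finite:
  assumes "finite A" "set_pmf p \<subseteq> A"
  shows "measure (bind_pmf p f) S = (\<Sum>x\<in>A. pmf p x * measure (f x) S)"
proof -
  have e: "measure (measure_pmf M) S = pmf (map_pmf (\<lambda>x. x \<in> S) M) True" for M
    by (simp add: pmf_map vimage_def)
  show ?thesis
    unfolding e map_bind_pmf by (rule pmf_bind_finite[OF assms])
qed

text \<open>Gibbs' inequality against \<open>q\<close>, which gives 1/2 to the estimate and 1/(2N)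
  to every other value, of total mass at most 1. Then -log q is 1 if the estimate is right and 1 +
  log N if it is wrong, which is the origin of the constant 1.\<close>

lemma fano:
  fixes P :: "('a \<times> 'b) pmf"
  assumes fin: "finite (set_pmf P)" and A: "finite A" "fst ` set_pmf P \<subseteq> A" and N: "card A = N"
    and err: "measure P {z. e (snd z) \<noteq> fst z} \<le> \<epsilon>"
  shows "entropy P - entropy (map_pmf snd P) \<le> 1 + \<epsilon> * log 2 N"
proof -
  define pb where "pb = map_pmf snd P"
  have "A \<noteq> {}" using A(2) set_pmf_not_empty[of P] by auto
  then have N0: "N > 0" using A N by auto
  define q where "q z = (if fst z = e (snd z) then 1 / 2 else 1 / (2 * real N))" for z
  have q0: "q z > 0" for z using N0 by (simp add: q_def)
  have qsum: "(\<Sum>a\<in>A. q (a, b)) \<le> 1" for b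
  proof -
    have "(\<Sum>a\<in>A. q (a, b)) \<le> (\<Sum>a\<in>A. (if a = e b then 1 / 2 else 0) + 1 / (2 * real N))"
      by (intro sum_mono) (auto simp: q_def)
    also have "\<dots> \<le> 1" using A N N0 by (simp add: sum.distrib sum.delta')
    finally show ?thesis .
  qed
  have qs: "(\<Sum>z\<in>set_pmf P. pmf pb (snd z) * q z) \<le> 1"
  proof -
    define pb_q where "pb_q = (\<lambda>z. pmf pb (snd z) * q z)"
    have "(\<Sum>z\<in>set_pmf P. pb_q z) \<le> (\<Sum>z\<in>A \<times> snd ` set_pmf P. pb_q z)"
      using A fin by (intro sum_mono2) (force simp: pb_q_def q_def)+
    also have "\<dots> = (\<Sum>b\<in>snd ` set_pmf P. pmf pb b * (\<Sum>a\<in>A. q (a, b)))"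
    proof -
      have "(\<Sum>z\<in>A \<times> snd ` set_pmf P. pb_q z) = (\<Sum>a\<in>A. \<Sum>b\<in>snd ` set_pmf P. pb_q (a, b))"
        by (simp add: sum.cartesian_product)
      also have "\<dots> = (\<Sum>b\<in>snd ` set_pmf P. \<Sum>a\<in>A. pb_q (a, b))" by (rule sum.swap)
      finally show ?thesis by (simp add: pb_q_def sum_distrib_left)
    qed
    also have "\<dots> \<le> (\<Sum>b\<in>snd ` set_pmf P. pmf pb b * 1)"
      by (intro sum_mono mult_left_mono qsum) auto
    also have "\<dots> = 1" using fin by (simp add: pb_def sum_pmf_eq_1)
    finally show ?thesis by (simp add: pb_q_def)
  qed
  have "entropy P - entropy (map_pmf snd P) =
      (\<Sum>z\<in>set_pmf P. pmf P z * log 2 (pmf pb (snd z)) - pmf P z * log 2 (pmf P z))"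
    unfolding sum_subtractf pb_def sum_log_map[OF fin] by (simp add: entropy_def eta_def sum_negf)
  also have "\<dots> \<le> (\<Sum>z\<in>set_pmf P. (pmf P z + (if e (snd z) \<noteq> fst z then pmf P z else 0) * log 2 N) +
      (pmf pb (snd z) * q z - pmf P z) / ln 2)"
  proof (rule sum_mono)
    fix z assume z: "z \<in> set_pmf P"
    let ?p = "pmf P z" and ?b = "pmf pb (snd z)"
    have p: "?p > 0" "?b > 0" using z pmf_map_pos[OF z, of snd] by (auto simp: pb_def pmf_positive)
    have "ln (?b * q z / ?p) \<le> ?b * q z / ?p - 1" using p q0 by (intro ln_le_minus_one) auto
    then have "?p * ln (?b * q z / ?p) \<le> ?b * q z - ?p" using p by (simp add: field_simps)
    then have "?p * (ln ?b + ln (q z) - ln ?p) \<le> ?b * q z - ?p"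
      using p q0[of z] by (simp add: ln_mult ln_div)
    then have "?p * (ln ?b + ln (q z) - ln ?p) / ln 2 \<le> (?b * q z - ?p) / ln 2"
      by (simp add: divide_right_mono)
    moreover have "?p * (ln ?b + ln (q z) - ln ?p) / ln 2 =
        ?p * log 2 ?b - ?p * log 2 ?p + ?p * log 2 (q z)"
      by (simp add: log_def algebra_simps add_divide_distrib diff_divide_distrib)
    moreover have "?p * log 2 (q z) = - (?p + (if e (snd z) \<noteq> fst z then ?p else 0) * log 2 N)"
      using N0 by (auto simp: q_def log_divide log_mult algebra_simps)
    ultimately show "?p * log 2 ?b - ?p * log 2 ?p \<le>
      (?p + (if e (snd z) \<noteq> fst z then ?p else 0) * log 2 N) + (?b * q z - ?p) / ln 2"
      by linarith
  qed
  also have "\<dots> = (1 + (\<Sum>z\<in>set_pmf P. if e (snd z) \<noteq> fst z then pmf P z else 0) * log 2 N) +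
      ((\<Sum>z\<in>set_pmf P. pmf pb (snd z) * q z) - 1) / ln 2"
    using fin by (simp add: sum.distrib sum_subtractf sum_distrib_right sum_divide_distrib[symmetric] sum_pmf_eq_1)
  also have "(\<Sum>z\<in>set_pmf P. if e (snd z) \<noteq> fst z then pmf P z else 0) = measure P {z. e (snd z) \<noteq> fst z}"
    using measure_bind_pmf_finite[OF fin order_refl, of return_pmf "{z. e (snd z) \<noteq> fst z}"]
    by (auto simp: bind_return_pmf' indicator_def intro!: sum.cong)
  finally have "entropy P - entropy (map_pmf snd P) \<le> (1 + measure P {z. e (snd z) \<noteq> fst z} * log 2 N) +
      ((\<Sum>z\<in>set_pmf P. pmf pb (snd z) * q z) - 1) / ln 2" .
  moreover have "((\<Sum>z\<in>set_pmf P. pmf pb (snd z) * q z) - 1) / ln 2 \<le> 0"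
    using qs by (simp add: divide_le_0_iff)
  moreover have "measure P {z. e (snd z) \<noteq> fst z} * log 2 N \<le> \<epsilon> * log 2 N"
    using err N0 by (intro mult_right_mono) auto
  ultimately show ?thesis by linarith
qed

lemma entropy_pmf_of_set:
  assumes "finite A" "A \<noteq> {}"
  shows "entropy (pmf_of_set A) = log 2 (card A)"
proof -
  have "card A > 0" using assms by (simp add: card_gt_0_iff)
  then show ?thesis using assms by (simp add: entropy_def eta_def log_divide)
qed

text \<open>U = (I, V_I) with I uniform on the \<open>n\<close> time indices, renamed to a natural
  number. H(Y|U) and H(Y|X) average exactly. The output entropy of the averaged input can only grow,
  and it enters the mutual informations with a plus sign, so upper bounds on rates survive. The law
  \<open>p\<close> is chosen before the kernel and thus serves all receivers at once.\<close>

lemma time_sharing: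
  fixes \<Theta> :: "nat \<Rightarrow> ('v \<times> 'x::finite) pmf"
  assumes n: "n > 0" and fin: "\<And>i. i < n \<Longrightarrow> finite (set_pmf (\<Theta> i))"
  shows "\<exists>p :: (nat \<times> 'x) pmf. finite (set_pmf p) \<and> (\<forall>k :: 'x \<Rightarrow> 'y::finite pmf.
    cond_ent k p = (\<Sum>i<n. cond_ent k (\<Theta> i)) / n \<and>
    noise_ent k (pmf (map_pmf snd p)) = (\<Sum>i<n. noise_ent k (pmf (map_pmf snd (\<Theta> i)))) / n \<and>
    out_ent k (pmf (map_pmf snd p)) \<ge> (\<Sum>i<n. out_ent k (pmf (map_pmf snd (\<Theta> i)))) / n)"
proof -
  define q where "q = pmf_of_set {..<n} \<bind> (\<lambda>i. map_pmf (\<lambda>(v,x). ((i,v),x)) (\<Theta> i))"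
  define c where "c = 1 / real n"
  have c0: "c \<ge> 0" by (simp add: c_def)
  have ne: "{..<n} \<noteq> {}" using n by auto
  have mapi: "pmf (map_pmf (\<lambda>(v,x). ((i,v),x)) (\<Theta> i)) ((j,v),x) = (if i = j then pmf (\<Theta> i) (v,x) else 0)" for i j v x
  proof (cases "i = j")
    case True
    have "inj (\<lambda>(v::'v,x::'x). ((j,v),x))" by (auto simp: inj_on_def)
    from pmf_map_inj'[OF this, of "\<Theta> i" "(v,x)"] show ?thesis using True by simp
  next
    case False
    then show ?thesis by (auto intro!: pmf_map_outside)
  qed
  have pq: "pmf q ((i,v),x) = (if i < n then c * pmf (\<Theta> i) (v,x) else 0)" for i v x
    unfolding q_def
    by (subst pmf_bind_finite[where A = "{..<n}"])
       (use n ne in \<open>auto simp: mapi c_def indicator_def sum.delta if_distrib sum.delta' cong: if_cong\<close>)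
  have finq: "finite (set_pmf q)" unfolding q_def using fin ne by auto
  define A where "A = Sigma {..<n} (\<lambda>i. fst ` set_pmf (\<Theta> i))"
  have A: "finite A" "fst ` set_pmf q \<subseteq> A"
    unfolding A_def q_def using fin ne by auto force
  have Hq: "cond_ent k q = (\<Sum>i<n. cond_ent k (\<Theta> i)) / n" for k :: "'x \<Rightarrow> 'y pmf"
  proof -
    have "cond_ent k q = (\<Sum>(i,v)\<in>A. c * out_ent k (\<lambda>x. pmf (\<Theta> i) (v, x)))"
      unfolding cond_ent_superset[OF A]
      by (intro sum.cong refl) (auto simp: A_def pq out_ent_scale[OF c0])
    also have "\<dots> = (\<Sum>i<n. c * cond_ent k (\<Theta> i))"
      unfolding A_def cond_ent_def sum_distrib_left
      by (rule sum.Sigma[symmetric]) (use fin in auto)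
    finally show ?thesis by (simp add: c_def sum_divide_distrib)
  qed
  have mq: "pmf (map_pmf snd q) = (\<lambda>x. c * (\<Sum>i<n. pmf (map_pmf snd (\<Theta> i)) x))"
  proof
    fix x
    have "map_pmf snd q = pmf_of_set {..<n} \<bind> (\<lambda>i. map_pmf snd (\<Theta> i))"
      unfolding q_def map_bind_pmf by (simp add: map_pmf_comp case_prod_unfold)
    then show "pmf (map_pmf snd q) x = c * (\<Sum>i<n. pmf (map_pmf snd (\<Theta> i)) x)"
      using ne by (simp add: pmf_bind_pmf_of_set c_def)
  qed
  have Cq: "noise_ent k (pmf (map_pmf snd q)) = (\<Sum>i<n. noise_ent k (pmf (map_pmf snd (\<Theta> i)))) / n" for k :: "'x \<Rightarrow> 'y pmf"
    unfolding mq noise_ent_scale noise_ent_sum by (simp add: c_def)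
  have Gq: "out_ent k (pmf (map_pmf snd q)) \<ge> (\<Sum>i<n. out_ent k (pmf (map_pmf snd (\<Theta> i)))) / n" for k :: "'x \<Rightarrow> 'y pmf"
  proof -
    have "(\<Sum>i<n. out_ent k (pmf (map_pmf snd (\<Theta> i)))) \<le> out_ent k (\<lambda>x. \<Sum>i<n. pmf (map_pmf snd (\<Theta> i)) x)"
      by (rule superadditive_sum[OF superadditive_out_ent]) auto
    then show ?thesis unfolding mq
      by (subst out_ent_scale[OF c0]) (auto intro!: sum_nonneg simp: c_def divide_right_mono)
  qed
  obtain h :: "nat \<times> 'v \<Rightarrow> nat" where h: "inj_on h (fst ` set_pmf q)"
    using finite_imp_inj_to_nat_seg[of "fst ` set_pmf q"] finq by auto
  let ?p = "map_pmf (\<lambda>(u,x). (h u, x)) q"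
  have s: "map_pmf snd ?p = map_pmf snd q" by (simp add: map_pmf_comp case_prod_unfold)
  show ?thesis
    by (rule exI[of _ ?p]) (use finq Hq Cq Gq in \<open>auto simp: cond_ent_relabel[OF finq h] s\<close>)
qed

lemma length_channel_out: "yss \<in> set_pmf (channel_out W xs) \<Longrightarrow> length yss = length xs"
  by (induction xs arbitrary: yss) auto

lemma finite_channel_out:
  assumes "\<And>x. finite (set_pmf (W x))"
  shows "finite (set_pmf (channel_out W xs))"
  using assms by (induction xs) auto

text \<open>Memorylessness as an invariance: redrawing letter \<open>i\<close> from its own input
  letter does not change the law. This expresses the independence of letter \<open>i\<close> from
  the other letters without conditional laws.\<close>

lemma channel_out_resample:
  assumes "i < length xs"
  shows "channel_out W xs = channel_out W xs \<bind> (\<lambda>yss. map_pmf (\<lambda>y. yss[i := y]) (W (xs ! i)))"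
  using assms
proof (induction xs arbitrary: i)
  case (Cons x xs)
  show ?case
  proof (cases i)
    case 0
    then show ?thesis
      by (simp add: bind_assoc_pmf bind_return_pmf map_pmf_def)
         (rule bind_commute_pmf)
  next
    case (Suc i')
    then have IH: "channel_out W xs = channel_out W xs \<bind> (\<lambda>yss. map_pmf (\<lambda>y. yss[i' := y]) (W (xs ! i')))"
      using Cons by simp
    show ?thesis using Suc
      by (subst channel_out.simps, subst IH)
         (simp add: bind_assoc_pmf bind_return_pmf map_pmf_def)
  qed
qed simp

subsection \<open>Converse\<close>

text \<open>A label function \<open>c\<close> says which receiver's output is revealed at each time;
  \<open>c l = 0\<close> reveals nothing.\<close>

definition obs :: "(nat \<Rightarrow> nat) \<Rightarrow> 'y list list \<Rightarrow> nat \<Rightarrow> 'y option" where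
  "obs c yss l = (if c l = 0 then None else Some (yss ! l ! (c l - 1)))"

definition past_lab :: "nat \<Rightarrow> nat \<Rightarrow> nat \<Rightarrow> nat" where
  "past_lab j i l = (if l < i then j else 0)"

lemma past_lab_0 [simp]: "past_lab j 0 = (\<lambda>_. 0)"
  by (simp add: past_lab_def fun_eq_iff)

text \<open>The message type and law are left open, and in the views below a function
  \<open>s\<close> selects what is known of the message: M1, M2, both or nothing. One chain rule
  then covers every conditioning in the converse.\<close>

locale block_code =
  fixes W :: "'x::finite \<Rightarrow> 'y::finite list pmf" and src :: "'m pmf" and F :: "'m \<Rightarrow> 'x list" and n :: nat
  assumes finW: "\<And>x. finite (set_pmf (W x))" and fin_src: "finite (set_pmf src)"
    and lenF: "\<And>m. m \<in> set_pmf src \<Longrightarrow> length (F m) = n"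
begin

definition code_law :: "('m \<times> 'y list list) pmf" where
  "code_law = src \<bind> (\<lambda>m. map_pmf (Pair m) (channel_out W (F m)))"

definition view :: "('m \<Rightarrow> 's) \<Rightarrow> (nat \<Rightarrow> nat) \<Rightarrow> 'm \<times> 'y list list \<Rightarrow> 's \<times> (nat \<Rightarrow> 'y option)" where
  "view s c = (\<lambda>(m, yss). (s m, obs c yss))"

definition view_entropy :: "('m \<Rightarrow> 's) \<Rightarrow> (nat \<Rightarrow> nat) \<Rightarrow> real" where
  "view_entropy s c = entropy (map_pmf (view s c) code_law)"

text \<open>The law of (U_i, X_i), where U_i is the view and X_i the i-th input letter. As soon as
  the view is silent at time \<open>i\<close>, \<open>cond_ent (out_kernel W j)\<close> of it is the
  entropy of letter \<open>i\<close> at receiver \<open>j\<close> given the view.\<close>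

definition view_input :: "('m \<Rightarrow> 's) \<Rightarrow> (nat \<Rightarrow> nat) \<Rightarrow> nat \<Rightarrow> (('s \<times> (nat \<Rightarrow> 'y option)) \<times> 'x) pmf" where
  "view_input s c i = map_pmf (\<lambda>\<omega>. (view s c \<omega>, F (fst \<omega>) ! i)) code_law"

definition input_law :: "nat \<Rightarrow> 'x pmf" where
  "input_law i = map_pmf (\<lambda>m. F m ! i) src"

lemma fin_code_law: "finite (set_pmf code_law)"
  unfolding code_law_def using fin_src finite_channel_out[of W] finW by auto

lemma code_law_length: "(m, yss) \<in> set_pmf code_law \<Longrightarrow> m \<in> set_pmf src \<and> length yss = n"
  unfolding code_law_def using length_channel_out lenF by fastforce

lemma fin_view_input: "finite (set_pmf (view_input s c i))"
  unfolding view_input_def using fin_code_law by simp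

lemma map_fst_code_law: "map_pmf fst code_law = src"
  unfolding code_law_def by (simp add: map_bind_pmf map_pmf_comp bind_return_pmf')

lemma snd_view_input: "map_pmf snd (view_input s c i) = input_law i"
proof -
  have "map_pmf snd (view_input s c i) = map_pmf (\<lambda>m. F m ! i) (map_pmf fst code_law)"
    by (simp add: view_input_def map_pmf_comp)
  then show ?thesis by (simp add: map_fst_code_law input_law_def)
qed

text \<open>The chain rule for one letter. Since the view is silent at time \<open>i\<close>, that
  letter may be redrawn from the channel, so it is the output of a kernel acting on the input
  component of \<open>view_input s c i\<close>.\<close>

lemma view_entropy_step:
  assumes c: "c i = 0" and j: "j \<ge> 1" and i: "i < n"
  shows "view_entropy s (c(i := j)) - view_entropy s c = cond_ent (out_kernel W j) (view_input s c i)"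
proof -
  let ?\<phi> = "\<lambda>((a, w), y). (a, w(i := Some y))"
  let ?P = "uy_pmf (out_kernel W j) (view_input s c i)"
  have "map_pmf ?\<phi> ?P = src \<bind> (\<lambda>m. channel_out W (F m) \<bind>
      (\<lambda>yss. map_pmf (\<lambda>ys. (s m, (obs c yss)(i := Some (ys ! (j - 1))))) (W (F m ! i))))"
    unfolding uy_pmf_def view_input_def code_law_def view_def out_kernel_def
    by (simp add: map_bind_pmf bind_map_pmf map_pmf_comp bind_assoc_pmf)
  also have "\<dots> = src \<bind> (\<lambda>m. channel_out W (F m) \<bind>
      (\<lambda>yss. map_pmf (\<lambda>ys. view s (c(i := j)) (m, yss[i := ys])) (W (F m ! i))))"
  proof (intro bind_pmf_cong refl map_pmf_cong)
    fix m yss ys assume "m \<in> set_pmf src" "yss \<in> set_pmf (channel_out W (F m))"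
    then have "length yss = n" using length_channel_out lenF by metis
    then show "(s m, (obs c yss)(i := Some (ys ! (j - 1)))) = view s (c(i := j)) (m, yss[i := ys])"
      using i j by (auto simp: view_def obs_def fun_eq_iff nth_list_update)
  qed
  also have "\<dots> = src \<bind> (\<lambda>m. map_pmf (\<lambda>yss. view s (c(i := j)) (m, yss)) (channel_out W (F m)))"
  proof (intro bind_pmf_cong refl)
    fix m assume "m \<in> set_pmf src"
    then have "i < length (F m)" using lenF i by simp
    from channel_out_resample[OF this, of W]
    have "map_pmf (\<lambda>yss. view s (c(i := j)) (m, yss)) (channel_out W (F m)) =
      map_pmf (\<lambda>yss. view s (c(i := j)) (m, yss)) (channel_out W (F m) \<bind> (\<lambda>yss. map_pmf (\<lambda>y. yss[i := y]) (W (F m ! i))))"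
      by simp
    then show "channel_out W (F m) \<bind>
      (\<lambda>yss. map_pmf (\<lambda>ys. view s (c(i := j)) (m, yss[i := ys])) (W (F m ! i))) =
      map_pmf (\<lambda>yss. view s (c(i := j)) (m, yss)) (channel_out W (F m))"
      by (simp add: map_bind_pmf map_pmf_comp)
  qed
  also have "\<dots> = map_pmf (view s (c(i := j))) code_law"
    unfolding code_law_def by (simp add: map_bind_pmf map_pmf_comp)
  finally have e: "map_pmf (view s (c(i := j))) code_law = map_pmf ?\<phi> ?P" ..
  have none: "snd u i = None" if "(u, y) \<in> set_pmf ?P" for u y
    using that c unfolding uy_pmf_def view_input_def view_def obs_def by auto
  \<comment> \<open>Slot \<open>i\<close> of the view holds \<open>None\<close>, so writing the
    letter into it destroys nothing.\<close>
  have "inj_on ?\<phi> (set_pmf ?P)"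
  proof (rule inj_onI)
    fix p q assume "p \<in> set_pmf ?P" "q \<in> set_pmf ?P" "?\<phi> p = ?\<phi> q"
    moreover obtain a w y a' w' y' where pq: "p = ((a, w), y)" "q = ((a', w'), y')"
      by (metis surj_pair)
    ultimately have in1: "((a, w), y) \<in> set_pmf ?P" and in2: "((a', w'), y') \<in> set_pmf ?P"
      and eq: "a = a'" "w(i := Some y) = w'(i := Some y')" by auto
    have "w l = w' l" for l
    proof (cases "l = i")
      case True
      then show ?thesis using none[OF in1] none[OF in2] by simp
    next
      case False
      then show ?thesis using fun_cong[OF eq(2), of l] by simp
    qed
    moreover have "y = y'" using fun_cong[OF eq(2), of i] by simp
    ultimately show "p = q" using eq(1) by (auto simp: pq)
  qed
  then have "entropy (map_pmf (view s (c(i := j))) code_law) = entropy ?P"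
    unfolding e by (rule entropy_map_inj)
  moreover have "map_pmf fst (view_input s c i) = map_pmf (view s c) code_law"
    by (simp add: view_input_def map_pmf_comp)
  ultimately show ?thesis
    using entropy_uy[OF fin_view_input, of "out_kernel W j" s c i] by (simp add: view_entropy_def)
qed

lemma view_input_coarsen:
  assumes s: "\<And>m. s' m = t (s m)" and c: "\<And>l. c' l = 0 \<or> c' l = c l"
  shows "view_input s' c' i = map_pmf (\<lambda>(u,x). ((\<lambda>(a, w). (t a, \<lambda>l. if c' l = 0 then None else w l)) u, x)) (view_input s c i)"
proof -
  have "view s' c' \<omega> = (\<lambda>(a, w). (t a, \<lambda>l. if c' l = 0 then None else w l)) (view s c \<omega>)" for \<omega>
  proof -
    have "obs c' yss l = (if c' l = 0 then None else obs c yss l)" for yss :: "'y list list" and l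
      using c[of l] by (auto simp: obs_def)
    then show ?thesis by (cases \<omega>) (simp add: view_def s fun_eq_iff)
  qed
  then show ?thesis unfolding view_input_def by (simp add: map_pmf_comp)
qed

lemma cond_ent_view_input_mono:
  fixes k :: "'x \<Rightarrow> 'y pmf"
  assumes "\<And>m. s' m = t (s m)" "\<And>l. c' l = 0 \<or> c' l = c l"
  shows "cond_ent k (view_input s c i) \<le> cond_ent k (view_input s' c' i)"
  unfolding view_input_coarsen[of s' t s c' c, OF assms] by (rule cond_ent_coarsen[OF fin_view_input])

text \<open>If \<open>k\<close> is the kernel of the less noisy receiver, the part of the view that
  is discarded in passing to \<open>s'\<close> and \<open>c'\<close> carries at least as much
  information about the output of \<open>k\<close> as about that of \<open>k'\<close>.\<close>

lemma cond_ent_diff_mono: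
  fixes k k' :: "'x \<Rightarrow> 'y pmf"
  assumes D: "superadditive (\<lambda>a. out_ent k a - out_ent k' a)" and sc: "\<And>m. s' m = t (s m)" "\<And>l. c' l = 0 \<or> c' l = c l"
  shows "cond_ent k (view_input s c i) - cond_ent k' (view_input s c i) \<le> cond_ent k (view_input s' c' i) - cond_ent k' (view_input s' c' i)"
  using superadditive_coarsen[OF D fin_view_input, of s c i "\<lambda>(a, w). (t a, \<lambda>l. if c' l = 0 then None else w l)"]
  unfolding view_input_coarsen[of s' t s c' c, OF sc] cond_ent_def sum_subtractf
  by (simp add: image_image case_prod_unfold)

lemma view_entropy_prefix: "view_entropy s (past_lab j n) - view_entropy s (\<lambda>_. 0) = (\<Sum>i<n. cond_ent (out_kernel W j) (view_input s (past_lab j i) i))" if "j \<ge> 1"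
proof -
  have "view_entropy s (past_lab j m) - view_entropy s (\<lambda>_. 0) = (\<Sum>i<m. cond_ent (out_kernel W j) (view_input s (past_lab j i) i))" if "m \<le> n" for m
    using that
  proof (induction m)
    case (Suc m)
    have "past_lab j (Suc m) = (past_lab j m)(m := j)" by (auto simp: past_lab_def fun_eq_iff)
    moreover have "past_lab j m m = 0" by (simp add: past_lab_def)
    ultimately have "view_entropy s (past_lab j (Suc m)) - view_entropy s (past_lab j m) = cond_ent (out_kernel W j) (view_input s (past_lab j m) m)"
      using view_entropy_step[of "past_lab j m" m j s] \<open>j \<ge> 1\<close> Suc.prems by (simp only: Suc_le_eq)
    then show ?case using Suc by simp
  qed simp
  then show ?thesis by simp
qed

definition future_lab :: "nat \<Rightarrow> nat \<Rightarrow> nat \<Rightarrow> nat" where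
  "future_lab z i l = (if i \<le> l \<and> l < n then z else 0)"

text \<open>The chain rule run backwards from the last letter. The auxiliary of class (A) contains
  the future of receiver K and not its past, so the forward expansion would not be comparable with
  it.\<close>

lemma view_entropy_suffix: "view_entropy s (past_lab z n) - view_entropy s (\<lambda>_. 0) = (\<Sum>i<n. cond_ent (out_kernel W z) (view_input s (future_lab z (Suc i)) i))" if "z \<ge> 1"
proof -
  have tel: "view_entropy s (future_lab z 0) - view_entropy s (future_lab z m) = (\<Sum>i<m. cond_ent (out_kernel W z) (view_input s (future_lab z (Suc i)) i))" if "m \<le> n" for m
    using that
  proof (induction m)
    case (Suc m)
    have "future_lab z m = (future_lab z (Suc m))(m := z)" using Suc.prems by (auto simp: future_lab_def fun_eq_iff)
    moreover have "future_lab z (Suc m) m = 0" by (simp add: future_lab_def)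
    ultimately have "view_entropy s (future_lab z m) - view_entropy s (future_lab z (Suc m)) = cond_ent (out_kernel W z) (view_input s (future_lab z (Suc m)) m)"
      using view_entropy_step[of "future_lab z (Suc m)" m z s] \<open>z \<ge> 1\<close> Suc.prems by (simp only: Suc_le_eq)
    then show ?case using Suc by simp
  qed simp
  have "future_lab z n = (\<lambda>_. 0)" "future_lab z 0 = past_lab z n" by (auto simp: future_lab_def past_lab_def fun_eq_iff)
  with tel[of n] show ?thesis by (simp only: order_refl simp_thms)
qed

definition mixed_lab :: "nat \<Rightarrow> nat \<Rightarrow> nat \<Rightarrow> nat \<Rightarrow> nat" where
  "mixed_lab y z i l = (if l < i then y else if l = i then 0 else if l < n then z else 0)"

text \<open>A telescoped form of the Csiszar sum identity. The hybrids \<open>mix i\<close> and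
  \<open>mix (Suc i)\<close> differ only in whose letter is shown at time \<open>i\<close>, and both
  extend the view \<open>mixed_lab y z i\<close> by that single letter.\<close>

lemma view_entropy_exchange:
  assumes "y \<ge> 1" "z \<ge> 1"
  shows "view_entropy s (past_lab y n) - view_entropy s (past_lab z n) =
    (\<Sum>i<n. cond_ent (out_kernel W y) (view_input s (mixed_lab y z i) i) - cond_ent (out_kernel W z) (view_input s (mixed_lab y z i) i))"
proof -
  define mix where "mix i l = (if l < i then y else if l < n then z else 0)" for i l :: nat
  have tel: "view_entropy s (mix m) - view_entropy s (mix 0) =
    (\<Sum>i<m. cond_ent (out_kernel W y) (view_input s (mixed_lab y z i) i) - cond_ent (out_kernel W z) (view_input s (mixed_lab y z i) i))" if "m \<le> n" for m
    using that
  proof (induction m)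
    case (Suc m)
    have "mix (Suc m) = (mixed_lab y z m)(m := y)" "mix m = (mixed_lab y z m)(m := z)"
      using Suc.prems by (auto simp: mix_def mixed_lab_def fun_eq_iff)
    moreover have "mixed_lab y z m m = 0" by (simp add: mixed_lab_def)
    ultimately have "view_entropy s (mix (Suc m)) - view_entropy s (mixed_lab y z m) = cond_ent (out_kernel W y) (view_input s (mixed_lab y z m) m)"
      "view_entropy s (mix m) - view_entropy s (mixed_lab y z m) = cond_ent (out_kernel W z) (view_input s (mixed_lab y z m) m)"
      using view_entropy_step[of "mixed_lab y z m" m y s] view_entropy_step[of "mixed_lab y z m" m z s] assms Suc.prems by (simp_all only: Suc_le_eq)
    then show ?case using Suc by simp
  qed simp
  have "mix n = past_lab y n" "mix 0 = past_lab z n" by (auto simp: mix_def past_lab_def fun_eq_iff)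
  with tel[of n] show ?thesis by (simp only: order_refl simp_thms)
qed

text \<open>Replacing the past of the noisier receiver by that of the less noisy one, a letter at a time,
  only reduces the uncertainty.\<close>

lemma past_less_noisy:
  assumes D: "superadditive (\<lambda>a. out_ent (out_kernel W j) a - out_ent (out_kernel W k) a)" and "j \<ge> 1" "k \<ge> 1" and i: "i < n"
  shows "cond_ent (out_kernel W j) (view_input s (past_lab j i) i) \<le> cond_ent (out_kernel W j) (view_input s (past_lab k i) i)"
proof -
  define T where "T r l = (if l < r then k else if l < i then j else 0)" for r l :: nat
  have tel: "cond_ent (out_kernel W j) (view_input s (T 0) i) \<le> cond_ent (out_kernel W j) (view_input s (T r) i)" if "r \<le> i" for r
    using that
  proof (induction r)
    case (Suc r)
    \<comment> \<open>Without its label at \<open>r\<close> the view is a common base, which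
      \<open>T r\<close> and \<open>T (Suc r)\<close> both extend by one letter.\<close>
    define c where "c = (T r)(r := 0)"
    have ri: "r \<noteq> i" "r < n" using Suc.prems i by auto
    have c0: "c r = 0" "c i = 0" "T r i = 0" "T (Suc r) i = 0" using Suc.prems by (auto simp: c_def T_def)
    have T: "T r = c(r := j)" "T (Suc r) = c(r := k)"
      using Suc.prems by (auto simp: c_def T_def fun_eq_iff)
    \<comment> \<open>The less noisy comparison is made at letter \<open>r\<close>, with letter
      \<open>i\<close> of receiver \<open>j\<close> as the additional knowledge. Written as joint
      entropies and regrouped, the same inequality compares the uncertainty of letter
      \<open>i\<close> given either version of letter \<open>r\<close>.\<close>
    have "cond_ent (out_kernel W j) (view_input s (c(i := j)) r) - cond_ent (out_kernel W k) (view_input s (c(i := j)) r)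
        \<le> cond_ent (out_kernel W j) (view_input s c r) - cond_ent (out_kernel W k) (view_input s c r)"
      by (rule cond_ent_diff_mono[OF D, where t = "\<lambda>x. x"]) (use c0 in auto)
    moreover have "cond_ent (out_kernel W j) (view_input s (T r) i) = view_entropy s (c(i := j, r := j)) - view_entropy s (c(r := j))"
      using view_entropy_step[of "T r" i j s] c0 i \<open>j \<ge> 1\<close> ri by (simp add: T fun_upd_twist)
    moreover have "cond_ent (out_kernel W j) (view_input s (T (Suc r)) i) = view_entropy s (c(i := j, r := k)) - view_entropy s (c(r := k))"
      using view_entropy_step[of "T (Suc r)" i j s] c0 i \<open>j \<ge> 1\<close> ri by (simp add: T fun_upd_twist)
    moreover have "cond_ent (out_kernel W a) (view_input s c r) = view_entropy s (c(r := a)) - view_entropy s c" if "a \<ge> 1" for a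
      using view_entropy_step[of c r a s] c0 ri that by simp
    moreover have "cond_ent (out_kernel W a) (view_input s (c(i := j)) r) = view_entropy s (c(i := j, r := a)) - view_entropy s (c(i := j))" if "a \<ge> 1" for a
      using view_entropy_step[of "c(i := j)" r a s] c0 ri that by simp
    ultimately have "cond_ent (out_kernel W j) (view_input s (T r) i) \<le> cond_ent (out_kernel W j) (view_input s (T (Suc r)) i)"
      using \<open>j \<ge> 1\<close> \<open>k \<ge> 1\<close> by simp
    then show ?case using Suc by simp
  qed simp
  have "T 0 = past_lab j i" "T i = past_lab k i" by (auto simp: T_def past_lab_def fun_eq_iff)
  with tel[of i] show ?thesis by (simp only: order_refl simp_thms)
qed

lemma view_entropy_const_le:
  assumes "j \<ge> 1"
  shows "view_entropy (\<lambda>_. ()) (past_lab j n) \<le> (\<Sum>i<n. out_ent (out_kernel W j) (pmf (input_law i)))"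
proof -
  have "map_pmf (view (\<lambda>_. ()) (\<lambda>_. 0)) code_law = map_pmf (\<lambda>_. ((), \<lambda>_. None)) code_law"
    by (intro map_pmf_cong) (auto simp: view_def obs_def fun_eq_iff)
  then have "view_entropy (\<lambda>_. ()) (\<lambda>_. 0) = 0" by (simp add: view_entropy_def)
  moreover have "(\<Sum>i<n. cond_ent (out_kernel W j) (view_input (\<lambda>_. ()) (past_lab j i) i)) \<le> (\<Sum>i<n. out_ent (out_kernel W j) (pmf (input_law i)))"
    by (intro sum_mono) (metis cond_ent_le_out_ent fin_view_input snd_view_input)
  ultimately show ?thesis using view_entropy_prefix[OF assms, of "\<lambda>_. ()"] by simp
qed

lemma noise_ent_le_view_entropy:
  assumes "j \<ge> 1"
  shows "(\<Sum>i<n. noise_ent (out_kernel W j) (pmf (input_law i))) \<le> view_entropy s (past_lab j n) - view_entropy s (\<lambda>_. 0)"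
  unfolding view_entropy_prefix[OF assms] by (intro sum_mono) (metis noise_ent_le_cond_ent fin_view_input snd_view_input)

lemma view_entropy_relabel:
  assumes "inj t"
  shows "view_entropy (\<lambda>m. t (s m)) c = view_entropy s c"
proof -
  have "map_pmf (view (\<lambda>m. t (s m)) c) code_law = map_pmf (map_prod t id) (map_pmf (view s c) code_law)"
    by (simp add: map_pmf_comp view_def case_prod_unfold)
  then show ?thesis unfolding view_entropy_def
    using assms by (simp add: entropy_map_inj inj_on_def map_prod_def case_prod_unfold prod_eq_iff)
qed

lemma view_entropy_0: "view_entropy s (\<lambda>_. 0) = entropy (map_pmf s src)"
proof -
  have "map_pmf (view s (\<lambda>_. 0)) code_law = map_pmf (\<lambda>a. (a, \<lambda>_. None)) (map_pmf s (map_pmf fst code_law))"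
    unfolding map_pmf_comp by (intro map_pmf_cong) (auto simp: view_def obs_def fun_eq_iff)
  then show ?thesis unfolding view_entropy_def map_fst_code_law by (simp add: entropy_map_inj inj_on_def)
qed

text \<open>\<open>a\<close> is the message to be decoded and \<open>b\<close> side knowledge that
  the decoder ignores; the left-hand side is H(a | Y_j^n, b).\<close>

lemma view_entropy_fano:
  assumes j: "j \<ge> 1" and A: "finite A" "\<And>m. m \<in> set_pmf src \<Longrightarrow> a m \<in> A" "card A = N"
    and err: "measure code_law {z. e (recv j (snd z)) \<noteq> a (fst z)} \<le> \<epsilon>"
  shows "view_entropy (\<lambda>m. (a m, b m)) (past_lab j n) - view_entropy b (past_lab j n) \<le> 1 + \<epsilon> * log 2 N"
proof -
  let ?P = "map_pmf (\<lambda>z. (a (fst z), view b (past_lab j n) z)) code_law"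
  \<comment> \<open>The decoder reads a list, whereas the view is an option-valued function;
    \<open>the\<close> is safe since every label below \<open>n\<close> is \<open>j\<close>, which
    is at least 1.\<close>
  let ?d = "\<lambda>(u, w). e (map (\<lambda>l. the (w l)) [0..<n])"
  have r: "recv j yss = map (\<lambda>l. the (obs (past_lab j n) yss l)) [0..<n]" if "length yss = n" for yss :: "'y list list"
    using that j by (auto simp: recv_def obs_def past_lab_def intro!: nth_equalityI)
  have "measure ?P {z. ?d (snd z) \<noteq> fst z} = measure code_law {z. ?d (view b (past_lab j n) z) \<noteq> a (fst z)}"
    by (simp add: vimage_def)
  also have "\<dots> = measure code_law {z. e (recv j (snd z)) \<noteq> a (fst z)}"
    by (rule measure_prob_cong_0) (auto simp: view_def set_pmf_iff[symmetric] pmf_eq_0_set_pmf r dest!: code_law_length)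
  finally have "measure ?P {z. ?d (snd z) \<noteq> fst z} \<le> \<epsilon>" using err by simp
  moreover have "fst ` set_pmf ?P \<subseteq> A" using A(2) code_law_length by auto
  ultimately have "entropy ?P - entropy (map_pmf snd ?P) \<le> 1 + \<epsilon> * log 2 N"
    using fin_code_law A by (intro fano[where A = A and e = ?d]) auto
  moreover have "map_pmf snd ?P = map_pmf (view b (past_lab j n)) code_law" by (simp add: map_pmf_comp)
  moreover have "map_pmf (view (\<lambda>m. (a m, b m)) (past_lab j n)) code_law = map_pmf (\<lambda>(x,y,z). ((x,y),z)) ?P"
    by (simp add: map_pmf_comp view_def case_prod_unfold)
  then have "view_entropy (\<lambda>m. (a m, b m)) (past_lab j n) = entropy ?P"
    unfolding view_entropy_def by (simp only:) (rule entropy_map_inj, rule inj_on_subset[OF _ subset_UNIV], auto simp: inj_on_def)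
  ultimately show ?thesis by (simp add: view_entropy_def)
qed

end

section \<open>Converse for one block code and passage to the limit\<close>

lemma cond_ent_more_capable:
  fixes W :: "'x::finite \<Rightarrow> 'y::finite list pmf"
  assumes mc: "more_capable W s c" and fin: "finite (set_pmf p)"
  shows "cond_ent (out_kernel W c) p - noise_ent (out_kernel W c) (pmf (map_pmf snd p)) \<le>
    cond_ent (out_kernel W s) p - noise_ent (out_kernel W s) (pmf (map_pmf snd p))"
proof -
  let ?A = "fst ` set_pmf p"
  have "pmf (map_pmf snd p) = (\<lambda>x. \<Sum>u\<in>?A. pmf p (u, x))"
    by (rule ext, rule pmf_map_snd) (use fin in auto)
  then have "cond_ent k p - noise_ent k (pmf (map_pmf snd p)) =
      (\<Sum>u\<in>?A. out_ent k (\<lambda>x. pmf p (u, x)) - noise_ent k (\<lambda>x. pmf p (u, x)))" for k :: "'x \<Rightarrow> 'y pmf"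
    by (simp add: noise_ent_sum cond_ent_def sum_subtractf)
  then show ?thesis by (simp add: sum_mono more_capable_vec[OF mc])
qed

lemma chain_rule:
  fixes W :: "'x::finite \<Rightarrow> 'y::finite list pmf"
  assumes "finite (set_pmf p)"
  shows "I_XY_given_U W p j + I_UY W p j = I_XY W (map_pmf snd p) j"
  using assms by (simp add: I_XY_given_U_eq I_UY_eq I_XY_eq)

lemma pmf_of_set_lessThan:
  assumes "N > 0"
  shows "pmf (pmf_of_set {..<N}) i = (if i < N then 1 / real N else 0)"
proof -
  have "{..<N} \<noteq> {}" using assms by auto
  then show ?thesis by (simp add: indicator_def)
qed

lemma measure_code_law:
  assumes "block_code W (pair_pmf (pmf_of_set {..<N1}) (pmf_of_set {..<N2})) F n" and N: "N1 > 0" "N2 > 0"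
  shows "measure (block_code.code_law W (pair_pmf (pmf_of_set {..<N1}) (pmf_of_set {..<N2})) F) {z. snd z \<in> B (fst z)} =
    (\<Sum>m1<N1. \<Sum>m2<N2. measure (channel_out W (F (m1, m2))) (B (m1, m2))) / (real N1 * real N2)"
proof -
  interpret block_code W "pair_pmf (pmf_of_set {..<N1}) (pmf_of_set {..<N2})" F n by fact
  have ne: "{..<N1} \<noteq> {}" "{..<N2} \<noteq> {}" using N by auto
  have "measure code_law {z. snd z \<in> B (fst z)} = (\<Sum>m\<in>{..<N1} \<times> {..<N2}.
      pmf (pair_pmf (pmf_of_set {..<N1}) (pmf_of_set {..<N2})) m * measure (channel_out W (F m)) (B m))"
    unfolding code_law_def
    by (subst measure_bind_pmf_finite[where A = "{..<N1} \<times> {..<N2}"]) (use ne in \<open>auto simp: vimage_def\<close>)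
  also have "\<dots> = (\<Sum>m\<in>{..<N1} \<times> {..<N2}. measure (channel_out W (F m)) (B m) / (real N1 * real N2))"
    by (intro sum.cong refl) (auto simp: pmf_pair pmf_of_set_lessThan[OF N(1)] pmf_of_set_lessThan[OF N(2)])
  finally show ?thesis
    by (simp add: sum.cartesian_product sum_divide_distrib case_prod_unfold)
qed

lemma entropy_pair_uniform:
  assumes "N1 > 0" "N2 > 0"
  shows "entropy (pair_pmf (pmf_of_set {..<N1}) (pmf_of_set {..<N2})) = log 2 (real N1) + log 2 (real N2)"
proof -
  have ne: "{..<N1} \<noteq> {}" "{..<N2} \<noteq> {}" "{..<N1} \<times> {..<N2} \<noteq> {}" using assms by auto
  have "pair_pmf (pmf_of_set {..<N1}) (pmf_of_set {..<N2}) = pmf_of_set ({..<N1} \<times> {..<N2})"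
  proof (rule pmf_eqI)
    fix z :: "nat \<times> nat"
    show "pmf (pair_pmf (pmf_of_set {..<N1}) (pmf_of_set {..<N2})) z = pmf (pmf_of_set ({..<N1} \<times> {..<N2})) z"
      using ne(3) by (cases z) (simp add: pmf_pair pmf_of_set_lessThan assms indicator_def card_cartesian_product)
  qed
  then show ?thesis
    using assms ne by (simp add: entropy_pmf_of_set card_cartesian_product log_mult)
qed

text \<open>The slack collects at most one Fano term for each message, 1 + \<epsilon> log N1 and 1 +
  \<epsilon> log N2, divided by the block length.\<close>

lemma converse_code:
  fixes W :: "'x::finite \<Rightarrow> 'y::finite list pmf"
  assumes K3: "K \<ge> 3" and finW: "\<And>x. finite (set_pmf (W x))"
    and cls: "((\<forall>j\<in>{1..K-2}. more_capable W j (K - 1)) \<and> more_capable W (K - 1) K)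
            \<or> (\<forall>i\<in>{1..K-1}. less_noisy W i K)"
    and n: "n > 0" and N: "N1 > 0" "N2 > 0"
    and len: "\<And>m1 m2. m1 < N1 \<Longrightarrow> m2 < N2 \<Longrightarrow> length (f m1 m2) = n"
    and err: "avg_err W K N1 N2 f g \<le> \<epsilon>"
  shows "\<exists>p. within_slack W K p ((2 + \<epsilon> * (log 2 N1 + log 2 N2)) / n) (log 2 N1 / n) (log 2 N2 / n)"
proof -
  define src where "src = pair_pmf (pmf_of_set {..<N1}) (pmf_of_set {..<N2})"
  define F where "F = (\<lambda>(m1, m2). f m1 m2)"
  have ne: "{..<N1} \<noteq> {}" "{..<N2} \<noteq> {}" using N by auto
  have set_src: "set_pmf src = {..<N1} \<times> {..<N2}" using ne by (simp add: src_def)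
  interpret block_code W src F n
    by unfold_locales (use finW set_src len in \<open>auto simp: F_def\<close>)
  define L1 L2 where "L1 = log 2 N1" and "L2 = log 2 N2"
  have L: "L1 \<ge> 0" "L2 \<ge> 0" using N by (auto simp: L1_def L2_def)
  define B where "B m = {ys. \<exists>j\<in>{1..K}. (j \<noteq> K \<and> fst (g j (recv j ys)) \<noteq> fst m) \<or>
      (j \<noteq> K - 1 \<and> snd (g j (recv j ys)) \<noteq> snd m)}" for m
  have "measure code_law {z. snd z \<in> B (fst z)} = avg_err W K N1 N2 f g"
    using measure_code_law[of W N1 N2 F n B] block_code_axioms N
    by (simp add: src_def avg_err_def B_def F_def)
  then have eB: "measure code_law {z. snd z \<in> B (fst z)} \<le> \<epsilon>" using err by simp
  then have \<epsilon>0: "\<epsilon> \<ge> 0" using measure_nonneg order_trans by blast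
  have e1: "measure code_law {z. (\<lambda>v. fst (g j v)) (recv j (snd z)) \<noteq> fst (fst z)} \<le> \<epsilon>" if "j \<in> {1..K-1}" for j
    by (rule order_trans[OF measure_pmf.finite_measure_mono eB]) (use that in \<open>auto simp: B_def\<close>)
  have e2: "measure code_law {z. (\<lambda>v. snd (g K v)) (recv K (snd z)) \<noteq> snd (fst z)} \<le> \<epsilon>"
  proof (rule order_trans[OF measure_pmf.finite_measure_mono eB])
    have KK: "K \<in> {1..K}" "K \<noteq> K - 1" using K3 by auto
    show "{z. (\<lambda>v. snd (g K v)) (recv K (snd z)) \<noteq> snd (fst z)} \<subseteq> {z. snd z \<in> B (fst z)}"
      unfolding B_def by (intro subsetI CollectI bexI[OF _ KK(1)] disjI2 conjI KK(2)) simp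
  qed simp
  have src12: "fst m \<in> {..<N1}" "snd m \<in> {..<N2}" if "m \<in> set_pmf src" for m
    using that unfolding set_src by (simp_all add: mem_Times_iff)
  let ?id = "\<lambda>m::nat \<times> nat. (fst m, snd m)" and ?y = "K - 1"
  have y: "?y \<ge> 1" "K \<ge> 1" "?y \<in> {1..K-1}" using K3 by auto
  \<comment> \<open>Fano is used four times: for M1 at receiver \<open>j\<close> given M2
    (\<open>F1\<close>), M2 at receiver K (\<open>F2\<close>), M1 at receiver K-1
    (\<open>Fa\<close>) and M2 at receiver K given M1 (\<open>Fb\<close>). \<open>F1\<close> and
    \<open>F2\<close> bound the sum rate with M2 as the first message, \<open>Fa\<close> and
    \<open>Fb\<close> with M1 as the first.\<close>
  have F1: "view_entropy ?id (past_lab j n) - view_entropy snd (past_lab j n) \<le> 1 + \<epsilon> * L1" if "j \<in> {1..K-1}" for j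
    unfolding L1_def
  proof (rule view_entropy_fano[where e = "\<lambda>v. fst (g j v)" and A = "{..<N1}" and a = fst and b = snd])
    show "measure code_law {z. fst (g j (recv j (snd z))) \<noteq> fst (fst z)} \<le> \<epsilon>" by (rule e1[OF that])
    show "j \<ge> 1" using that by simp
  qed (simp_all only: src12 finite_lessThan card_lessThan)
  have F2: "view_entropy snd (past_lab K n) - view_entropy (\<lambda>_. ()) (past_lab K n) \<le> 1 + \<epsilon> * L2"
  proof -
    have "view_entropy (\<lambda>m. (snd m, ())) (past_lab K n) - view_entropy (\<lambda>_. ()) (past_lab K n) \<le> 1 + \<epsilon> * L2"
      unfolding L2_def
    proof (rule view_entropy_fano[where e = "\<lambda>v. snd (g K v)" and A = "{..<N2}" and a = snd and b = "\<lambda>_. ()"])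
      show "measure code_law {z. snd (g K (recv K (snd z))) \<noteq> snd (fst z)} \<le> \<epsilon>" by (rule e2)
    qed (simp_all only: src12 y finite_lessThan card_lessThan)
    then show ?thesis using view_entropy_relabel[of "\<lambda>x. (x, ())" snd] by (simp add: inj_on_def)
  qed
  have Fa: "view_entropy fst (past_lab ?y n) - view_entropy (\<lambda>_. ()) (past_lab ?y n) \<le> 1 + \<epsilon> * L1"
  proof -
    have "view_entropy (\<lambda>m. (fst m, ())) (past_lab ?y n) - view_entropy (\<lambda>_. ()) (past_lab ?y n) \<le> 1 + \<epsilon> * L1"
      unfolding L1_def
    proof (rule view_entropy_fano[where e = "\<lambda>v. fst (g ?y v)" and A = "{..<N1}" and a = fst and b = "\<lambda>_. ()"])
      show "measure code_law {z. fst (g ?y (recv ?y (snd z))) \<noteq> fst (fst z)} \<le> \<epsilon>" by (rule e1[OF y(3)])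
    qed (simp_all only: src12 y finite_lessThan card_lessThan)
    then show ?thesis using view_entropy_relabel[of "\<lambda>x. (x, ())" fst] by (simp add: inj_on_def)
  qed
  have Fb: "view_entropy ?id (past_lab K n) - view_entropy fst (past_lab K n) \<le> 1 + \<epsilon> * L2"
  proof -
    have "view_entropy (\<lambda>m. (snd m, fst m)) (past_lab K n) - view_entropy fst (past_lab K n) \<le> 1 + \<epsilon> * L2"
      unfolding L2_def
    proof (rule view_entropy_fano[where e = "\<lambda>v. snd (g K v)" and A = "{..<N2}" and a = snd and b = fst])
      show "measure code_law {z. snd (g K (recv K (snd z))) \<noteq> snd (fst z)} \<le> \<epsilon>" by (rule e2)
    qed (simp_all only: src12 y finite_lessThan card_lessThan)
    then show ?thesis using view_entropy_relabel[of prod.swap ?id "past_lab K n"] by (simp add: prod.swap_def)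
  qed
  have h0: "view_entropy snd (\<lambda>_. 0) = L2" "view_entropy ?id (\<lambda>_. 0) = L1 + L2"
  proof -
    have "entropy (map_pmf snd src) = L2" "entropy src = L1 + L2"
      using entropy_pmf_of_set[of "{..<N2}"] ne entropy_pair_uniform[OF N]
      by (simp_all add: src_def map_snd_pair_pmf L1_def L2_def)
    then show "view_entropy snd (\<lambda>_. 0) = L2" "view_entropy ?id (\<lambda>_. 0) = L1 + L2" by (simp_all add: view_entropy_0)
  qed
  define SG where "SG j = (\<Sum>i<n. out_ent (out_kernel W j) (pmf (input_law i)))" for j
  define SC where "SC j = (\<Sum>i<n. noise_ent (out_kernel W j) (pmf (input_law i)))" for j
  have hG: "view_entropy (\<lambda>_. ()) (past_lab j n) \<le> SG j" if "j \<ge> 1" for j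
    unfolding SG_def by (rule view_entropy_const_le[OF that])
  \<comment> \<open>H(Y_j^n | M1, M2) is at least the sum of the letterwise entropies given the
    input letters, so L1 + L2 = H(M1, M2) is at most H(M1, M2, Y_j^n) minus that sum.\<close>
  have hC: "L1 + L2 \<le> view_entropy ?id (past_lab j n) - SC j" if "j \<ge> 1" for j
    using noise_ent_le_view_entropy[OF that, of ?id] h0(2) by (simp add: SC_def)
  define e where "e = 2 + \<epsilon> * (L1 + L2)"
  have e_ge: "1 + \<epsilon> * L2 \<le> e" "(1 + \<epsilon> * L1) + (1 + \<epsilon> * L2) = e"
    using \<epsilon>0 L by (auto simp: e_def algebra_simps)
  have div: "(x::real) / n \<le> z / n" if "x \<le> z" for x z using that n by (simp add: divide_right_mono)
  from cls show ?thesis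
  proof
    assume A: "(\<forall>j\<in>{1..K-2}. more_capable W j ?y) \<and> more_capable W ?y K"
    define \<Theta> where "\<Theta> i = view_input snd (mixed_lab ?y K i) i" for i
    define SH where "SH j = (\<Sum>i<n. cond_ent (out_kernel W j) (\<Theta> i))" for j
    have fin\<Theta>: "finite (set_pmf (\<Theta> i))" and snd_\<Theta>: "map_pmf snd (\<Theta> i) = input_law i" for i
      unfolding \<Theta>_def by (rule fin_view_input, rule snd_view_input)
    obtain p :: "(nat \<times> 'x) pmf" where p: "finite (set_pmf p)"
      "\<forall>k :: 'x \<Rightarrow> 'y pmf. cond_ent k p = (\<Sum>i<n. cond_ent k (\<Theta> i)) / n \<and>
        noise_ent k (pmf (map_pmf snd p)) = (\<Sum>i<n. noise_ent k (pmf (map_pmf snd (\<Theta> i)))) / n \<and>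
        out_ent k (pmf (map_pmf snd p)) \<ge> (\<Sum>i<n. out_ent k (pmf (map_pmf snd (\<Theta> i)))) / n"
      using time_sharing[of n \<Theta>, OF n fin\<Theta>] by blast
    have pH: "cond_ent (out_kernel W j) p = SH j / n" and pC: "noise_ent (out_kernel W j) (pmf (map_pmf snd p)) = SC j / n"
      and pG: "out_ent (out_kernel W j) (pmf (map_pmf snd p)) \<ge> SG j / n" for j
      unfolding SH_def SC_def SG_def
      using p(2)[rule_format, of "out_kernel W j"] unfolding snd_\<Theta> by simp_all
    \<comment> \<open>The backward expansion conditions on M2 and the future of receiver K; adding
      the past of receiver K-1 completes this to U_i and can only lower the conditional
      entropy.\<close>
    have "L2 = view_entropy snd (past_lab K n) - (\<Sum>i<n. cond_ent (out_kernel W K) (view_input snd (future_lab K (Suc i)) i))"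
      using view_entropy_suffix[OF y(2), of snd] h0 by simp
    also have "\<dots> \<le> view_entropy snd (past_lab K n) - SH K"
      unfolding SH_def \<Theta>_def
      by (intro diff_left_mono sum_mono cond_ent_view_input_mono[where t = "\<lambda>x. x"]) (auto simp: future_lab_def mixed_lab_def)
    finally have c1: "L2 \<le> SG K - SH K + e" using F2 hG[OF y(2)] e_ge by linarith
    have ex: "view_entropy snd (past_lab ?y n) - view_entropy snd (past_lab K n) = SH ?y - SH K"
      using view_entropy_exchange[OF y(1,2), of snd] by (simp add: SH_def \<Theta>_def sum_subtractf)
    have c2: "L2 + L1 \<le> SH ?y - SC ?y + (SG K - SH K) + e"
      using hC[OF y(1)] F1[OF y(3)] ex F2 hG[OF y(2)] e_ge by linarith
    \<comment> \<open>The exchange conditioned on M1. At each time the more capable ordering gives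
      I(X_i;Y_{K,i}|view) <= I(X_i;Y_{K-1,i}|view), so the output of receiver K can be traded for
      that of K-1, where \<open>Fa\<close> applies.\<close>
    have "(\<Sum>i<n. cond_ent (out_kernel W K) (view_input fst (mixed_lab ?y K i) i) - cond_ent (out_kernel W ?y) (view_input fst (mixed_lab ?y K i) i))
      \<le> (\<Sum>i<n. noise_ent (out_kernel W K) (pmf (input_law i)) - noise_ent (out_kernel W ?y) (pmf (input_law i)))"
    proof (rule sum_mono)
      fix i
      show "cond_ent (out_kernel W K) (view_input fst (mixed_lab ?y K i) i) - cond_ent (out_kernel W ?y) (view_input fst (mixed_lab ?y K i) i)
        \<le> noise_ent (out_kernel W K) (pmf (input_law i)) - noise_ent (out_kernel W ?y) (pmf (input_law i))"
        using cond_ent_more_capable[OF A[THEN conjunct2] fin_view_input, of fst "mixed_lab ?y K i" i] unfolding snd_view_input by linarith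
    qed
    then have "view_entropy fst (past_lab K n) - view_entropy fst (past_lab ?y n) \<le> SC K - SC ?y"
      using view_entropy_exchange[OF y(1,2), of fst] by (simp add: SC_def sum_subtractf)
    then have c3: "L2 + L1 \<le> SG ?y - SC ?y + e"
      using hC[OF y(2)] Fb Fa hG[OF y(1)] e_ge by linarith
    have r1: "L2 / n \<le> I_UY W p K + e / n"
      using div[OF c1] pG[of K] unfolding I_UY_eq[OF p(1)] pH by (simp add: add_divide_distrib diff_divide_distrib)
    have r2: "(L2 + L1) / n \<le> I_XY_given_U W p ?y + I_UY W p K + e / n"
      using div[OF c2] pG[of K] unfolding I_UY_eq[OF p(1)] I_XY_given_U_eq[OF p(1)] pH pC
      by (simp add: add_divide_distrib diff_divide_distrib)
    have r3: "(L2 + L1) / n \<le> I_XY W (map_pmf snd p) ?y + e / n"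
      using div[OF c3] pG[of ?y] unfolding I_XY_eq pC by (simp add: add_divide_distrib diff_divide_distrib)
    \<comment> \<open>For j < K-1 the bound carries over from K-1, because the more capable ordering
      also holds conditionally on U.\<close>
    have r2': "(L2 + L1) / n \<le> I_XY_given_U W p j + I_UY W p K + e / n" if j: "j \<in> {1..K-1}" for j
    proof (cases "j = ?y")
      case False
      then have "more_capable W j ?y" using A j by auto
      from cond_ent_more_capable[OF this p(1)] show ?thesis
        using r2 unfolding I_XY_given_U_eq[OF p(1)] by linarith
    qed (use r2 in simp)
    show ?thesis
      using p(1) r1 r2' r3 unfolding within_slack_def L1_def[symmetric] L2_def[symmetric] e_def[symmetric]
      by (intro exI[of _ p]) (auto simp: add_divide_distrib)
  next
    assume B: "\<forall>i\<in>{1..K-1}. less_noisy W i K"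
    define \<Theta> where "\<Theta> i = view_input snd (past_lab K i) i" for i
    define SH where "SH j = (\<Sum>i<n. cond_ent (out_kernel W j) (\<Theta> i))" for j
    have fin\<Theta>: "finite (set_pmf (\<Theta> i))" and snd_\<Theta>: "map_pmf snd (\<Theta> i) = input_law i" for i
      unfolding \<Theta>_def by (rule fin_view_input, rule snd_view_input)
    obtain p :: "(nat \<times> 'x) pmf" where p: "finite (set_pmf p)"
      "\<forall>k :: 'x \<Rightarrow> 'y pmf. cond_ent k p = (\<Sum>i<n. cond_ent k (\<Theta> i)) / n \<and>
        noise_ent k (pmf (map_pmf snd p)) = (\<Sum>i<n. noise_ent k (pmf (map_pmf snd (\<Theta> i)))) / n \<and>
        out_ent k (pmf (map_pmf snd p)) \<ge> (\<Sum>i<n. out_ent k (pmf (map_pmf snd (\<Theta> i)))) / n"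
      using time_sharing[of n \<Theta>, OF n fin\<Theta>] by blast
    have pH: "cond_ent (out_kernel W j) p = SH j / n" and pC: "noise_ent (out_kernel W j) (pmf (map_pmf snd p)) = SC j / n"
      and pG: "out_ent (out_kernel W j) (pmf (map_pmf snd p)) \<ge> SG j / n" for j
      unfolding SH_def SC_def SG_def
      using p(2)[rule_format, of "out_kernel W j"] unfolding snd_\<Theta> by simp_all
    have hs: "L2 = view_entropy snd (past_lab K n) - SH K"
      using view_entropy_prefix[OF y(2), of snd] h0 by (simp add: SH_def \<Theta>_def)
    then have c1: "L2 \<le> SG K - SH K + e" using F2 hG[OF y(2)] e_ge by linarith
    have c2: "L2 + L1 \<le> SH j - SC j + (SG K - SH K) + e" if j: "j \<in> {1..K-1}" for j
    proof -
      have j1: "j \<ge> 1" using j by simp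
      have D: "superadditive (\<lambda>a. out_ent (out_kernel W j) a - out_ent (out_kernel W K) a)" using less_noisy_superadditive B j by blast
      have "(\<Sum>i<n. cond_ent (out_kernel W j) (view_input snd (past_lab j i) i)) \<le> SH j"
        unfolding SH_def \<Theta>_def by (intro sum_mono past_less_noisy[OF D j1 y(2)]) simp
      then have "view_entropy snd (past_lab j n) - L2 \<le> SH j" using view_entropy_prefix[OF j1, of snd] h0 by simp
      then show ?thesis using hC[OF j1] F1[OF j] F2 hG[OF y(2)] e_ge hs by linarith
    qed
    have r1: "L2 / n \<le> I_UY W p K + e / n"
      using div[OF c1] pG[of K] unfolding I_UY_eq[OF p(1)] pH by (simp add: add_divide_distrib diff_divide_distrib)
    have r2: "(L2 + L1) / n \<le> I_XY_given_U W p j + I_UY W p K + e / n" if "j \<in> {1..K-1}" for j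
      using div[OF c2[OF that]] pG[of K] unfolding I_UY_eq[OF p(1)] I_XY_given_U_eq[OF p(1)] pH pC
      by (simp add: add_divide_distrib diff_divide_distrib)
    have "I_UY W p K \<le> I_UY W p ?y" using B y(3) p(1) unfolding less_noisy_def by blast
    then have r3: "(L2 + L1) / n \<le> I_XY W (map_pmf snd p) ?y + e / n"
      using r2[OF y(3)] chain_rule[OF p(1), of W ?y] by linarith
    show ?thesis
      using p(1) r1 r2 r3 unfolding within_slack_def L1_def[symmetric] L2_def[symmetric] e_def[symmetric]
      by (intro exI[of _ p]) (auto simp: add_divide_distrib)
  qed
qed

lemma within_slack_mono:
  assumes "within_slack W K p d a b" "b' + d \<le> b + d'" "b' + a' + d \<le> b + a + d'"
  shows "within_slack W K p d' a' b'"
  using assms unfolding within_slack_def by force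

lemma msg_size_bounds:
  assumes "R \<ge> 0"
  shows "msg_size n R > 0" "real n * R \<le> log 2 (msg_size n R)" "log 2 (msg_size n R) \<le> real n * R + 1"
proof -
  define x where "x = 2 powr (real n * R)"
  have x: "x \<ge> 1" using assms by (simp add: x_def ge_one_powr_ge_zero)
  have m: "real (msg_size n R) = of_int \<lceil>x\<rceil>" unfolding msg_size_def x_def[symmetric] using x by simp
  have le: "x \<le> real (msg_size n R)" "real (msg_size n R) \<le> 2 * x" unfolding m using x by linarith+
  show pos: "msg_size n R > 0" using le x by (cases "msg_size n R") auto
  have lx: "log 2 x = real n * R" by (simp add: x_def)
  show "real n * R \<le> log 2 (msg_size n R)" unfolding lx[symmetric] using le x by (subst log_le_cancel_iff) auto
  have "log 2 (msg_size n R) \<le> log 2 (2 * x)" using le x pos by (subst log_le_cancel_iff) auto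
  also have "\<dots> = real n * R + 1" using x lx by (simp add: log_mult)
  finally show "log 2 (msg_size n R) \<le> real n * R + 1" .
qed

lemma achievable_slack:
  fixes W :: "'x::finite \<Rightarrow> 'y::finite list pmf"
  assumes K3: "K \<ge> 3" and finW: "\<And>x. finite (set_pmf (W x))"
    and cls: "((\<forall>j\<in>{1..K-2}. more_capable W j (K - 1)) \<and> more_capable W (K - 1) K)
            \<or> (\<forall>i\<in>{1..K-1}. less_noisy W i K)"
    and ach: "achievable W K (a, b)" and d: "d > 0"
  shows "\<exists>p. within_slack W K p d a b"
proof -
  have ab: "a \<ge> 0" "b \<ge> 0" using ach by (auto simp: achievable_def)
  \<comment> \<open>As L1 + L2 <= n (a + b) + 2 <= n (a + b + 2), the slack proportional to
    \<epsilon> is at most d/2; n >= 4/d makes the remaining 2/n at most d/2.\<close>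
  define \<epsilon> where "\<epsilon> = d / (2 * (a + b + 2))"
  have "\<epsilon> > 0" using d ab by (simp add: \<epsilon>_def)
  then have "\<exists>N. \<forall>n\<ge>N. \<exists>f g.
      (\<forall>m1<msg_size n a. \<forall>m2<msg_size n b. length (f m1 m2) = n) \<and>
      avg_err W K (msg_size n a) (msg_size n b) f g \<le> \<epsilon>"
    using ach unfolding achievable_def fst_conv snd_conv by blast
  then obtain N where N: "\<And>n. n \<ge> N \<Longrightarrow> \<exists>f g.
      (\<forall>m1<msg_size n a. \<forall>m2<msg_size n b. length (f m1 m2) = n) \<and>
      avg_err W K (msg_size n a) (msg_size n b) f g \<le> \<epsilon>" by blast
  define n where "n = max N (nat \<lceil>4 / d\<rceil>)"
  have "real n \<ge> 4 / d" unfolding n_def by linarith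
  moreover have "4 / d > 0" using d by simp
  ultimately have rn: "real n > 0" "4 / d \<le> real n" by linarith+
  then have n: "n > 0" by simp
  have n2: "2 / real n \<le> d / 2" using rn d by (simp add: field_simps)
  obtain f g where fg: "\<forall>m1<msg_size n a. \<forall>m2<msg_size n b. length (f m1 m2) = n"
      "avg_err W K (msg_size n a) (msg_size n b) f g \<le> \<epsilon>"
    using N[of n] by (auto simp: n_def)
  define L1 L2 where "L1 = log 2 (msg_size n a)" and "L2 = log 2 (msg_size n b)"
  note ms = msg_size_bounds[OF ab(1), of n, folded L1_def] msg_size_bounds[OF ab(2), of n, folded L2_def]
  obtain p where p: "within_slack W K p ((2 + \<epsilon> * (L1 + L2)) / n) (L1 / n) (L2 / n)"
    unfolding L1_def L2_def
    using converse_code[OF K3 finW cls n ms(1,4) _ fg(2)] fg(1) by blast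
  have "a \<le> L1 / n" "b \<le> L2 / n" using ms n by (auto simp: field_simps)
  moreover have "(2 + \<epsilon> * (L1 + L2)) / n \<le> d"
  proof -
    have "L1 + L2 \<le> real n * (a + b + 2)"
      using ms n by (simp add: algebra_simps)
    then have "\<epsilon> * (L1 + L2) \<le> \<epsilon> * (real n * (a + b + 2))"
      using \<open>\<epsilon> > 0\<close> by (intro mult_left_mono) auto
    also have "\<dots> = real n * (d / 2)" using ab by (simp add: \<epsilon>_def field_simps)
    finally have "\<epsilon> * (L1 + L2) / n \<le> d / 2" using n by (simp add: field_simps)
    then show ?thesis using n2 unfolding add_divide_distrib by linarith
  qed
  ultimately show ?thesis
    by (intro exI[of _ p] within_slack_mono[OF p]) auto
qed

lemma capacity_region_subset:
  fixes W :: "'x::finite \<Rightarrow> 'y::finite list pmf"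
  assumes K3: "K \<ge> 3" and finW: "\<And>x. finite (set_pmf (W x))"
    and cls: "((\<forall>j\<in>{1..K-2}. more_capable W j (K - 1)) \<and> more_capable W (K - 1) K)
            \<or> (\<forall>i\<in>{1..K-1}. less_noisy W i K)"
    and R: "(a, b) \<in> capacity_region W K"
  shows "a \<ge> 0 \<and> b \<ge> 0 \<and> (\<exists>p. within_slack W K p 0 a b)"
proof -
  have near: "\<exists>a' b'. achievable W K (a', b') \<and> \<bar>a' - a\<bar> < e \<and> \<bar>b' - b\<bar> < e" if "e > 0" for e
  proof -
    have "\<exists>R'\<in>{R. achievable W K R}. dist R' (a, b) < e"
      using R that unfolding capacity_region_def closure_approachable by blast
    then obtain R' where R': "achievable W K R'" "dist R' (a, b) < e" by blast
    have "dist (fst R') a < e" "dist (snd R') b < e"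
      using dist_fst_le[of R' "(a,b)"] dist_snd_le[of R' "(a,b)"] R'(2) by auto
    then show ?thesis using R'(1) by (intro exI[of _ "fst R'"] exI[of _ "snd R'"]) (auto simp: dist_real_def)
  qed
  have "- e < a \<and> - e < b" if "e > 0" for e
    using near[OF that] unfolding achievable_def by force
  from this[of "- a"] this[of "- b"] have "a \<ge> 0 \<and> b \<ge> 0" by force
  moreover have "\<exists>p. within_slack W K p 0 a b"
  proof (rule within_slack_closed)
    fix d :: real assume d: "d > 0"
    \<comment> \<open>An error of d/4 in each coordinate costs at most d/2 in the sum rate and
      leaves d/2 for the slack of the achievable pair.\<close>
    obtain a' b' where a': "achievable W K (a', b')" "\<bar>a' - a\<bar> < d / 4" "\<bar>b' - b\<bar> < d / 4"
      using near[of "d / 4"] d by auto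
    have "d / 2 > 0" using d by simp
    then obtain p where p: "within_slack W K p (d / 2) a' b'"
      using achievable_slack[OF K3 finW cls a'(1)] by blast
    have "b + d / 2 \<le> b' + d" "b + a + d / 2 \<le> b' + a' + d" using a'(2,3) by linarith+
    then show "\<exists>p. within_slack W K p d a b" using within_slack_mono[OF p] by blast
  qed
  ultimately show ?thesis by blast
qed

subsection \<open>One-shot superposition coding\<close>

lemma measure_bind_le:
  fixes f :: "'a \<Rightarrow> 'b pmf"
  assumes "\<And>x. x \<in> set_pmf p \<Longrightarrow> measure_pmf.prob (f x) S \<le> c"
  shows "measure_pmf.prob (bind_pmf p f) S \<le> c"
proof -
  obtain x where "x \<in> set_pmf p" using set_pmf_not_empty[of p] by blast
  then have c: "c \<ge> 0" using assms[of x] measure_nonneg order_trans by blast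
  have "emeasure (bind_pmf p f) S = (\<integral>\<^sup>+x. emeasure (f x) S \<partial>measure_pmf p)" by simp
  also have "\<dots> \<le> (\<integral>\<^sup>+x. ennreal c \<partial>measure_pmf p)"
    by (intro nn_integral_mono_AE) (auto simp: AE_measure_pmf_iff measure_pmf.emeasure_eq_measure assms intro!: ennreal_leI)
  also have "\<dots> = ennreal c" by simp
  finally show ?thesis using c by (simp add: measure_pmf.emeasure_eq_measure)
qed

lemma Pi_pmf_pair_component:
  assumes "finite A" "a \<in> A" "b \<in> A" "a \<noteq> b"
  shows "map_pmf (\<lambda>f. (f a, f b)) (Pi_pmf A d p) = pair_pmf (p a) (p b)"
proof -
  have A: "A = insert a (A - {a})" using assms by auto
  have "map_pmf (\<lambda>f. (f a, f b)) (Pi_pmf A d p) =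
    map_pmf (\<lambda>f. (f a, f b)) (map_pmf (\<lambda>(y, f). f(a := y)) (pair_pmf (p a) (Pi_pmf (A - {a}) d p)))"
    using assms by (subst A, subst Pi_pmf_insert) auto
  also have "\<dots> = map_pmf (\<lambda>(y, f). (id y, f b)) (pair_pmf (p a) (Pi_pmf (A - {a}) d p))"
    using assms by (simp add: map_pmf_comp case_prod_unfold)
  also have "\<dots> = pair_pmf (p a) (map_pmf (\<lambda>f. f b) (Pi_pmf (A - {a}) d p))"
    unfolding map_pair by simp
  also have "\<dots> = pair_pmf (p a) (p b)"
    using assms by (subst Pi_pmf_component) auto
  finally show ?thesis .
qed

text \<open>Markov's inequality for the likelihood ratio: the wrong codeword \<open>a\<close> looks \<open>\<gamma>\<close> times more
  likely than average with probability at most \<open>1 / \<gamma>\<close>.\<close>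

lemma false_accept:
  fixes A :: "'a pmf" and V :: "'a \<Rightarrow> 'b pmf"
  assumes fin: "finite (set_pmf A)" and \<gamma>: "\<gamma> > 0"
  shows "measure_pmf.prob A {a. pmf (V a) y > \<gamma> * pmf (A \<bind> V) y} \<le> 1 / \<gamma>"
proof -
  let ?P = "pmf (A \<bind> V) y"
  have P: "?P = (\<Sum>a\<in>set_pmf A. pmf A a * pmf (V a) y)" by (rule pmf_bind_finite[OF fin order_refl])
  have m: "measure_pmf.prob A {a. pmf (V a) y > \<gamma> * ?P} = (\<Sum>a\<in>set_pmf A. pmf A a * indicator {a. pmf (V a) y > \<gamma> * ?P} a)"
    using measure_bind_pmf_finite[OF fin order_refl, of return_pmf] by (simp add: bind_return_pmf')
  show ?thesis
  proof (cases "?P = 0")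
    case True
    then have "\<forall>a\<in>set_pmf A. pmf A a * pmf (V a) y = 0"
      unfolding P by (subst (asm) sum_nonneg_eq_0_iff[OF fin]) auto
    then have "\<forall>a\<in>set_pmf A. pmf (V a) y = 0" by (auto simp: set_pmf_iff)
    then have "measure_pmf.prob A {a. pmf (V a) y > \<gamma> * ?P} = 0"
      by (subst m, intro sum.neutral) (auto simp: True)
    then show ?thesis using \<gamma> by simp
  next
    case False
    then have P0: "?P > 0" by simp
    have "measure_pmf.prob A {a. pmf (V a) y > \<gamma> * ?P} \<le> (\<Sum>a\<in>set_pmf A. pmf A a * (pmf (V a) y / (\<gamma> * ?P)))"
      unfolding m using \<gamma> P0 by (intro sum_mono mult_left_mono) (auto simp: indicator_def)
    also have "\<dots> = (\<Sum>a\<in>set_pmf A. pmf A a * pmf (V a) y) / (\<gamma> * ?P)"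
      by (simp add: sum_divide_distrib)
    also have "\<dots> = 1 / \<gamma>" unfolding P[symmetric] using P0 by simp
    finally show ?thesis .
  qed
qed

text \<open>The competing codeword is independent of the output, so it may be drawn last; a bound
  that holds for every fixed output then carries over.\<close>

lemma measure_indep_le:
  fixes B :: "'b pmf" and T :: "'a \<Rightarrow> 'c pmf"
  assumes "\<And>z. measure_pmf.prob B {b. P b z} \<le> c"
  shows "measure_pmf.prob (pair_pmf A B \<bind> (\<lambda>(a, b). map_pmf (\<lambda>z. (b, z)) (T a))) {(b, z). P b z} \<le> c"
proof -
  have "pair_pmf A B \<bind> (\<lambda>(a, b). map_pmf (\<lambda>z. (b, z)) (T a)) =
      A \<bind> (\<lambda>a. T a \<bind> (\<lambda>z. map_pmf (\<lambda>b. (b, z)) B))"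
    unfolding pair_pmf_def map_pmf_def
    by (simp add: bind_assoc_pmf bind_return_pmf) (subst bind_commute_pmf, rule refl)
  moreover have "measure_pmf.prob (A \<bind> (\<lambda>a. T a \<bind> (\<lambda>z. map_pmf (\<lambda>b. (b, z)) B))) {(b, z). P b z} \<le> c"
    using assms by (intro measure_bind_le) (simp add: vimage_def)
  ultimately show ?thesis by simp
qed

text \<open>\<open>Q\<close> draws a cloud centre, \<open>k\<close> its satellites, \<open>V\<close>
  is the channel and \<open>r j\<close> extracts what receiver \<open>j\<close> sees;
  \<open>w\<close> is the receiver that decodes only the cloud. There are \<open>L\<close> clouds of
  \<open>M\<close> satellites, and \<open>g0\<close>, \<open>g1\<close>, \<open>g2\<close> are
  thresholds of likelihood ratio tests. The alphabets are arbitrary, so that whole blocks can be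
  inserted as single letters.\<close>

locale superposition =
  fixes Q :: "'u pmf" and k :: "'u \<Rightarrow> 'x pmf" and V :: "'x \<Rightarrow> 'o pmf"
    and r :: "nat \<Rightarrow> 'o \<Rightarrow> 'w" and w :: nat and g0 :: real and g1 g2 :: "nat \<Rightarrow> real" and L M :: nat
  assumes finQ: "finite (set_pmf Q)" and fink: "\<And>u. finite (set_pmf (k u))"
    and g_pos: "g0 > 0" "\<And>j. g1 j > 0" "\<And>j. g2 j > 0"
begin

definition Vr :: "nat \<Rightarrow> 'x \<Rightarrow> 'w pmf" where
  "Vr j x = map_pmf (r j) (V x)"

definition t0 :: "'u \<Rightarrow> 'w \<Rightarrow> bool" where
  "t0 u y \<longleftrightarrow> pmf (k u \<bind> Vr w) y > g0 * pmf (Q \<bind> k \<bind> Vr w) y"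

text \<open>The ratio p(y|x)/p(y|u) separates the satellites of one cloud. Codewords of a wrong
  cloud are rejected by \<open>t2\<close>, whose ratio p(y|x)/p(y) does not involve the
  centre.\<close>

definition t1 :: "nat \<Rightarrow> 'u \<Rightarrow> 'x \<Rightarrow> 'w \<Rightarrow> bool" where
  "t1 j u x y \<longleftrightarrow> pmf (Vr j x) y > g1 j * pmf (k u \<bind> Vr j) y"

definition t2 :: "nat \<Rightarrow> 'x \<Rightarrow> 'w \<Rightarrow> bool" where
  "t2 j x y \<longleftrightarrow> pmf (Vr j x) y > g2 j * pmf (Q \<bind> k \<bind> Vr j) y"

definition joint :: "('u \<times> 'x \<times> 'o) pmf" where
  "joint = Q \<bind> (\<lambda>u. k u \<bind> (\<lambda>x. map_pmf (\<lambda>z. (u, x, z)) (V x)))"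

definition cloud_law :: "('u \<times> (nat \<Rightarrow> 'x)) pmf" where
  "cloud_law = Q \<bind> (\<lambda>u. map_pmf (Pair u) (Pi_pmf {..<M} undefined (\<lambda>_. k u)))"

definition codebook_law :: "(nat \<Rightarrow> 'u \<times> (nat \<Rightarrow> 'x)) pmf" where
  "codebook_law = Pi_pmf {..<L} undefined (\<lambda>_. cloud_law)"

text \<open>Random codebook and channel output in one law, so that an error probability averaged
  over codebooks is a single probability.\<close>

definition sent :: "nat \<Rightarrow> nat \<Rightarrow> ((nat \<Rightarrow> 'u \<times> (nat \<Rightarrow> 'x)) \<times> 'o) pmf" where
  "sent l s = codebook_law \<bind> (\<lambda>cb. map_pmf (Pair cb) (V (snd (cb l) s)))"

lemma finite_Pi: "finite A \<Longrightarrow> (\<And>i. finite (set_pmf (p i))) \<Longrightarrow> finite (set_pmf (Pi_pmf A d p))"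
  by (rule finite_subset[OF set_Pi_pmf_subset']) auto

lemma fin_codebook_law: "finite (set_pmf codebook_law)"
  unfolding codebook_law_def cloud_law_def using finQ fink by (intro finite_Pi) (auto intro!: finite_Pi)

lemma cloud_law_component:
  assumes "s < M"
  shows "cloud_law \<bind> (\<lambda>c. T (fst c) (snd c s)) = Q \<bind> (\<lambda>u. k u \<bind> T u)"
proof -
  have "cloud_law \<bind> (\<lambda>c. T (fst c) (snd c s)) =
      Q \<bind> (\<lambda>u. map_pmf (\<lambda>f. f s) (Pi_pmf {..<M} undefined (\<lambda>_. k u)) \<bind> T u)"
    unfolding cloud_law_def by (simp add: bind_assoc_pmf bind_map_pmf)
  then show ?thesis using assms by (simp add: Pi_pmf_component)
qed

lemma codebook_law_component:
  assumes "l < L"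
  shows "codebook_law \<bind> (\<lambda>cb. T (cb l)) = cloud_law \<bind> T"
proof -
  have "codebook_law \<bind> (\<lambda>cb. T (cb l)) = map_pmf (\<lambda>cb. cb l) codebook_law \<bind> T" by (simp add: bind_map_pmf)
  then show ?thesis using assms by (simp add: codebook_law_def Pi_pmf_component)
qed

lemma map_sent:
  "map_pmf (\<lambda>(cb, z). h cb z) (sent l s) = codebook_law \<bind> (\<lambda>cb. map_pmf (h cb) (V (snd (cb l) s)))"
  unfolding sent_def by (simp add: map_bind_pmf map_pmf_comp)

lemma miss_law:
  assumes "l < L" "s < M"
  shows "map_pmf (\<lambda>(cb, z). (fst (cb l), snd (cb l) s, z)) (sent l s) = joint"
  unfolding map_sent joint_def
  using codebook_law_component[OF assms(1), of "\<lambda>c. map_pmf (\<lambda>z. (fst c, snd c s, z)) (V (snd c s))"]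
    cloud_law_component[OF assms(2), of "\<lambda>u x. map_pmf (\<lambda>z. (u, x, z)) (V x)"] by simp

text \<open>Satellites of one cloud are independent given the centre \<open>u\<close>; hence, given
  \<open>u\<close>, the wrong satellite is independent of the output.\<close>

lemma same_cloud_law:
  assumes l: "l < L" and s: "s < M" "s' < M" "s \<noteq> s'"
  shows "map_pmf (\<lambda>(cb, z). (fst (cb l), snd (cb l) s', z)) (sent l s) =
    Q \<bind> (\<lambda>u. map_pmf (Pair u) (pair_pmf (k u) (k u) \<bind> (\<lambda>(x, x'). map_pmf (\<lambda>z. (x', z)) (V x))))"
proof -
  have "map_pmf (\<lambda>(cb, z). (fst (cb l), snd (cb l) s', z)) (sent l s) =
      cloud_law \<bind> (\<lambda>c. map_pmf (\<lambda>z. (fst c, snd c s', z)) (V (snd c s)))"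
    unfolding map_sent using codebook_law_component[OF l, of "\<lambda>c. map_pmf (\<lambda>z. (fst c, snd c s', z)) (V (snd c s))"] by simp
  also have "\<dots> = Q \<bind> (\<lambda>u. map_pmf (\<lambda>f. (f s, f s')) (Pi_pmf {..<M} undefined (\<lambda>_. k u)) \<bind>
      (\<lambda>(x, x'). map_pmf (\<lambda>z. (u, x', z)) (V x)))"
    unfolding cloud_law_def by (simp add: bind_assoc_pmf bind_map_pmf)
  also have "\<dots> = Q \<bind> (\<lambda>u. pair_pmf (k u) (k u) \<bind> (\<lambda>(x, x'). map_pmf (\<lambda>z. (u, x', z)) (V x)))"
    using s by (simp add: Pi_pmf_pair_component)
  also have "\<dots> = Q \<bind> (\<lambda>u. map_pmf (Pair u) (pair_pmf (k u) (k u) \<bind> (\<lambda>(x, x'). map_pmf (\<lambda>z. (x', z)) (V x))))"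
    by (simp add: map_bind_pmf case_prod_unfold map_pmf_comp)
  finally show ?thesis .
qed

lemma other_cloud_law:
  assumes "l < L" "l' < L" "l \<noteq> l'"
  shows "map_pmf (\<lambda>(cb, z). (cb l', z)) (sent l s) =
    pair_pmf cloud_law cloud_law \<bind> (\<lambda>(c, c'). map_pmf (\<lambda>z. (c', z)) (V (snd c s)))"
proof -
  have "map_pmf (\<lambda>(cb, z). (cb l', z)) (sent l s) =
      map_pmf (\<lambda>cb. (cb l, cb l')) codebook_law \<bind> (\<lambda>(c, c'). map_pmf (\<lambda>z. (c', z)) (V (snd c s)))"
    unfolding map_sent by (simp add: bind_map_pmf)
  then show ?thesis using assms by (simp add: codebook_law_def Pi_pmf_pair_component)
qed

lemma finQk: "finite (set_pmf (Q \<bind> k))"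
  using finQ fink by auto

lemma miss_prob:
  assumes "l < L" "s < M"
  shows "measure_pmf.prob (sent l s) {(cb, z). P (fst (cb l)) (snd (cb l) s) z} = measure_pmf.prob joint {(u, x, z). P u x z}"
  unfolding miss_law[OF assms, symmetric] by (simp add: vimage_def case_prod_unfold)

lemma same_cloud_prob:
  assumes "l < L" "s < M" "s' < M" "s \<noteq> s'"
  shows "measure_pmf.prob (sent l s) {(cb, z). t1 j (fst (cb l)) (snd (cb l) s') (r j z)} \<le> 1 / g1 j"
proof -
  have "measure_pmf.prob (sent l s) {(cb, z). t1 j (fst (cb l)) (snd (cb l) s') (r j z)} =
    measure_pmf.prob (map_pmf (\<lambda>(cb, z). (fst (cb l), snd (cb l) s', z)) (sent l s)) {(u, x', z). t1 j u x' (r j z)}"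
    by (simp add: vimage_def case_prod_unfold)
  also have "\<dots> \<le> 1 / g1 j"
    unfolding same_cloud_law[OF assms]
  proof (rule measure_bind_le)
    fix u
    have "measure_pmf.prob (pair_pmf (k u) (k u) \<bind> (\<lambda>(x, x'). map_pmf (\<lambda>z. (x', z)) (V x))) {(x', z). t1 j u x' (r j z)} \<le> 1 / g1 j"
      unfolding t1_def by (intro measure_indep_le false_accept fink g_pos)
    then show "measure_pmf.prob (map_pmf (Pair u) (pair_pmf (k u) (k u) \<bind> (\<lambda>(x, x'). map_pmf (\<lambda>z. (x', z)) (V x))))
        {(u, x', z). t1 j u x' (r j z)} \<le> 1 / g1 j"
      by (simp add: vimage_def case_prod_unfold)
  qed
  finally show ?thesis .
qed

lemma other_cloud_prob:
  assumes "l < L" "l' < L" "l \<noteq> l'" "s' < M"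
  shows "measure_pmf.prob (sent l s) {(cb, z). t2 j (snd (cb l') s') (r j z)} \<le> 1 / g2 j"
    and "measure_pmf.prob (sent l s) {(cb, z). t0 (fst (cb l')) (r w z)} \<le> 1 / g0"
proof -
  have gen: "measure_pmf.prob (sent l s) {(cb, z). P (cb l') z} \<le> c" if "\<And>z. measure_pmf.prob cloud_law {c'. P c' z} \<le> c" for P c
  proof -
    have "measure_pmf.prob (sent l s) {(cb, z). P (cb l') z} =
        measure_pmf.prob (map_pmf (\<lambda>(cb, z). (cb l', z)) (sent l s)) {(c', z). P c' z}"
      by (simp add: vimage_def case_prod_unfold)
    then show ?thesis unfolding other_cloud_law[OF assms(1-3)] using measure_indep_le[of cloud_law P, OF that] by simp
  qed
  have "map_pmf (\<lambda>c. snd c s') cloud_law = Q \<bind> k"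
    using cloud_law_component[OF assms(4), of "\<lambda>u. return_pmf"] by (simp add: map_pmf_def bind_return_pmf')
  then have "measure_pmf.prob cloud_law {c. P (snd c s')} = measure_pmf.prob (Q \<bind> k) {x. P x}" for P
    by (metis measure_map_pmf vimage_Collect_eq)
  from this[of "\<lambda>x. t2 j x _"]
  show "measure_pmf.prob (sent l s) {(cb, z). t2 j (snd (cb l') s') (r j z)} \<le> 1 / g2 j"
    by (intro gen) (simp add: t2_def false_accept[OF finQk g_pos(3)])
  have "map_pmf fst cloud_law = Q"
    unfolding cloud_law_def by (simp add: map_bind_pmf map_pmf_comp bind_return_pmf')
  then have "measure_pmf.prob cloud_law {c. P (fst c)} = measure_pmf.prob Q {u. P u}" for P
    by (metis measure_map_pmf vimage_Collect_eq)
  from this[of "\<lambda>u. t0 u _"]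
  show "measure_pmf.prob (sent l s) {(cb, z). t0 (fst (cb l')) (r w z)} \<le> 1 / g0"
    using false_accept[OF finQ g_pos(1), of "\<lambda>u. k u \<bind> Vr w"]
    by (intro gen) (simp add: t0_def bind_assoc_pmf)
qed

definition pass :: "(nat \<Rightarrow> 'u \<times> (nat \<Rightarrow> 'x)) \<Rightarrow> nat \<Rightarrow> 'w \<Rightarrow> nat \<times> nat \<Rightarrow> bool" where
  "pass cb j y = (\<lambda>(l, s). l < L \<and> s < M \<and> t1 j (fst (cb l)) (snd (cb l) s) y \<and> t2 j (snd (cb l) s) y)"

definition wpass :: "(nat \<Rightarrow> 'u \<times> (nat \<Rightarrow> 'x)) \<Rightarrow> 'w \<Rightarrow> nat \<Rightarrow> bool" where
  "wpass cb y l \<longleftrightarrow> l < L \<and> t0 (fst (cb l)) y"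

text \<open>\<open>SOME\<close> is the decoder: it is right whenever the true index passes the tests
  and no other index does.\<close>

definition Err :: "nat set \<Rightarrow> (nat \<Rightarrow> 'u \<times> (nat \<Rightarrow> 'x)) \<Rightarrow> nat \<times> nat \<Rightarrow> 'o set" where
  "Err J cb = (\<lambda>(l, s). {z. (\<exists>j\<in>J. (SOME i. pass cb j (r j z) i) \<noteq> (l, s)) \<or> (SOME i. wpass cb (r w z) i) \<noteq> l})"

text \<open>The union bound: a rejection of the true codeword for each test, then the number of
  wrong candidates divided by the threshold. Because \<open>M - 1\<close> and \<open>L - 1\<close>
  are exact, these terms vanish for a single satellite or a single cloud, which settles rate 0
  without a positive exponent.\<close>

definition bound :: "nat set \<Rightarrow> real" where
  "bound J = (\<Sum>j\<in>J. measure_pmf.prob joint {(u, x, z). \<not> t1 j u x (r j z)} + measure_pmf.prob joint {(u, x, z). \<not> t2 j x (r j z)} +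
      (real M - 1) / g1 j + (real L - 1) * real M / g2 j) +
    measure_pmf.prob joint {(u, x, z). \<not> t0 u (r w z)} + (real L - 1) / g0"

lemma Err_bound:
  assumes J: "finite J" and ls: "l < L" "s < M"
  shows "measure_pmf.prob (sent l s) {(cb, z). z \<in> Err J cb (l, s)} \<le> bound J"
proof -
  let ?m = "measure_pmf.prob (sent l s)"
  define E1 where "E1 j = {(cb, z). \<not> t1 j (fst (cb l)) (snd (cb l) s) (r j z)}" for j
  define E2 where "E2 j = {(cb :: nat \<Rightarrow> 'u \<times> (nat \<Rightarrow> 'x), z). \<not> t2 j (snd (cb l) s) (r j z)}" for j
  define E3 where "E3 j = (\<Union>s'\<in>{..<M} - {s}. {(cb, z). t1 j (fst (cb l)) (snd (cb l) s') (r j z)})" for j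
  define E4 where "E4 j = (\<Union>i\<in>({..<L} - {l}) \<times> {..<M}.
    {(cb :: nat \<Rightarrow> 'u \<times> (nat \<Rightarrow> 'x), z). t2 j (snd (cb (fst i)) (snd i)) (r j z)})" for j
  define E5 where "E5 = {(cb :: nat \<Rightarrow> 'u \<times> (nat \<Rightarrow> 'x), z). \<not> t0 (fst (cb l)) (r w z)}"
  define E6 where "E6 = (\<Union>l'\<in>{..<L} - {l}. {(cb :: nat \<Rightarrow> 'u \<times> (nat \<Rightarrow> 'x), z). t0 (fst (cb l')) (r w z)})"
  have strong: "(SOME i. pass cb j (r j z) i) = (l, s)" if "(cb, z) \<notin> E1 j \<union> E2 j \<union> E3 j \<union> E4 j" for cb j z
  proof (rule some_equality)
    show "pass cb j (r j z) (l, s)" using that ls by (auto simp: pass_def E1_def E2_def)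
    fix i assume i: "pass cb j (r j z) i"
    show "i = (l, s)"
    proof (rule ccontr)
      assume ne: "i \<noteq> (l, s)"
      obtain l' s' where i': "i = (l', s')" by fastforce
      show False
      proof (cases "l' = l")
        case True
        then show False using that i ne unfolding i' pass_def E3_def by auto
      next
        case False
        then show False using that i unfolding i' pass_def E4_def by force
      qed
    qed
  qed
  have weak: "(SOME i. wpass cb (r w z) i) = l" if "(cb, z) \<notin> E5 \<union> E6" for cb z
  proof (rule some_equality)
    show "wpass cb (r w z) l" using that ls by (auto simp: wpass_def E5_def)
    fix i assume i: "wpass cb (r w z) i"
    show "i = l" using that i unfolding wpass_def E6_def by force
  qed
  have "{(cb, z). z \<in> Err J cb (l, s)} \<subseteq> (\<Union>j\<in>J. E1 j \<union> E2 j \<union> E3 j \<union> E4 j) \<union> (E5 \<union> E6)"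
    using strong weak unfolding Err_def by fast
  then have "?m {(cb, z). z \<in> Err J cb (l, s)} \<le> ?m ((\<Union>j\<in>J. E1 j \<union> E2 j \<union> E3 j \<union> E4 j) \<union> (E5 \<union> E6))"
    by (intro measure_pmf.finite_measure_mono) auto
  also have "\<dots> \<le> ?m (\<Union>j\<in>J. E1 j \<union> E2 j \<union> E3 j \<union> E4 j) + (?m E5 + ?m E6)"
    by (intro order_trans[OF measure_Un_le] add_left_mono measure_Un_le) auto
  also have "\<dots> \<le> (\<Sum>j\<in>J. ?m (E1 j) + ?m (E2 j) + ?m (E3 j) + ?m (E4 j)) + (?m E5 + ?m E6)"
  proof (intro add_right_mono)
    have "?m (\<Union>j\<in>J. E1 j \<union> E2 j \<union> E3 j \<union> E4 j) \<le> (\<Sum>j\<in>J. ?m (E1 j \<union> E2 j \<union> E3 j \<union> E4 j))"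
      using J by (intro measure_pmf.finite_measure_subadditive_finite) auto
    also have "\<dots> \<le> (\<Sum>j\<in>J. ?m (E1 j) + ?m (E2 j) + ?m (E3 j) + ?m (E4 j))"
      by (intro sum_mono order_trans[OF measure_Un_le] add_right_mono) auto
    finally show "?m (\<Union>j\<in>J. E1 j \<union> E2 j \<union> E3 j \<union> E4 j) \<le> (\<Sum>j\<in>J. ?m (E1 j) + ?m (E2 j) + ?m (E3 j) + ?m (E4 j))" .
  qed
  also have "\<dots> \<le> bound J"
  proof -
    have "?m (E1 j) = measure_pmf.prob joint {(u, x, z). \<not> t1 j u x (r j z)}" for j
      unfolding E1_def by (rule miss_prob[OF ls])
    moreover have "?m (E2 j) = measure_pmf.prob joint {(u, x, z). \<not> t2 j x (r j z)}" for j
      unfolding E2_def by (rule miss_prob[OF ls])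
    moreover have "?m E5 = measure_pmf.prob joint {(u, x, z). \<not> t0 u (r w z)}"
      unfolding E5_def by (rule miss_prob[OF ls])
    moreover have "?m (E3 j) \<le> (real M - 1) / g1 j" for j
    proof -
      have "?m (E3 j) \<le> (\<Sum>s'\<in>{..<M} - {s}. ?m {(cb, z). t1 j (fst (cb l)) (snd (cb l) s') (r j z)})"
        unfolding E3_def by (intro measure_pmf.finite_measure_subadditive_finite) auto
      also have "\<dots> \<le> (\<Sum>s'\<in>{..<M} - {s}. 1 / g1 j)"
        using ls by (intro sum_mono same_cloud_prob) auto
      also have "\<dots> = (real M - 1) / g1 j" using ls by (simp add: of_nat_diff)
      finally show ?thesis .
    qed
    moreover have "?m (E4 j) \<le> (real L - 1) * real M / g2 j" for j
    proof -
      have "?m (E4 j) \<le> (\<Sum>i\<in>({..<L} - {l}) \<times> {..<M}. ?m {(cb, z). t2 j (snd (cb (fst i)) (snd i)) (r j z)})"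
        unfolding E4_def by (intro measure_pmf.finite_measure_subadditive_finite) auto
      also have "\<dots> \<le> (\<Sum>i\<in>({..<L} - {l}) \<times> {..<M}. 1 / g2 j)"
        using ls by (intro sum_mono other_cloud_prob(1)) auto
      also have "\<dots> = (real L - 1) * real M / g2 j" using ls by (simp add: of_nat_diff card_cartesian_product)
      finally show ?thesis .
    qed
    moreover have "?m E6 \<le> (real L - 1) / g0"
    proof -
      have "?m E6 \<le> (\<Sum>l'\<in>{..<L} - {l}. ?m {(cb, z). t0 (fst (cb l')) (r w z)})"
        unfolding E6_def by (intro measure_pmf.finite_measure_subadditive_finite) auto
      also have "\<dots> \<le> (\<Sum>l'\<in>{..<L} - {l}. 1 / g0)"
        using ls by (intro sum_mono other_cloud_prob(2)) auto
      also have "\<dots> = (real L - 1) / g0" using ls by (simp add: of_nat_diff)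
      finally show ?thesis .
    qed
    ultimately show ?thesis unfolding bound_def by (simp add: add_mono sum_mono)
  qed
  finally show ?thesis .
qed

text \<open>Some codebook is no worse than the average one. The error event is joint over the
  receivers and the sum runs over all messages, so a single codebook serves them all. Membership in
  the support of \<open>Q \<bind> k\<close> is recorded since it later forces the codewords to have
  length n.\<close>

lemma ex_codebook:
  assumes J: "finite J" and Ms: "finite Ms" and e: "\<And>m. m \<in> Ms \<Longrightarrow> fst (e m) < L \<and> snd (e m) < M"
  shows "\<exists>X ds dw. (\<forall>l<L. \<forall>s<M. X l s \<in> set_pmf (Q \<bind> k)) \<and>
    (\<Sum>m\<in>Ms. measure_pmf.prob (V (X (fst (e m)) (snd (e m))))
      {z. (\<exists>j\<in>J. ds j (r j z) \<noteq> e m) \<or> dw (r w z) \<noteq> fst (e m)}) \<le> real (card Ms) * bound J"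
proof -
  define err where "err cb = (\<Sum>m\<in>Ms. measure_pmf.prob (V (snd (cb (fst (e m))) (snd (e m)))) (Err J cb (e m)))" for cb
  have "(\<Sum>cb\<in>set_pmf codebook_law. pmf codebook_law cb * err cb) =
      (\<Sum>m\<in>Ms. \<Sum>cb\<in>set_pmf codebook_law. pmf codebook_law cb * measure_pmf.prob (V (snd (cb (fst (e m))) (snd (e m)))) (Err J cb (e m)))"
    unfolding err_def sum_distrib_left by (rule sum.swap)
  also have "\<dots> \<le> (\<Sum>m\<in>Ms. bound J)"
  proof (rule sum_mono)
    fix m assume m: "m \<in> Ms"
    have "measure_pmf.prob (sent (fst (e m)) (snd (e m))) {(cb, z). z \<in> Err J cb (fst (e m), snd (e m))} \<le> bound J"
      using e[OF m] by (intro Err_bound[OF J]) auto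
    then show "(\<Sum>cb\<in>set_pmf codebook_law. pmf codebook_law cb * measure_pmf.prob (V (snd (cb (fst (e m))) (snd (e m)))) (Err J cb (e m))) \<le> bound J"
      unfolding sent_def by (subst (asm) measure_bind_pmf_finite[OF fin_codebook_law order_refl]) (simp add: vimage_def)
  qed
  finally have avg: "(\<Sum>cb\<in>set_pmf codebook_law. pmf codebook_law cb * err cb) \<le> real (card Ms) * bound J" by simp
  have "\<exists>cb\<in>set_pmf codebook_law. err cb \<le> real (card Ms) * bound J"
  proof (rule ccontr)
    assume "\<not> ?thesis"
    then have "(\<Sum>cb\<in>set_pmf codebook_law. pmf codebook_law cb * (real (card Ms) * bound J)) < (\<Sum>cb\<in>set_pmf codebook_law. pmf codebook_law cb * err cb)"
      using fin_codebook_law set_pmf_not_empty by (intro sum_strict_mono mult_strict_left_mono) (auto simp: pmf_positive)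
    moreover have "(\<Sum>cb\<in>set_pmf codebook_law. pmf codebook_law cb * (real (card Ms) * bound J)) = real (card Ms) * bound J"
      using fin_codebook_law by (simp add: sum_distrib_right[symmetric] sum_pmf_eq_1)
    ultimately show False using avg by simp
  qed
  then obtain cb where cb: "cb \<in> set_pmf codebook_law" "err cb \<le> real (card Ms) * bound J" by blast
  have "snd (cb l) s \<in> set_pmf (Q \<bind> k)" if "l < L" "s < M" for l s
  proof -
    have "cb l \<in> set_pmf cloud_law"
      using cb(1) that(1) set_Pi_pmf_subset'[of "{..<L}" undefined "\<lambda>_. cloud_law"]
      unfolding codebook_law_def PiE_dflt_def by auto
    then obtain u f where "u \<in> set_pmf Q" "f \<in> set_pmf (Pi_pmf {..<M} undefined (\<lambda>_. k u))" "cb l = (u, f)"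
      unfolding cloud_law_def by auto
    then show ?thesis
      using that(2) set_Pi_pmf_subset'[of "{..<M}" undefined "\<lambda>_. k u"] unfolding PiE_dflt_def by auto
  qed
  moreover have "err cb = (\<Sum>m\<in>Ms. measure_pmf.prob (V (snd (cb (fst (e m))) (snd (e m))))
      {z. (\<exists>j\<in>J. (\<lambda>j y. SOME i. pass cb j y i) j (r j z) \<noteq> e m) \<or> (\<lambda>y. SOME i. wpass cb y i) (r w z) \<noteq> fst (e m)})"
    unfolding err_def Err_def by (simp add: case_prod_unfold)
  ultimately show ?thesis using cb(2)
    by (intro exI[of _ "\<lambda>l s. snd (cb l) s"] exI[of _ "\<lambda>j y. SOME i. pass cb j y i"] exI[of _ "\<lambda>y. SOME i. wpass cb y i"])
       simp
qed

end

subsection \<open>Memoryless extension and achievability\<close>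

lemma finite_replicate_pmf: "finite (set_pmf D) \<Longrightarrow> finite (set_pmf (replicate_pmf n D))"
  by (induction n) auto

text \<open>Splitting off one letter, the cross term vanishes because the mean is zero, so second
  moments add.\<close>

lemma replicate_moments:
  fixes \<psi> :: "'a \<Rightarrow> real"
  assumes fin: "finite (set_pmf D)" and zero: "measure_pmf.expectation D \<psi> = 0"
  shows "measure_pmf.expectation (replicate_pmf n D) (\<lambda>zs. sum_list (map \<psi> zs)) = 0"
    and "measure_pmf.expectation (replicate_pmf n D) (\<lambda>zs. (sum_list (map \<psi> zs))\<^sup>2) =
      real n * measure_pmf.expectation D (\<lambda>z. (\<psi> z)\<^sup>2)"
proof (induction n)
  case (Suc n)
  let ?R = "replicate_pmf n D" and ?S = "\<lambda>zs. sum_list (map \<psi> zs)"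
  have int: "integrable (measure_pmf ?R) h" for h :: "'a list \<Rightarrow> real"
    by (rule integrable_measure_pmf_finite) (rule finite_replicate_pmf[OF fin])
  have step: "measure_pmf.expectation (replicate_pmf (Suc n) D) h =
      measure_pmf.expectation D (\<lambda>z. measure_pmf.expectation ?R (\<lambda>zs. h (z # zs)))" for h :: "'a list \<Rightarrow> real"
  proof -
    have "replicate_pmf (Suc n) D = D \<bind> (\<lambda>z. map_pmf ((#) z) ?R)" by (simp add: map_pmf_def)
    then have "measure_pmf.expectation (replicate_pmf (Suc n) D) h =
        (\<Sum>z\<in>set_pmf D. pmf D z *\<^sub>R measure_pmf.expectation (map_pmf ((#) z) ?R) h)"
      using fin finite_replicate_pmf[OF fin] by (simp only:) (rule pmf_expectation_bind, auto)
    then show ?thesis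
      by (simp add: integral_measure_pmf_real[OF fin] mult.commute)
  qed
  {
    case 1
    show ?case unfolding step using Suc.IH(1) zero int
      by (simp add: integrable_measure_pmf_finite[OF fin])
  next
    case 2
    have "measure_pmf.expectation ?R (\<lambda>zs. (\<psi> z + ?S zs)\<^sup>2) = (\<psi> z)\<^sup>2 + real n * measure_pmf.expectation D (\<lambda>z. (\<psi> z)\<^sup>2)" for z
      using Suc.IH int by (simp add: power2_sum)
    then show ?case unfolding step
      by (simp add: integrable_measure_pmf_finite[OF fin] algebra_simps)
  }
qed simp_all

text \<open>Chebyshev's inequality. The lower tail is the relevant one, since a true codeword is
  rejected when its likelihood ratio is too small.\<close>

lemma weak_law:
  fixes \<phi> :: "'a \<Rightarrow> real"
  assumes fin: "finite (set_pmf D)" and \<mu>: "measure_pmf.expectation D \<phi> = \<mu>" and \<delta>: "\<delta> > 0"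
  shows "(\<lambda>n. measure (replicate_pmf n D) {zs. sum_list (map \<phi> zs) \<le> real n * (\<mu> - \<delta>)}) \<longlonglongrightarrow> 0"
proof -
  define \<psi> where "\<psi> z = \<phi> z - \<mu>" for z
  define v where "v = measure_pmf.expectation D (\<lambda>z. (\<psi> z)\<^sup>2)"
  have zero: "measure_pmf.expectation D \<psi> = 0"
    unfolding \<psi>_def using \<mu> by (simp add: integrable_measure_pmf_finite[OF fin])
  have le: "measure (replicate_pmf n D) {zs. sum_list (map \<phi> zs) \<le> real n * (\<mu> - \<delta>)} \<le> v / \<delta>\<^sup>2 / real n"
    if n: "n > 0" for n
  proof -
    let ?R = "replicate_pmf n D"
    have int: "integrable (measure_pmf ?R) h" for h :: "'a list \<Rightarrow> real"
      by (rule integrable_measure_pmf_finite) (rule finite_replicate_pmf[OF fin])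
    let ?E = "{zs. sum_list (map \<phi> zs) \<le> real n * (\<mu> - \<delta>)}"
    have "measure ?R ?E = measure_pmf.expectation ?R (indicator ?E)" by simp
    also have "\<dots> \<le> measure_pmf.expectation ?R (\<lambda>zs. (sum_list (map \<psi> zs))\<^sup>2 / (real n * \<delta>)\<^sup>2)"
    proof (intro integral_mono_AE int)
      have "indicator ?E zs \<le> (sum_list (map \<psi> zs))\<^sup>2 / (real n * \<delta>)\<^sup>2" if "length zs = n" for zs
      proof (cases "zs \<in> ?E")
        case True
        have "sum_list (map \<psi> zs) = sum_list (map \<phi> zs) - real (length zs) * \<mu>" for zs
          by (induction zs) (auto simp: \<psi>_def algebra_simps)
        from this[of zs] have "real n * \<delta> \<le> - sum_list (map \<psi> zs)" using True that by (simp add: algebra_simps)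
        moreover have "real n * \<delta> > 0" using n \<delta> by simp
        ultimately have "(real n * \<delta>)\<^sup>2 \<le> (- sum_list (map \<psi> zs))\<^sup>2" by (intro power_mono) auto
        then show ?thesis using True n \<delta> by simp
      qed simp
      then show "AE zs in measure_pmf ?R. indicator ?E zs \<le> (sum_list (map \<psi> zs))\<^sup>2 / (real n * \<delta>)\<^sup>2"
        by (simp add: AE_measure_pmf_iff set_replicate_pmf)
    qed
    also have "\<dots> = real n * v / (real n * \<delta>)\<^sup>2"
      using replicate_moments(2)[OF fin zero, of n] by (simp add: v_def)
    also have "\<dots> = v / \<delta>\<^sup>2 / real n" using n by (simp add: power2_eq_square field_simps)
    finally show ?thesis .
  qed
  show ?thesis
  proof (rule tendsto_sandwich[OF _ _ tendsto_const lim_const_over_n])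
    show "\<forall>\<^sub>F n in sequentially. measure (replicate_pmf n D) {zs. sum_list (map \<phi> zs) \<le> real n * (\<mu> - \<delta>)} \<le> v / \<delta>\<^sup>2 / real n"
      using le by (intro eventually_sequentiallyI[of 1]) simp
  qed simp
qed

text \<open>On the support of \<open>D\<close> the quotient of the two products is 2 to the power of
  the summed log ratios, so the test fails only in the lower tail of that sum.\<close>

lemma likelihood_ratio_typical:
  fixes A B :: "'a \<Rightarrow> real"
  assumes fin: "finite (set_pmf D)" and pos: "\<And>z. z \<in> set_pmf D \<Longrightarrow> A z > 0 \<and> B z > 0"
    and I: "measure_pmf.expectation D (\<lambda>z. log 2 (A z / B z)) = I" and \<delta>: "\<delta> > 0"
  shows "(\<lambda>n. measure (replicate_pmf n D)
    {zs. \<not> prod_list (map A zs) > 2 powr (real n * (I - \<delta>)) * prod_list (map B zs)}) \<longlonglongrightarrow> 0"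
proof (rule tendsto_sandwich[OF _ _ tendsto_const weak_law[OF fin I \<delta>]])
  let ?\<phi> = "\<lambda>z. log 2 (A z / B z)"
  have "measure (replicate_pmf n D) {zs. \<not> prod_list (map A zs) > 2 powr (real n * (I - \<delta>)) * prod_list (map B zs)} \<le>
      measure (replicate_pmf n D) {zs. sum_list (map ?\<phi> zs) \<le> real n * (I - \<delta>)}" for n
  proof (rule measure_pmf.finite_measure_mono_AE)
    have pr: "prod_list (map A zs) = 2 powr (sum_list (map ?\<phi> zs)) * prod_list (map B zs) \<and> prod_list (map B zs) > 0"
      if "set zs \<subseteq> set_pmf D" for zs
      using that
    proof (induction zs)
      case (Cons z zs)
      then have "A z > 0" "B z > 0" using pos[of z] by auto
      then show ?case using Cons by (simp add: powr_add)
    qed simp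
    have "sum_list (map ?\<phi> zs) \<le> real n * (I - \<delta>)"
      if "set zs \<subseteq> set_pmf D" "\<not> prod_list (map A zs) > 2 powr (real n * (I - \<delta>)) * prod_list (map B zs)" for zs
    proof -
      have "2 powr (sum_list (map ?\<phi> zs)) \<le> 2 powr (real n * (I - \<delta>))"
        using that(2) pr[OF that(1)] by (simp add: mult_le_cancel_right not_less)
      then show ?thesis by simp
    qed
    then show "AE zs in measure_pmf (replicate_pmf n D).
        zs \<in> {zs. \<not> prod_list (map A zs) > 2 powr (real n * (I - \<delta>)) * prod_list (map B zs)} \<longrightarrow>
        zs \<in> {zs. sum_list (map ?\<phi> zs) \<le> real n * (I - \<delta>)}"
      by (auto simp: AE_measure_pmf_iff set_replicate_pmf lists_eq_set)
  qed simp
  then show "\<forall>\<^sub>F n in sequentially. measure (replicate_pmf n D)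
      {zs. \<not> prod_list (map A zs) > 2 powr (real n * (I - \<delta>)) * prod_list (map B zs)} \<le>
      measure (replicate_pmf n D) {zs. sum_list (map ?\<phi> zs) \<le> real n * (I - \<delta>)}" by simp
qed simp

text \<open>\<open>channel_out\<close> for an arbitrary kernel: the satellite kernel, the channel
  and the channels to single receivers all obtain their n-letter versions in this way.\<close>

fun memoryless :: "('a \<Rightarrow> 'b pmf) \<Rightarrow> 'a list \<Rightarrow> 'b list pmf" where
  "memoryless \<kappa> [] = return_pmf []"
| "memoryless \<kappa> (a # as) = \<kappa> a \<bind> (\<lambda>b. map_pmf ((#) b) (memoryless \<kappa> as))"

lemma channel_out_memoryless: "channel_out W = memoryless W"
proof
  fix xs show "channel_out W xs = memoryless W xs" by (induction xs) (simp_all add: map_pmf_def)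
qed

lemma finite_memoryless: "(\<And>a. finite (set_pmf (\<kappa> a))) \<Longrightarrow> finite (set_pmf (memoryless \<kappa> as))"
  by (induction as) auto

lemma memoryless_bind: "memoryless \<kappa> as \<bind> memoryless \<kappa>' = memoryless (\<lambda>a. \<kappa> a \<bind> \<kappa>') as"
proof (induction as)
  case (Cons a as)
  have "memoryless \<kappa> (a # as) \<bind> memoryless \<kappa>' =
      \<kappa> a \<bind> (\<lambda>b. memoryless \<kappa> as \<bind> (\<lambda>bs. \<kappa>' b \<bind> (\<lambda>c. map_pmf ((#) c) (memoryless \<kappa>' bs))))"
    by (simp add: bind_assoc_pmf bind_map_pmf)
  also have "\<dots> = \<kappa> a \<bind> (\<lambda>b. \<kappa>' b \<bind> (\<lambda>c. memoryless \<kappa> as \<bind> (\<lambda>bs. map_pmf ((#) c) (memoryless \<kappa>' bs))))"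
    by (subst bind_commute_pmf) (rule refl)
  also have "\<dots> = memoryless (\<lambda>a. \<kappa> a \<bind> \<kappa>') (a # as)"
    by (simp add: bind_assoc_pmf map_bind_pmf[symmetric] Cons)
  finally show ?case .
qed (simp add: bind_return_pmf)

lemma memoryless_map: "map_pmf (map g) (memoryless \<kappa> as) = memoryless (\<lambda>a. map_pmf g (\<kappa> a)) as"
proof (induction as)
  case (Cons a as)
  have "map_pmf (map g) (memoryless \<kappa> (a # as)) = \<kappa> a \<bind> (\<lambda>b. map_pmf ((#) (g b)) (map_pmf (map g) (memoryless \<kappa> as)))"
    by (simp add: map_bind_pmf map_pmf_comp)
  then show ?case by (simp add: Cons bind_map_pmf)
qed simp

lemma replicate_memoryless: "replicate_pmf n q = memoryless (\<lambda>_. q) (replicate n ())"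
  by (induction n) (simp_all add: map_pmf_def)

lemma replicate_bind_memoryless: "replicate_pmf n q \<bind> memoryless k = replicate_pmf n (q \<bind> k)"
  unfolding replicate_memoryless memoryless_bind ..

lemma pmf_bind_Cons:
  "pmf (p \<bind> (\<lambda>b. map_pmf ((#) b) P)) (c # cs) = pmf p c * pmf P cs"
proof -
  have "p \<bind> (\<lambda>b. map_pmf ((#) b) P) = map_pmf (\<lambda>(b, bs). b # bs) (pair_pmf p P)"
    by (simp add: pair_pmf_def map_bind_pmf map_pmf_def bind_assoc_pmf bind_return_pmf)
  moreover have "inj (\<lambda>(b, bs). b # bs)" by (auto simp: inj_on_def)
  ultimately show ?thesis using pmf_map_inj'[of "\<lambda>(b, bs). b # bs" "pair_pmf p P" "(c, cs)"] by (simp add: pmf_pair)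
qed

text \<open>Inputs and outputs are written as images of one list \<open>zs\<close>, because the
  n-letter joint law is an i.i.d. list of triples from which the components are read off.\<close>

lemma pmf_memoryless: "pmf (memoryless \<kappa> (map f zs)) (map g zs) = prod_list (map (\<lambda>z. pmf (\<kappa> (f z)) (g z)) zs)"
  by (induction zs) (simp_all add: pmf_bind_Cons)

lemma pmf_replicate: "length zs = n \<Longrightarrow> pmf (replicate_pmf n q) (map g zs) = prod_list (map (\<lambda>z. pmf q (g z)) zs)"
proof -
  assume "length zs = n"
  then have "replicate n () = map (\<lambda>_. ()) zs" by (simp add: map_replicate_const)
  then show ?thesis unfolding replicate_memoryless by (simp add: pmf_memoryless)
qed

definition joint3 :: "('u \<Rightarrow> 'x pmf) \<Rightarrow> ('x \<Rightarrow> 'o pmf) \<Rightarrow> 'u pmf \<Rightarrow> ('u \<times> 'x \<times> 'o) pmf" where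
  "joint3 k V q = q \<bind> (\<lambda>u. k u \<bind> (\<lambda>x. map_pmf (\<lambda>z. (u, x, z)) (V x)))"

text \<open>Commuting independent draws brings together the three draws that belong to the first
  letter; the remaining draws form the joint law of the shorter block.\<close>

lemma joint3_replicate:
  "joint3 (memoryless k) (memoryless V) (replicate_pmf n q) =
    map_pmf (\<lambda>zs. (map fst zs, map (\<lambda>z. fst (snd z)) zs, map (\<lambda>z. snd (snd z)) zs)) (replicate_pmf n (joint3 k V q))"
proof (induction n)
  case 0
  then show ?case by (simp add: joint3_def bind_return_pmf)
next
  case (Suc n)
  let ?c = "\<lambda>u x z (us, xs, zs). (u # us, x # xs, z # zs)"
  have "joint3 (memoryless k) (memoryless V) (replicate_pmf (Suc n) q) =
     q \<bind> (\<lambda>u. replicate_pmf n q \<bind> (\<lambda>us. k u \<bind> (\<lambda>x. memoryless k us \<bind> (\<lambda>xs. V x \<bind> (\<lambda>z.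
       memoryless V xs \<bind> (\<lambda>zs. return_pmf (?c u x z (us, xs, zs))))))))"
    by (simp add: joint3_def bind_assoc_pmf bind_return_pmf map_pmf_def)
  also have "\<dots> = q \<bind> (\<lambda>u. k u \<bind> (\<lambda>x. replicate_pmf n q \<bind> (\<lambda>us. memoryless k us \<bind> (\<lambda>xs. V x \<bind> (\<lambda>z.
       memoryless V xs \<bind> (\<lambda>zs. return_pmf (?c u x z (us, xs, zs))))))))"
    by (intro bind_pmf_cong refl) (rule bind_commute_pmf)
  also have "\<dots> = q \<bind> (\<lambda>u. k u \<bind> (\<lambda>x. replicate_pmf n q \<bind> (\<lambda>us. V x \<bind> (\<lambda>z. memoryless k us \<bind> (\<lambda>xs.
       memoryless V xs \<bind> (\<lambda>zs. return_pmf (?c u x z (us, xs, zs))))))))"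
    by (intro bind_pmf_cong refl) (rule bind_commute_pmf)
  also have "\<dots> = q \<bind> (\<lambda>u. k u \<bind> (\<lambda>x. V x \<bind> (\<lambda>z. replicate_pmf n q \<bind> (\<lambda>us. memoryless k us \<bind> (\<lambda>xs.
       memoryless V xs \<bind> (\<lambda>zs. return_pmf (?c u x z (us, xs, zs))))))))"
    by (intro bind_pmf_cong refl) (rule bind_commute_pmf)
  also have "\<dots> = q \<bind> (\<lambda>u. k u \<bind> (\<lambda>x. V x \<bind> (\<lambda>z. map_pmf (?c u x z) (joint3 (memoryless k) (memoryless V) (replicate_pmf n q)))))"
    by (simp add: joint3_def map_bind_pmf map_pmf_comp) (simp add: map_pmf_def)
  also have "\<dots> = map_pmf (\<lambda>zs. (map fst zs, map (\<lambda>z. fst (snd z)) zs, map (\<lambda>z. snd (snd z)) zs))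
      (replicate_pmf (Suc n) (joint3 k V q))"
    unfolding Suc by (simp add: joint3_def bind_assoc_pmf bind_return_pmf map_pmf_def)
  finally show ?case .
qed

lemma pmf_bind_Pair:
  assumes fin: "finite (set_pmf q)"
  shows "pmf (q \<bind> (\<lambda>u. map_pmf (Pair u) (c u))) (u, y) = pmf q u * pmf (c u) y"
proof -
  have "pmf (q \<bind> (\<lambda>u. map_pmf (Pair u) (c u))) (u, y) =
      (\<Sum>v\<in>insert u (set_pmf q). pmf q v * pmf (map_pmf (Pair v) (c v)) (u, y))"
    using fin by (intro pmf_bind_finite) auto
  also have "\<dots> = (\<Sum>v\<in>insert u (set_pmf q). if v = u then pmf q v * pmf (c v) y else 0)"
    by (intro sum.cong) (auto simp: pmf_map_Pair)
  finally show ?thesis using fin by simp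
qed

lemma ex_conditional:
  fixes p :: "('u \<times> 'x::finite) pmf"
  assumes "finite (set_pmf p)"
  obtains k where "p = map_pmf fst p \<bind> (\<lambda>u. map_pmf (Pair u) (k u))"
proof -
  define k where "k u = map_pmf snd (cond_pmf p {z. u = fst z})" for u
  have ne: "set_pmf p \<inter> {z. u = fst z} \<noteq> {}" if "u \<in> set_pmf (map_pmf fst p)" for u
    using that by auto
  have "p = map_pmf fst p \<bind> (\<lambda>u. cond_pmf p {z. u = fst z})"
    by (rule sym, rule bind_cond_pmf_cancel)
       (use ne in \<open>auto simp: vimage_def intro!: arg_cong2[where f = "measure_pmf.prob"]\<close>)
  also have "\<dots> = map_pmf fst p \<bind> (\<lambda>u. map_pmf (Pair u) (k u))"
  proof (rule bind_pmf_cong[OF refl])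
    fix u assume u: "u \<in> set_pmf (map_pmf fst p)"
    have "map_pmf (Pair u) (k u) = map_pmf (\<lambda>z. (u, snd z)) (cond_pmf p {z. u = fst z})"
      by (simp add: k_def map_pmf_comp)
    also have "\<dots> = map_pmf (\<lambda>z. z) (cond_pmf p {z. u = fst z})"
      using set_cond_pmf[OF ne[OF u]] by (intro map_pmf_cong) auto
    finally show "cond_pmf p {z. u = fst z} = map_pmf (Pair u) (k u)" by simp
  qed
  finally show ?thesis by (rule that)
qed

section \<open>Information densities and their means\<close>

lemma mi_expectation:
  assumes "finite (set_pmf P)"
  shows "mi P = measure_pmf.expectation P (\<lambda>t. log 2 (pmf P t / (pmf (map_pmf fst P) (fst t) * pmf (map_pmf snd P) (snd t))))"
  by (subst integral_measure_pmf_real[where A = "set_pmf P"]) (use assms in \<open>auto simp: mi_def mult.commute\<close>)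

lemma cmi_expectation:
  assumes "finite (set_pmf P)"
  shows "cmi P = measure_pmf.expectation P (\<lambda>t. log 2 (pmf P t * pmf (map_pmf fst P) (fst t) /
        (pmf (map_pmf (\<lambda>(c,a,b). (c,a)) P) (fst t, fst (snd t)) *
         pmf (map_pmf (\<lambda>(c,a,b). (c,b)) P) (fst t, snd (snd t)))))"
  by (subst integral_measure_pmf_real[where A = "set_pmf P"]) (use assms in \<open>auto simp: cmi_def mult.commute\<close>)

locale single_letter =
  fixes W :: "'x::finite \<Rightarrow> 'y::finite list pmf" and q :: "'u pmf" and k :: "'u \<Rightarrow> 'x pmf"
  assumes finW: "\<And>x. finite (set_pmf (W x))" and finq: "finite (set_pmf q)"
begin

definition p :: "('u \<times> 'x) pmf" where
  "p = q \<bind> (\<lambda>u. map_pmf (Pair u) (k u))"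

definition joint :: "('u \<times> 'x \<times> 'y list) pmf" where
  "joint = joint3 k W q"

definition yj :: "nat \<Rightarrow> 'u \<times> 'x \<times> 'y list \<Rightarrow> 'y" where
  "yj j z = snd (snd z) ! (j - 1)"

lemma joint_bc_joint: "joint = bc_joint W p"
  unfolding joint_def joint3_def bc_joint_def p_def by (simp add: bind_assoc_pmf bind_map_pmf)

lemma fin_joint: "finite (set_pmf joint)"
  unfolding joint_def joint3_def using finq finW by auto

lemma snd_p: "map_pmf snd p = q \<bind> k"
  unfolding p_def by (simp add: map_bind_pmf map_pmf_comp)

text \<open>These memberships make numerator and denominator of every likelihood ratio positive on
  the support of \<open>joint\<close>.\<close>

lemma joint_pos:
  assumes "z \<in> set_pmf joint"
  shows "fst z \<in> set_pmf q" "fst (snd z) \<in> set_pmf (k (fst z))" "yj j z \<in> set_pmf (out_kernel W j (fst (snd z)))"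
    "yj j z \<in> set_pmf (k (fst z) \<bind> out_kernel W j)" "yj j z \<in> set_pmf (q \<bind> k \<bind> out_kernel W j)"
    "fst (snd z) \<in> set_pmf (q \<bind> k)"
  using assms unfolding joint_def joint3_def yj_def out_kernel_def by (auto, force+)

text \<open>The factor p(u) cancels from p(u,y)/(p(u) p(y)) and leaves the single-letter ratio of
  the test \<open>t0\<close>. Its mean logarithm is therefore the exponent that the threshold may
  approach from below.\<close>

lemma I_UY_expectation:
  "measure_pmf.expectation joint (\<lambda>z. log 2 (pmf (k (fst z) \<bind> out_kernel W j) (yj j z) / pmf (q \<bind> k \<bind> out_kernel W j) (yj j z))) = I_UY W p j"
proof -
  define P where "P = q \<bind> (\<lambda>u. map_pmf (Pair u) (k u \<bind> out_kernel W j))"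
  have P: "map_pmf (\<lambda>z. (fst z, yj j z)) joint = P"
    unfolding P_def joint_def joint3_def yj_def out_kernel_def by (simp add: map_bind_pmf map_pmf_comp)
  have fP: "map_pmf fst P = q" unfolding P_def by (simp add: map_bind_pmf map_pmf_comp bind_return_pmf')
  have sP: "map_pmf snd P = q \<bind> k \<bind> out_kernel W j"
    unfolding P_def by (simp add: map_bind_pmf map_pmf_comp bind_assoc_pmf)
  have pP: "pmf P (u, y) = pmf q u * pmf (k u \<bind> out_kernel W j) y" for u y
    unfolding P_def by (rule pmf_bind_Pair[OF finq])
  have "I_UY W p j = mi P"
    unfolding I_UY_def P[symmetric] joint_bc_joint yj_def by (simp add: case_prod_unfold)
  also have "\<dots> = measure_pmf.expectation P (\<lambda>t. log 2 (pmf P t / (pmf q (fst t) * pmf (q \<bind> k \<bind> out_kernel W j) (snd t))))"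
  proof -
    have "finite (set_pmf P)" by (simp add: P[symmetric] fin_joint)
    from mi_expectation[OF this] show ?thesis unfolding fP sP .
  qed
  also have "\<dots> = measure_pmf.expectation joint (\<lambda>z. log 2 (pmf P (fst z, yj j z) / (pmf q (fst z) * pmf (q \<bind> k \<bind> out_kernel W j) (yj j z))))"
    unfolding P[symmetric] integral_map_pmf by simp
  also have "\<dots> = measure_pmf.expectation joint (\<lambda>z. log 2 (pmf (k (fst z) \<bind> out_kernel W j) (yj j z) / pmf (q \<bind> k \<bind> out_kernel W j) (yj j z)))"
    by (intro integral_cong_AE) (auto simp: AE_measure_pmf_iff pP dest: joint_pos(1) simp: set_pmf_iff)
  finally show ?thesis ..
qed

lemma I_XY_given_U_expectation:
  "measure_pmf.expectation joint (\<lambda>z. log 2 (pmf (out_kernel W j (fst (snd z))) (yj j z) / pmf (k (fst z) \<bind> out_kernel W j) (yj j z))) = I_XY_given_U W p j"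
proof -
  define P where "P = q \<bind> (\<lambda>u. map_pmf (Pair u) (k u \<bind> (\<lambda>x. map_pmf (Pair x) (out_kernel W j x))))"
  have P: "map_pmf (\<lambda>z. (fst z, fst (snd z), yj j z)) joint = P"
    unfolding P_def joint_def joint3_def yj_def out_kernel_def by (simp add: map_bind_pmf map_pmf_comp)
  have 1: "map_pmf fst P = q" unfolding P_def by (simp add: map_bind_pmf map_pmf_comp bind_return_pmf')
  have 2: "map_pmf (\<lambda>(c,a,b). (c,a)) P = q \<bind> (\<lambda>u. map_pmf (Pair u) (k u))"
    unfolding P_def by (simp add: map_bind_pmf map_pmf_comp) (simp add: map_pmf_def)
  have 3: "map_pmf (\<lambda>(c,a,b). (c,b)) P = q \<bind> (\<lambda>u. map_pmf (Pair u) (k u \<bind> out_kernel W j))"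
    unfolding P_def by (simp add: map_bind_pmf map_pmf_comp)
  have fk: "finite (set_pmf (k u))" for u by simp
  have pP: "pmf P (u, x, y) = pmf q u * (pmf (k u) x * pmf (out_kernel W j x) y)" for u x y
    unfolding P_def by (simp add: pmf_bind_Pair[OF finq] pmf_bind_Pair[OF fk])
  have "I_XY_given_U W p j = cmi P"
    unfolding I_XY_given_U_def P[symmetric] joint_bc_joint yj_def by (simp add: case_prod_unfold)
  also have "\<dots> = measure_pmf.expectation P (\<lambda>t. log 2 (pmf P t * pmf q (fst t) /
      (pmf (q \<bind> (\<lambda>u. map_pmf (Pair u) (k u))) (fst t, fst (snd t)) *
       pmf (q \<bind> (\<lambda>u. map_pmf (Pair u) (k u \<bind> out_kernel W j))) (fst t, snd (snd t)))))"
    using cmi_expectation[of P] unfolding 1 2 3 by (simp add: P[symmetric] fin_joint)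
  also have "\<dots> = measure_pmf.expectation joint (\<lambda>z. log 2 (pmf P (fst z, fst (snd z), yj j z) * pmf q (fst z) /
      (pmf (q \<bind> (\<lambda>u. map_pmf (Pair u) (k u))) (fst z, fst (snd z)) *
       pmf (q \<bind> (\<lambda>u. map_pmf (Pair u) (k u \<bind> out_kernel W j))) (fst z, yj j z))))"
    unfolding P[symmetric] integral_map_pmf by simp
  also have "\<dots> = measure_pmf.expectation joint (\<lambda>z. log 2 (pmf (out_kernel W j (fst (snd z))) (yj j z) / pmf (k (fst z) \<bind> out_kernel W j) (yj j z)))"
  proof (intro integral_cong_AE)
    have "pmf P (fst z, fst (snd z), yj j z) * pmf q (fst z) /
      (pmf (q \<bind> (\<lambda>u. map_pmf (Pair u) (k u))) (fst z, fst (snd z)) *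
       pmf (q \<bind> (\<lambda>u. map_pmf (Pair u) (k u \<bind> out_kernel W j))) (fst z, yj j z)) =
       pmf (out_kernel W j (fst (snd z))) (yj j z) / pmf (k (fst z) \<bind> out_kernel W j) (yj j z)" if "z \<in> set_pmf joint" for z
      using joint_pos(1,2)[OF that] unfolding pP pmf_bind_Pair[OF finq] set_pmf_iff by simp
    then show "AE z in measure_pmf joint. log 2 (pmf P (fst z, fst (snd z), yj j z) * pmf q (fst z) /
      (pmf (q \<bind> (\<lambda>u. map_pmf (Pair u) (k u))) (fst z, fst (snd z)) *
       pmf (q \<bind> (\<lambda>u. map_pmf (Pair u) (k u \<bind> out_kernel W j))) (fst z, yj j z))) =
       log 2 (pmf (out_kernel W j (fst (snd z))) (yj j z) / pmf (k (fst z) \<bind> out_kernel W j) (yj j z))"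
      by (simp add: AE_measure_pmf_iff)
  qed auto
  finally show ?thesis ..
qed

lemma I_XY_expectation:
  "measure_pmf.expectation joint (\<lambda>z. log 2 (pmf (out_kernel W j (fst (snd z))) (yj j z) / pmf (q \<bind> k \<bind> out_kernel W j) (yj j z))) = I_XY W (q \<bind> k) j"
proof -
  define P where "P = (q \<bind> k) \<bind> (\<lambda>x. map_pmf (Pair x) (out_kernel W j x))"
  have P: "map_pmf (\<lambda>z. (fst (snd z), yj j z)) joint = P"
    unfolding P_def joint_def joint3_def yj_def out_kernel_def by (simp add: map_bind_pmf map_pmf_comp bind_assoc_pmf)
  have fP: "map_pmf fst P = q \<bind> k" unfolding P_def by (simp add: map_bind_pmf map_pmf_comp bind_return_pmf')
  have sP: "map_pmf snd P = q \<bind> k \<bind> out_kernel W j"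
    unfolding P_def by (simp add: map_bind_pmf map_pmf_comp)
  have pP: "pmf P (x, y) = pmf (q \<bind> k) x * pmf (out_kernel W j x) y" for x y
    unfolding P_def by (rule pmf_bind_Pair) simp
  have "I_XY W (q \<bind> k) j = mi P"
    unfolding I_XY_def P_def out_kernel_def by (simp add: map_pmf_comp)
  also have "\<dots> = measure_pmf.expectation P (\<lambda>t. log 2 (pmf P t / (pmf (q \<bind> k) (fst t) * pmf (q \<bind> k \<bind> out_kernel W j) (snd t))))"
  proof -
    have "finite (set_pmf P)" by (simp add: P[symmetric] fin_joint)
    from mi_expectation[OF this] show ?thesis unfolding fP sP .
  qed
  also have "\<dots> = measure_pmf.expectation joint (\<lambda>z. log 2 (pmf P (fst (snd z), yj j z) / (pmf (q \<bind> k) (fst (snd z)) * pmf (q \<bind> k \<bind> out_kernel W j) (yj j z))))"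
    unfolding P[symmetric] integral_map_pmf by simp
  also have "\<dots> = measure_pmf.expectation joint (\<lambda>z. log 2 (pmf (out_kernel W j (fst (snd z))) (yj j z) / pmf (q \<bind> k \<bind> out_kernel W j) (yj j z)))"
  proof (intro integral_cong_AE)
    have "pmf P (fst (snd z), yj j z) / (pmf (q \<bind> k) (fst (snd z)) * pmf (q \<bind> k \<bind> out_kernel W j) (yj j z)) =
        pmf (out_kernel W j (fst (snd z))) (yj j z) / pmf (q \<bind> k \<bind> out_kernel W j) (yj j z)" if "z \<in> set_pmf joint" for z
      using joint_pos(6)[OF that] unfolding pP set_pmf_iff by simp
    then show "AE z in measure_pmf joint. log 2 (pmf P (fst (snd z), yj j z) / (pmf (q \<bind> k) (fst (snd z)) * pmf (q \<bind> k \<bind> out_kernel W j) (yj j z))) =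
        log 2 (pmf (out_kernel W j (fst (snd z))) (yj j z) / pmf (q \<bind> k \<bind> out_kernel W j) (yj j z))"
      by (simp add: AE_measure_pmf_iff)
  qed auto
  finally show ?thesis ..
qed

end

context single_letter
begin

text \<open>This and the next two are the probabilities that the transmitted block fails the tests
  \<open>t1\<close>, \<open>t2\<close> and \<open>t0\<close>, with the n-letter likelihoods written
  out as products.\<close>

definition miss1 :: "nat \<Rightarrow> nat \<Rightarrow> real \<Rightarrow> real" where
  "miss1 j n g = measure (replicate_pmf n joint) {zs. \<not> prod_list (map (\<lambda>z. pmf (out_kernel W j (fst (snd z))) (yj j z)) zs)
    > g * prod_list (map (\<lambda>z. pmf (k (fst z) \<bind> out_kernel W j) (yj j z)) zs)}"

definition miss2 :: "nat \<Rightarrow> nat \<Rightarrow> real \<Rightarrow> real" where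
  "miss2 j n g = measure (replicate_pmf n joint) {zs. \<not> prod_list (map (\<lambda>z. pmf (out_kernel W j (fst (snd z))) (yj j z)) zs)
    > g * prod_list (map (\<lambda>z. pmf (q \<bind> k \<bind> out_kernel W j) (yj j z)) zs)}"

definition miss0 :: "nat \<Rightarrow> nat \<Rightarrow> real \<Rightarrow> real" where
  "miss0 j n g = measure (replicate_pmf n joint) {zs. \<not> prod_list (map (\<lambda>z. pmf (k (fst z) \<bind> out_kernel W j) (yj j z)) zs)
    > g * prod_list (map (\<lambda>z. pmf (q \<bind> k \<bind> out_kernel W j) (yj j z)) zs)}"

lemma miss_tendsto:
  assumes "\<delta> > 0"
  shows "(\<lambda>n. miss1 j n (2 powr (real n * (I_XY_given_U W p j - \<delta>)))) \<longlonglongrightarrow> 0"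
    and "(\<lambda>n. miss2 j n (2 powr (real n * (I_XY W (map_pmf snd p) j - \<delta>)))) \<longlonglongrightarrow> 0"
    and "(\<lambda>n. miss0 j n (2 powr (real n * (I_UY W p j - \<delta>)))) \<longlonglongrightarrow> 0"
  unfolding miss1_def miss2_def miss0_def snd_p
  by (rule likelihood_ratio_typical[OF fin_joint _ I_XY_given_U_expectation assms]
        likelihood_ratio_typical[OF fin_joint _ I_XY_expectation assms]
        likelihood_ratio_typical[OF fin_joint _ I_UY_expectation assms];
      use joint_pos in \<open>auto simp: pmf_positive_iff simp del: set_bind_pmf\<close>)+

definition code_bound :: "nat set \<Rightarrow> nat \<Rightarrow> nat \<Rightarrow> real \<Rightarrow> (nat \<Rightarrow> real) \<Rightarrow> (nat \<Rightarrow> real) \<Rightarrow> nat \<Rightarrow> nat \<Rightarrow> real" where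
  "code_bound J w n g0 g1 g2 L M =
    (\<Sum>j\<in>J. miss1 j n (g1 j) + miss2 j n (g2 j) + (real M - 1) / g1 j + (real L - 1) * real M / g2 j) +
    miss0 w n g0 + (real L - 1) / g0"

text \<open>M1 is split by division with remainder by \<open>M\<close>. The quotient, which is below
  \<open>A\<close>, is joined with M2 to the cloud index m2 * A + m1 div M, and the remainder is the
  satellite index; hence the number N2 * A of clouds.\<close>

lemma ex_code:
  assumes K: "K \<ge> 2" and g: "g0 > 0" "\<And>j. g1 j > 0" "\<And>j. g2 j > 0"
    and pos: "A > 0" "M > 0" "N1 > 0" "N2 > 0" and N1: "N1 \<le> A * M"
  shows "\<exists>f g. (\<forall>m1<N1. \<forall>m2<N2. length (f m1 m2) = n) \<and>
    avg_err W K N1 N2 f g \<le> code_bound {1..K-1} K n g0 g1 g2 (N2 * A) M"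
proof -
  let ?Q = "replicate_pmf n q" and ?L = "N2 * A"
  interpret S: superposition ?Q "memoryless k" "channel_out W" recv K g0 g1 g2 ?L M
    by unfold_locales (use finite_replicate_pmf[OF finq] finite_memoryless[of k] g in auto)
  have Vr: "S.Vr j = memoryless (out_kernel W j)" for j
  proof
    fix xs
    have rec: "recv j = map (\<lambda>y. y ! (j - 1))" by (simp add: recv_def fun_eq_iff)
    show "S.Vr j xs = memoryless (out_kernel W j) xs"
      unfolding S.Vr_def unfolding rec channel_out_memoryless memoryless_map out_kernel_def[abs_def] ..
  qed
  let ?tr = "\<lambda>zs. (map fst zs, map (\<lambda>z. fst (snd z)) zs, map (\<lambda>z. snd (snd z)) zs)"
  have joint: "S.joint = map_pmf ?tr (replicate_pmf n joint)"
    unfolding S.joint_def joint_def unfolding joint3_def[symmetric] channel_out_memoryless by (rule joint3_replicate)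
  have r: "recv j (map (\<lambda>z. snd (snd z)) zs) = map (yj j) zs" for j and zs :: "('u \<times> 'x \<times> 'y list) list"
    by (simp add: recv_def yj_def)
  have len: "AE zs in measure_pmf (replicate_pmf n joint). length zs = n"
    by (simp add: AE_measure_pmf_iff set_replicate_pmf)
  have m1: "measure S.joint {(u, x, z). \<not> S.t1 j u x (recv j z)} = miss1 j n (g1 j)" for j
    unfolding joint miss1_def measure_map_pmf
    by (simp add: vimage_def S.t1_def Vr r memoryless_bind pmf_memoryless)
  have m2: "measure S.joint {(u, x, z). \<not> S.t2 j x (recv j z)} = miss2 j n (g2 j)" for j
    unfolding joint miss2_def measure_map_pmf
    by (rule measure_pmf.finite_measure_eq_AE; (rule AE_mp[OF len])?)
       (auto simp: S.t2_def Vr r replicate_bind_memoryless pmf_memoryless pmf_replicate)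
  have m0: "measure S.joint {(u, x, z). \<not> S.t0 u (recv K z)} = miss0 K n g0"
    unfolding joint miss0_def measure_map_pmf
    by (rule measure_pmf.finite_measure_eq_AE; (rule AE_mp[OF len])?)
       (auto simp: S.t0_def Vr r replicate_bind_memoryless memoryless_bind pmf_memoryless pmf_replicate)
  have bound: "S.bound {1..K-1} = code_bound {1..K-1} K n g0 g1 g2 ?L M"
    unfolding S.bound_def code_bound_def m1 m2 m0 ..
  define e where "e = (\<lambda>(m1, m2). (m2 * A + m1 div M, m1 mod M))"
  have div: "m1 div M < A" if "m1 < N1" for m1
    using that N1 pos by (intro less_mult_imp_div_less) auto
  have e_rng: "fst (e m) < ?L \<and> snd (e m) < M" if "m \<in> {..<N1} \<times> {..<N2}" for m
  proof -
    obtain m1 m2 where m: "m = (m1, m2)" "m1 < N1" "m2 < N2" using \<open>m \<in> _\<close> by (cases m) auto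
    have "m2 * A + m1 div M < m2 * A + A" using div[OF m(2)] by simp
    also have "\<dots> = Suc m2 * A" by simp
    also have "\<dots> \<le> N2 * A" using m(3) by (intro mult_le_mono1) simp
    finally show ?thesis using pos by (simp add: m(1) e_def)
  qed
  obtain X ds dw where X: "\<forall>l<?L. \<forall>s<M. X l s \<in> set_pmf (?Q \<bind> memoryless k)"
    and err: "(\<Sum>m\<in>{..<N1} \<times> {..<N2}. measure (channel_out W (X (fst (e m)) (snd (e m))))
      {z. (\<exists>j\<in>{1..K-1}. ds j (recv j z) \<noteq> e m) \<or> dw (recv K z) \<noteq> fst (e m)}) \<le>
      real (card ({..<N1} \<times> {..<N2})) * S.bound {1..K-1}"
    using S.ex_codebook[of "{1..K-1}" "{..<N1} \<times> {..<N2}" e] e_rng by auto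
  define f where "f m1 m2 = X (fst (e (m1, m2))) (snd (e (m1, m2)))" for m1 m2
  define gd where "gd j y = (if j = K then (0, dw y div A) else ((fst (ds j y) mod A) * M + snd (ds j y), fst (ds j y) div A))" for j y
  have "length (f m1 m2) = n" if "m1 < N1" "m2 < N2" for m1 m2
    using X e_rng[of "(m1, m2)"] that unfolding f_def replicate_bind_memoryless set_replicate_pmf by auto
  moreover have "avg_err W K N1 N2 f gd \<le> code_bound {1..K-1} K n g0 g1 g2 ?L M"
  proof -
    have dec: "fst (gd j y) = m1 \<and> snd (gd j y) = m2" if "ds j y = e (m1, m2)" "j \<noteq> K" "m1 < N1" for j y m1 m2
      using that div[OF that(3)] pos by (simp add: gd_def e_def)
    have decK: "snd (gd K y) = m2" if "dw y = fst (e (m1, m2))" "m1 < N1" for y m1 m2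
      using that div[OF that(2)] pos by (simp add: gd_def e_def)
    have "(\<Sum>m1<N1. \<Sum>m2<N2. measure (channel_out W (f m1 m2))
        {ys. \<exists>j\<in>{1..K}. (j \<noteq> K \<and> fst (gd j (recv j ys)) \<noteq> m1) \<or> (j \<noteq> K - 1 \<and> snd (gd j (recv j ys)) \<noteq> m2)})
      \<le> (\<Sum>m1<N1. \<Sum>m2<N2. measure (channel_out W (f m1 m2))
        {z. (\<exists>j\<in>{1..K-1}. ds j (recv j z) \<noteq> e (m1, m2)) \<or> dw (recv K z) \<noteq> fst (e (m1, m2))})"
    proof (intro sum_mono measure_pmf.finite_measure_mono)
      fix m1 m2 assume m: "m1 \<in> {..<N1}" "m2 \<in> {..<N2}"
      show "{ys. \<exists>j\<in>{1..K}. (j \<noteq> K \<and> fst (gd j (recv j ys)) \<noteq> m1) \<or> (j \<noteq> K - 1 \<and> snd (gd j (recv j ys)) \<noteq> m2)}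
        \<subseteq> {z. (\<exists>j\<in>{1..K-1}. ds j (recv j z) \<noteq> e (m1, m2)) \<or> dw (recv K z) \<noteq> fst (e (m1, m2))}"
      proof (intro subsetI CollectI)
        fix ys assume "ys \<in> {ys. \<exists>j\<in>{1..K}. (j \<noteq> K \<and> fst (gd j (recv j ys)) \<noteq> m1) \<or> (j \<noteq> K - 1 \<and> snd (gd j (recv j ys)) \<noteq> m2)}"
        then obtain j where j: "j \<in> {1..K}"
          "(j \<noteq> K \<and> fst (gd j (recv j ys)) \<noteq> m1) \<or> (j \<noteq> K - 1 \<and> snd (gd j (recv j ys)) \<noteq> m2)" by blast
        show "(\<exists>j\<in>{1..K-1}. ds j (recv j ys) \<noteq> e (m1, m2)) \<or> dw (recv K ys) \<noteq> fst (e (m1, m2))"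
        proof (cases "j = K")
          case True
          then show ?thesis using j(2) decK[of "recv K ys" m1 m2] m by auto
        next
          case False
          then have "j \<in> {1..K-1}" using j(1) by auto
          moreover have "ds j (recv j ys) \<noteq> e (m1, m2)" using j(2) dec[of j "recv j ys" m1 m2] m False by auto
          ultimately show ?thesis by blast
        qed
      qed
    qed simp
    also have "\<dots> \<le> (real N1 * real N2) * code_bound {1..K-1} K n g0 g1 g2 ?L M"
      using err unfolding f_def bound by (simp add: sum.cartesian_product card_cartesian_product case_prod_unfold)
    finally show ?thesis
      unfolding avg_err_def using pos by (simp add: divide_le_eq mult.commute)
  qed
  ultimately show ?thesis by blast
qed

end

section \<open>Choice of rates and the boundary of the region\<close>

lemma msg_size_upper:
  assumes "R \<ge> 0"
  shows "real (msg_size n R) \<le> 2 * 2 powr (real n * R)" "R = 0 \<Longrightarrow> msg_size n R = 1"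
proof -
  have "2 powr log 2 (msg_size n R) \<le> 2 powr (real n * R + 1)"
    using msg_size_bounds(3)[OF assms, of n] by (intro powr_mono) auto
  then show "real (msg_size n R) \<le> 2 * 2 powr (real n * R)"
    using msg_size_bounds(1)[OF assms, of n] by (simp add: powr_add mult.commute)
  show "R = 0 \<Longrightarrow> msg_size n R = 1" by (simp add: msg_size_def)
qed

text \<open>The product of the two ceilings is an integer above 2 to the n (a + b). It guarantees
  that M1 fits into the index pairs when its rate is split into two parts.\<close>

lemma msg_size_add:
  assumes "a \<ge> 0" "b \<ge> 0"
  shows "msg_size n (a + b) \<le> msg_size n a * msg_size n b"
proof -
  have "2 powr (real n * c) \<le> real (msg_size n c)" for c
    unfolding msg_size_def by linarith
  then have "2 powr (real n * a) * 2 powr (real n * b) \<le> real (msg_size n a) * real (msg_size n b)"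
    by (intro mult_mono) auto
  then have "2 powr (real n * (a + b)) \<le> real_of_int (int (msg_size n a * msg_size n b))"
    by (simp add: powr_add distrib_left)
  then have "\<lceil>2 powr (real n * (a + b))\<rceil> \<le> int (msg_size n a * msg_size n b)"
    by (rule ceiling_le)
  then show ?thesis unfolding msg_size_def[of n "a + b"] by linarith
qed

text \<open>\<open>Z\<close> bounds the number of wrong candidates, of exponent \<rho>. Half of the
  gap I - \<rho> is spent on lowering the threshold and the other half remains as decay. If
  \<open>Z\<close> vanishes identically any \<delta> will do, which admits rate 0 also when I =
  0.\<close>

lemma exponent_tendsto_0:
  fixes Z :: "nat \<Rightarrow> real"
  assumes "\<And>n. 0 \<le> Z n" "\<And>n. Z n \<le> c * 2 powr (real n * \<rho>)" "\<rho> < I \<or> (\<forall>n. Z n = 0)"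
  obtains \<delta> where "\<delta> > 0" "(\<lambda>n. Z n / 2 powr (real n * (I - \<delta>))) \<longlonglongrightarrow> 0"
proof (cases "\<rho> < I")
  case True
  define \<delta> where "\<delta> = (I - \<rho>) / 2"
  have \<delta>: "\<delta> > 0" using True by (simp add: \<delta>_def)
  have "(\<lambda>n. c * (2 powr (- \<delta>)) ^ n) \<longlonglongrightarrow> c * 0"
    using \<delta> by (intro tendsto_mult tendsto_const LIMSEQ_realpow_zero) (auto simp: powr_less_one)
  moreover have "Z n / 2 powr (real n * (I - \<delta>)) \<le> c * (2 powr (- \<delta>)) ^ n" for n
  proof -
    have ex: "real n * \<rho> - real n * (I - \<delta>) = (- \<delta>) * real n" by (simp add: \<delta>_def field_simps)
    have "(2 powr (- \<delta>)) ^ n = (2 powr (- \<delta>)) powr real n" by (rule powr_realpow[symmetric]) simp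
    then have pw: "2 powr (real n * \<rho> - real n * (I - \<delta>)) = (2 powr (- \<delta>)) ^ n"
      unfolding ex by (simp only: powr_powr)
    have "Z n / 2 powr (real n * (I - \<delta>)) \<le> c * 2 powr (real n * \<rho>) / 2 powr (real n * (I - \<delta>))"
      by (intro divide_right_mono assms) auto
    also have "\<dots> = c * 2 powr (real n * \<rho> - real n * (I - \<delta>))" by (simp add: powr_diff)
    also have "\<dots> = c * (2 powr (- \<delta>)) ^ n" unfolding pw ..
    finally show ?thesis .
  qed
  moreover have "0 \<le> Z n / 2 powr (real n * (I - \<delta>))" for n using assms(1) by simp
  ultimately have "(\<lambda>n. Z n / 2 powr (real n * (I - \<delta>))) \<longlonglongrightarrow> 0"
    using tendsto_sandwich[of "\<lambda>_. 0" "\<lambda>n. Z n / 2 powr (real n * (I - \<delta>))" sequentially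
        "\<lambda>n. c * (2 powr (- \<delta>)) ^ n" 0] by simp
  with \<delta> show ?thesis by (rule that)
next
  case False
  then show ?thesis using assms(3) by (intro that[of 1]) auto
qed

text \<open>\<open>a0\<close> is the part of the rate of M1 that moves into the cloud,
  \<open>a1\<close> the part left to the satellites. The conditions stand for decoding the cloud at
  receiver K, the satellite within the right cloud, and the pair when the cloud is wrong, the last
  two at receivers 1..K-1.\<close>

lemma achievable_split:
  fixes W :: "'x::finite \<Rightarrow> 'y::finite list pmf" and p :: "(nat \<times> 'x) pmf"
  assumes K: "K \<ge> 2" and finW: "\<And>x. finite (set_pmf (W x))" and finp: "finite (set_pmf p)"
    and nn: "a0 \<ge> 0" "a1 \<ge> 0" "b \<ge> 0"
    and c0: "b + a0 < I_UY W p K \<or> b + a0 = 0"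
    and c1: "\<And>j. j \<in> {1..K-1} \<Longrightarrow> a1 < I_XY_given_U W p j \<or> a1 = 0"
    and c2: "\<And>j. j \<in> {1..K-1} \<Longrightarrow> b + a0 + a1 < I_XY W (map_pmf snd p) j \<or> b + a0 + a1 = 0"
  shows "achievable W K (a0 + a1, b)"
proof -
  obtain k where k: "p = map_pmf fst p \<bind> (\<lambda>u. map_pmf (Pair u) (k u))"
    using ex_conditional[OF finp] .
  interpret SL: single_letter W "map_pmf fst p" k
    by unfold_locales (use finW finp in auto)
  have p: "SL.p = p" unfolding SL.p_def using k by simp
  define A M where "A n = msg_size n a0" and "M n = msg_size n a1" for n
  define L where "L n = msg_size n b * A n" for n
  have pos: "A n > 0" "M n > 0" "L n > 0" for n
    using msg_size_bounds(1) nn by (auto simp: A_def M_def L_def)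
  have M_up: "real (M n) \<le> 2 * 2 powr (real n * a1)" for n
    unfolding M_def by (rule msg_size_upper(1)[OF nn(2)])
  have L_up: "real (L n) \<le> 4 * 2 powr (real n * (b + a0))" for n
  proof -
    have "real (L n) \<le> (2 * 2 powr (real n * b)) * (2 * 2 powr (real n * a0))"
      unfolding L_def A_def of_nat_mult using nn by (intro mult_mono msg_size_upper(1)) auto
    then show ?thesis by (simp add: powr_add distrib_left)
  qed
  have L1: "L n = 1" if "b + a0 = 0" for n
    using that nn msg_size_upper(2)[of b n] msg_size_upper(2)[of a0 n] by (simp add: L_def A_def)
  have M1: "M n = 1" if "a1 = 0" for n
    using that msg_size_upper(2)[of a1 n] by (simp add: M_def)
  have "\<exists>\<delta>>0. (\<lambda>n. (real (L n) - 1) / 2 powr (real n * (I_UY W p K - \<delta>))) \<longlonglongrightarrow> 0"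
    by (rule exponent_tendsto_0[of "\<lambda>n. real (L n) - 1" 4 "b + a0" "I_UY W p K"])
       (use pos(3) L_up c0 L1 in \<open>auto simp: Suc_le_eq intro: order_trans[OF _ L_up]\<close>)
  then obtain d0 where d0: "d0 > 0" "(\<lambda>n. (real (L n) - 1) / 2 powr (real n * (I_UY W p K - d0))) \<longlonglongrightarrow> 0"
    by blast
  have "\<exists>\<delta>>0. j \<in> {1..K-1} \<longrightarrow> (\<lambda>n. (real (M n) - 1) / 2 powr (real n * (I_XY_given_U W p j - \<delta>))) \<longlonglongrightarrow> 0" for j
  proof (cases "j \<in> {1..K-1}")
    case True
    show ?thesis
      by (rule exponent_tendsto_0[of "\<lambda>n. real (M n) - 1" 2 a1 "I_XY_given_U W p j"])
         (use pos(2) M_up c1[OF True] M1 in \<open>auto simp: Suc_le_eq intro: order_trans[OF _ M_up]\<close>)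
  qed (auto intro: exI[of _ 1])
  then have "\<forall>j. \<exists>\<delta>. \<delta> > 0 \<and> (j \<in> {1..K-1} \<longrightarrow> (\<lambda>n. (real (M n) - 1) / 2 powr (real n * (I_XY_given_U W p j - \<delta>))) \<longlonglongrightarrow> 0)" by blast
  from choice[OF this] obtain d1 where d1: "\<And>j. d1 j > 0" "\<And>j. j \<in> {1..K-1} \<Longrightarrow>
      (\<lambda>n. (real (M n) - 1) / 2 powr (real n * (I_XY_given_U W p j - d1 j))) \<longlonglongrightarrow> 0"
    by blast
  have LM: "0 \<le> (real (L n) - 1) * real (M n)" "(real (L n) - 1) * real (M n) \<le> 8 * 2 powr (real n * (b + a0 + a1))" for n
  proof -
    have l: "real (L n) \<ge> 1" using pos(3)[of n] by simp
    then show "0 \<le> (real (L n) - 1) * real (M n)" by simp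
    have "(real (L n) - 1) * real (M n) \<le> (4 * 2 powr (real n * (b + a0))) * (2 * 2 powr (real n * a1))"
      using L_up[of n] l by (intro mult_mono M_up) auto
    then show "(real (L n) - 1) * real (M n) \<le> 8 * 2 powr (real n * (b + a0 + a1))"
      by (simp add: powr_add distrib_left)
  qed
  have "\<exists>\<delta>>0. j \<in> {1..K-1} \<longrightarrow> (\<lambda>n. (real (L n) - 1) * real (M n) / 2 powr (real n * (I_XY W (map_pmf snd p) j - \<delta>))) \<longlonglongrightarrow> 0" for j
  proof (cases "j \<in> {1..K-1}")
    case True
    have "b + a0 = 0" if "b + a0 + a1 = 0" using that nn by simp
    then have z: "b + a0 + a1 < I_XY W (map_pmf snd p) j \<or> (\<forall>n. (real (L n) - 1) * real (M n) = 0)"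
      using c2[OF True] L1 by auto
    show ?thesis
      by (rule exponent_tendsto_0[OF LM z]) auto
  qed (auto intro: exI[of _ 1])
  then have "\<forall>j. \<exists>\<delta>. \<delta> > 0 \<and> (j \<in> {1..K-1} \<longrightarrow> (\<lambda>n. (real (L n) - 1) * real (M n) / 2 powr (real n * (I_XY W (map_pmf snd p) j - \<delta>))) \<longlonglongrightarrow> 0)" by blast
  from choice[OF this] obtain d2 where d2: "\<And>j. d2 j > 0" "\<And>j. j \<in> {1..K-1} \<Longrightarrow>
      (\<lambda>n. (real (L n) - 1) * real (M n) / 2 powr (real n * (I_XY W (map_pmf snd p) j - d2 j))) \<longlonglongrightarrow> 0"
    by blast
  define g0 where "g0 n = 2 powr (real n * (I_UY W p K - d0))" for n
  define g1 where "g1 n j = 2 powr (real n * (I_XY_given_U W p j - d1 j))" for n j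
  define g2 where "g2 n j = 2 powr (real n * (I_XY W (map_pmf snd p) j - d2 j))" for n j
  define B where "B n = SL.code_bound {1..K-1} K n (g0 n) (g1 n) (g2 n) (L n) (M n)" for n
  have "B \<longlonglongrightarrow> (\<Sum>j\<in>{1..K-1}. 0 + 0 + 0 + 0) + 0 + 0"
    unfolding B_def SL.code_bound_def g0_def g1_def g2_def
    by (intro tendsto_add tendsto_sum SL.miss_tendsto[unfolded p] d0 d1 d2) auto
  then have B0: "B \<longlonglongrightarrow> 0" by simp
  have codes: "\<exists>f g. (\<forall>m1<msg_size n (a0 + a1). \<forall>m2<msg_size n b. length (f m1 m2) = n) \<and>
      avg_err W K (msg_size n (a0 + a1)) (msg_size n b) f g \<le> B n" for n
    unfolding B_def L_def
    by (rule SL.ex_code[OF K])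
       (use pos nn msg_size_bounds(1) msg_size_add[OF nn(1,2)] in \<open>auto simp: g0_def g1_def g2_def A_def M_def\<close>)
  show ?thesis
    unfolding achievable_def fst_conv snd_conv
  proof (intro conjI allI impI)
    fix \<epsilon> :: real assume "\<epsilon> > 0"
    then obtain N where "\<forall>n\<ge>N. B n < \<epsilon>"
      using order_tendstoD(2)[OF B0, of \<epsilon>] by (auto simp: eventually_sequentially)
    then show "\<exists>N. \<forall>n\<ge>N. \<exists>f g. (\<forall>m1<msg_size n (a0 + a1). \<forall>m2<msg_size n b. length (f m1 m2) = n) \<and>
        avg_err W K (msg_size n (a0 + a1)) (msg_size n b) f g \<le> \<epsilon>"
      using codes by (meson less_imp_le order_trans)
  qed (use nn in auto)
qed

lemma subset_capacity_region:
  fixes W :: "'x::finite \<Rightarrow> 'y::finite list pmf"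
  assumes K3: "K \<ge> 3" and finW: "\<And>x. finite (set_pmf (W x))"
    and cls: "((\<forall>j\<in>{1..K-2}. more_capable W j (K - 1)) \<and> more_capable W (K - 1) K)
            \<or> (\<forall>i\<in>{1..K-1}. less_noisy W i K)"
    and ab: "a \<ge> 0" "b \<ge> 0" and reg: "within_slack W K p 0 a b"
  shows "(a, b) \<in> capacity_region W K"
proof -
  have fin: "finite (set_pmf p)" and r1: "b \<le> I_UY W p K"
    and r2: "\<And>j. j \<in> {1..K-1} \<Longrightarrow> b + a \<le> I_XY_given_U W p j + I_UY W p K"
    and r3: "b + a \<le> I_XY W (map_pmf snd p) (K - 1)"
    using reg unfolding within_slack_def by auto
  \<comment> \<open>In class (A) the third bound is passed on to \<open>j\<close> by the more
    capable ordering. In class (B) it is the second bound that is used, with I(U;Y_K) <= I(U;Y_j)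
    and the chain rule.\<close>
  have r3': "b + a \<le> I_XY W (map_pmf snd p) j" if j: "j \<in> {1..K-1}" for j
    using cls
  proof
    assume A: "(\<forall>j\<in>{1..K-2}. more_capable W j (K - 1)) \<and> more_capable W (K - 1) K"
    show ?thesis
    proof (cases "j = K - 1")
      case False
      then have "more_capable W j (K - 1)" using A j by auto
      then show ?thesis using r3 unfolding more_capable_def by (meson order_trans)
    qed (use r3 in simp)
  next
    assume "\<forall>i\<in>{1..K-1}. less_noisy W i K"
    then have "I_UY W p K \<le> I_UY W p j" using j fin unfolding less_noisy_def by blast
    then show ?thesis using r2[OF j] chain_rule[OF fin, of W j] by linarith
  qed
  \<comment> \<open>As much of M1 as receiver K can still decode goes into the cloud. Either all of
    it fits and a1 = 0, or b + a0 = I(U;Y_K), and the second bound then leaves a1 <=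
    I(X;Y_j|U).\<close>
  define a0 where "a0 = min a (I_UY W p K - b)"
  define a1 where "a1 = a - a0"
  have a0: "a0 \<ge> 0" "a1 \<ge> 0" "a0 + a1 = a" "b + a0 \<le> I_UY W p K"
    using ab r1 by (auto simp: a0_def a1_def)
  have a1: "a1 \<le> I_XY_given_U W p j \<or> a1 = 0" if "j \<in> {1..K-1}" for j
    using r2[OF that] by (auto simp: a1_def a0_def min_def)
  \<comment> \<open>Scaling by t < 1 makes every constraint with a nonzero rate strict; the closure
    in \<open>capacity_region\<close> recovers (a, b) as t tends to 1.\<close>
  have ach: "achievable W K (t * a, t * b)" if t: "0 < t" "t < 1" for t
  proof -
    have sc: "t * c < i \<or> t * c = 0" if "c \<ge> 0" "c \<le> i \<or> c = 0" for c i
    proof (cases "c = 0")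
      case False
      then have "t * c < c" "c \<le> i" using that t mult_strict_right_mono[of t 1 c] by auto
      then show ?thesis by linarith
    qed simp
    have "achievable W K (t * a0 + t * a1, t * b)"
    proof (rule achievable_split[where W = W and K = K and p = p])
      show "t * b + t * a0 < I_UY W p K \<or> t * b + t * a0 = 0"
        using sc[of "b + a0"] a0 ab by (simp add: distrib_left)
      show "t * a1 < I_XY_given_U W p j \<or> t * a1 = 0" if "j \<in> {1..K-1}" for j
        using sc[of a1] a1[OF that] a0 by blast
      show "t * b + t * a0 + t * a1 < I_XY W (map_pmf snd p) j \<or> t * b + t * a0 + t * a1 = 0" if "j \<in> {1..K-1}" for j
      proof -
        have e: "t * b + t * a0 + t * a1 = t * (b + a)" unfolding a0(3)[symmetric] by (simp add: algebra_simps)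
        show ?thesis unfolding e using sc[of "b + a"] r3'[OF that] ab by simp
      qed
    qed (use K3 finW fin t a0 ab in auto)
    moreover have "t * a0 + t * a1 = t * a" unfolding a0(3)[symmetric] by (simp add: distrib_left)
    ultimately show ?thesis by simp
  qed
  define t where "t n = 1 - 1 / real (n + 2)" for n :: nat
  have "t \<longlonglongrightarrow> 1 - 0"
    unfolding t_def by (intro tendsto_diff tendsto_const) real_asymp
  then have "(\<lambda>n. (t n * a, t n * b)) \<longlonglongrightarrow> (1 * a, 1 * b)"
    by (intro tendsto_Pair tendsto_mult tendsto_const) auto
  moreover have "achievable W K (t n * a, t n * b)" for n
    by (rule ach) (auto simp: t_def field_simps)
  ultimately show ?thesis
    unfolding capacity_region_def closure_sequential by (intro exI[of _ "\<lambda>n. (t n * a, t n * b)"]) auto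
qed

theorem theorem2:
  fixes W :: "'x::finite \<Rightarrow> 'y::finite list pmf" and K :: nat
  assumes K3: "K \<ge> 3"
    and W_len: "\<forall>x. \<forall>ys\<in>set_pmf (W x). length ys = K"
    and cls: "((\<forall>j\<in>{1..K-2}. more_capable W j (K - 1)) \<and> more_capable W (K - 1) K)
            \<or> (\<forall>i\<in>{1..K-1}. less_noisy W i K)"
  shows "capacity_region W K =
    {(RK, RK1). RK \<ge> 0 \<and> RK1 \<ge> 0 \<and>
       (\<exists>p :: (nat \<times> 'x) pmf. finite (set_pmf p) \<and>
          RK1 \<le> I_UY W p K \<and>
          (\<forall>j\<in>{1..K-1}. RK1 + RK \<le> I_XY_given_U W p j + I_UY W p K) \<and>
          RK1 + RK \<le> I_XY W (map_pmf snd p) (K - 1))}"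
proof -
  \<comment> \<open>The type of output lists is infinite; the fixed length K over a finite alphabet
    makes the supports finite, as the entropy sums require.\<close>
  have finW: "finite (set_pmf (W x))" for x
  proof (rule finite_subset)
    show "set_pmf (W x) \<subseteq> {ys. set ys \<subseteq> UNIV \<and> length ys = K}" using W_len by auto
  qed (rule finite_lists_length_eq, simp)
  have "(RK, RK1) \<in> capacity_region W K \<longleftrightarrow> RK \<ge> 0 \<and> RK1 \<ge> 0 \<and> (\<exists>p. within_slack W K p 0 RK RK1)" for RK RK1
    using capacity_region_subset[OF K3 finW cls] subset_capacity_region[OF K3 finW cls] by blast
  then show ?thesis unfolding within_slack_def by (auto simp: set_eq_iff)
qed

end
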